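(* Let $\mathcal{A}$ be an Arens regular Banach algebra, and let $M$ be a reflexive Banach $\mathcal{A}$-module. Let $\mathcal{B}=M\oplus_1\mathcal{A}$ be the module extension Banach algebra. Then: (i) $\mathcal{B}$ is Arens regular. (ii) $\mathcal{B}^{**}=(M\oplus_1\mathcal{A})^{**}$ is Connes amenable if and only if $M=0$ and $\mathcal{A}^{**}$ is Connes amenable.
   Context: "Module" means Banach bimodule. For a Banach algebra $\mathcal{A}$ and a Banach $\mathcal{A}$-module $M$, $M\oplus_1\mathcal{A}$ is the Banach space of pairs $(m,a)$ with norm $\|(m,a)\|=\|m\|+\|a\|$, made into a Banach algebra by the product $(m_1,a_1)(m_2,a_2)=(m_1\cdot a_2+a_1\cdot m_2,\;a_1a_2)$. For a Banach algebra $\mathcal{C}$, the second dual $\mathcal{C}^{**}$ is a Banach algebra under the first Arens product, $a''b''=w^*\text{-}\lim_i\lim_j a_ib_j$ whenever $(a_i),(b_j)$ are bounded nets in $\mathcal{C}$ with $a_i\to a''$, $b_j\to b''$ weak$^*$. $\mathcal{C}$ is Arens regular if its two Arens products on $\mathcal{C}^{**}$ coincide; then $\mathcal{C}^{**}$ is a dual Banach algebra with predual $\mathcal{C}^*$, and Connes amenability of $\mathcal{C}^{**}$ is understood with respect to this predual. A Banach algebra $\mathcal{D}$ is dual if there is a closed submodule $\mathcal{D}_*$ of $\mathcal{D}^*$ with $\mathcal{D}=(\mathcal{D}_* )^*$. A dual Banach $\mathcal{D}$-module $X$ (i.e. $X$ is the dual of a Banach $\mathcal{D}$-module, with the dual actions)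 over a dual Banach algebra $\mathcal{D}$ is normal if for every $x\in X$ the maps $a\mapsto a\cdot x$ and $a\mapsto x\cdot a$ are weak$^*$-weak$^*$-continuous from $\mathcal{D}$ to $X$. A derivation $D:\mathcal{D}\to X$ is a linear map with $D(ab)=D(a)\cdot b+a\cdot D(b)$; it is inner if $D(a)=a\cdot x-x\cdot a$ for some $x\in X$ and all $a$. A dual Banach algebra $\mathcal{D}$ is Connes amenable if every weak$^*$-weak$^*$-continuous derivation from $\mathcal{D}$ into every normal dual Banach $\mathcal{D}$-module is inner. *)

theory Defs
  imports "HOL-Analysis.Function_Topology" "HOL-Algebra.Module"
begin

section \<open>Banach spaces and Banach algebras\<close>

text \<open>
  All spaces are complex and are given by an explicit carrier. A normed space is a module over
  the field of complex numbers in the sense of HOL-Algebra together with a norm. The field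
  \<open>one\<close> of the record is never used; the field \<open>mult\<close> is used for Banach algebras only and is
  irrelevant for Banach spaces.
\<close>

record 'v normed = "(complex, 'v) module" +
  nrm :: "'v \<Rightarrow> real"

definition complex_ring :: "complex ring" where
  "complex_ring = \<lparr>carrier = UNIV, monoid.mult = (*), monoid.one = 1, ring.zero = 0, ring.add = (+)\<rparr>"

locale normed_space = module complex_ring V for V :: "'v normed" (structure) +
  assumes nrm_nonneg: "x \<in> carrier V \<Longrightarrow> 0 \<le> nrm V x"
    and nrm_eq_0: "x \<in> carrier V \<Longrightarrow> nrm V x = 0 \<Longrightarrow> x = \<zero>"
    and nrm_smult: "x \<in> carrier V \<Longrightarrow> nrm V (c \<odot> x) = cmod c * nrm V x"
    and nrm_triangle: "x \<in> carrier V \<Longrightarrow> y \<in> carrier V \<Longrightarrow> nrm V (x \<oplus> y) \<le> nrm V x + nrm V y"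

locale banach_space = normed_space +
  assumes complete: "\<lbrakk>\<And>n. s n \<in> carrier V;
      \<forall>e>0. \<exists>N. \<forall>m\<ge>N. \<forall>n\<ge>N. nrm V (s m \<ominus> s n) < e\<rbrakk>
    \<Longrightarrow> \<exists>x\<in>carrier V. (\<lambda>n. nrm V (s n \<ominus> x)) \<longlonglongrightarrow> 0"

locale banach_algebra = banach_space A for A :: "'a normed" (structure) +
  assumes mult_closed: "a \<in> carrier A \<Longrightarrow> b \<in> carrier A \<Longrightarrow> a \<otimes> b \<in> carrier A"
    and mult_assoc: "a \<in> carrier A \<Longrightarrow> b \<in> carrier A \<Longrightarrow> c \<in> carrier A
      \<Longrightarrow> (a \<otimes> b) \<otimes> c = a \<otimes> (b \<otimes> c)"
    and mult_add_left: "a \<in> carrier A \<Longrightarrow> b \<in> carrier A \<Longrightarrow> c \<in> carrier A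
      \<Longrightarrow> (a \<oplus> b) \<otimes> c = (a \<otimes> c) \<oplus> (b \<otimes> c)"
    and mult_add_right: "a \<in> carrier A \<Longrightarrow> b \<in> carrier A \<Longrightarrow> c \<in> carrier A
      \<Longrightarrow> a \<otimes> (b \<oplus> c) = (a \<otimes> b) \<oplus> (a \<otimes> c)"
    and mult_smult_left: "a \<in> carrier A \<Longrightarrow> b \<in> carrier A \<Longrightarrow> (k \<odot> a) \<otimes> b = k \<odot> (a \<otimes> b)"
    and mult_smult_right: "a \<in> carrier A \<Longrightarrow> b \<in> carrier A \<Longrightarrow> a \<otimes> (k \<odot> b) = k \<odot> (a \<otimes> b)"
    and nrm_mult: "a \<in> carrier A \<Longrightarrow> b \<in> carrier A \<Longrightarrow> nrm A (a \<otimes> b) \<le> nrm A a * nrm A b"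

text \<open>\<open>l a y\<close> and \<open>r y a\<close> are the left and the right action of \<open>a\<close> on \<open>y\<close>.\<close>

locale banach_bimodule = banach_space Y
  for A :: "'a normed" and Y :: "'y normed" (structure)
    and l :: "'a \<Rightarrow> 'y \<Rightarrow> 'y" and r :: "'y \<Rightarrow> 'a \<Rightarrow> 'y" +
  assumes l_closed: "a \<in> carrier A \<Longrightarrow> y \<in> carrier Y \<Longrightarrow> l a y \<in> carrier Y"
    and r_closed: "a \<in> carrier A \<Longrightarrow> y \<in> carrier Y \<Longrightarrow> r y a \<in> carrier Y"
    and l_add: "a \<in> carrier A \<Longrightarrow> y \<in> carrier Y \<Longrightarrow> z \<in> carrier Y
      \<Longrightarrow> l a (y \<oplus> z) = l a y \<oplus> l a z"
    and r_add: "a \<in> carrier A \<Longrightarrow> y \<in> carrier Y \<Longrightarrow> z \<in> carrier Y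
      \<Longrightarrow> r (y \<oplus> z) a = r y a \<oplus> r z a"
    and l_smult: "a \<in> carrier A \<Longrightarrow> y \<in> carrier Y \<Longrightarrow> l a (k \<odot> y) = k \<odot> l a y"
    and r_smult: "a \<in> carrier A \<Longrightarrow> y \<in> carrier Y \<Longrightarrow> r (k \<odot> y) a = k \<odot> r y a"
    and l_add_alg: "a \<in> carrier A \<Longrightarrow> b \<in> carrier A \<Longrightarrow> y \<in> carrier Y
      \<Longrightarrow> l (a \<oplus>\<^bsub>A\<^esub> b) y = l a y \<oplus> l b y"
    and r_add_alg: "a \<in> carrier A \<Longrightarrow> b \<in> carrier A \<Longrightarrow> y \<in> carrier Y
      \<Longrightarrow> r y (a \<oplus>\<^bsub>A\<^esub> b) = r y a \<oplus> r y b"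
    and l_smult_alg: "a \<in> carrier A \<Longrightarrow> y \<in> carrier Y \<Longrightarrow> l (k \<odot>\<^bsub>A\<^esub> a) y = k \<odot> l a y"
    and r_smult_alg: "a \<in> carrier A \<Longrightarrow> y \<in> carrier Y \<Longrightarrow> r y (k \<odot>\<^bsub>A\<^esub> a) = k \<odot> r y a"
    and l_mult: "a \<in> carrier A \<Longrightarrow> b \<in> carrier A \<Longrightarrow> y \<in> carrier Y
      \<Longrightarrow> l (a \<otimes>\<^bsub>A\<^esub> b) y = l a (l b y)"
    and r_mult: "a \<in> carrier A \<Longrightarrow> b \<in> carrier A \<Longrightarrow> y \<in> carrier Y
      \<Longrightarrow> r y (a \<otimes>\<^bsub>A\<^esub> b) = r (r y a) b"
    and l_r: "a \<in> carrier A \<Longrightarrow> b \<in> carrier A \<Longrightarrow> y \<in> carrier Y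
      \<Longrightarrow> l a (r y b) = r (l a y) b"
    and bounded_actions: "\<exists>K. \<forall>a\<in>carrier A. \<forall>y\<in>carrier Y.
      nrm Y (l a y) \<le> K * nrm A a * nrm Y y \<and> nrm Y (r y a) \<le> K * nrm A a * nrm Y y"

text \<open>
  The norm of the module extension is submultiplicative if the actions are contractive; for actions
  bounded by a constant it is so up to an equivalent norm.
\<close>

definition module_extension ::
    "'m normed \<Rightarrow> 'a normed \<Rightarrow> ('a \<Rightarrow> 'm \<Rightarrow> 'm) \<Rightarrow> ('m \<Rightarrow> 'a \<Rightarrow> 'm) \<Rightarrow> ('m \<times> 'a) normed" where
  "module_extension M A l r =
    \<lparr>carrier = carrier M \<times> carrier A,
     monoid.mult = (\<lambda>(m\<^sub>1, a\<^sub>1) (m\<^sub>2, a\<^sub>2). (r m\<^sub>1 a\<^sub>2 \<oplus>\<^bsub>M\<^esub> l a\<^sub>1 m\<^sub>2, a\<^sub>1 \<otimes>\<^bsub>A\<^esub> a\<^sub>2)),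
     monoid.one = undefined,
     ring.zero = (\<zero>\<^bsub>M\<^esub>, \<zero>\<^bsub>A\<^esub>),
     ring.add = (\<lambda>(m\<^sub>1, a\<^sub>1) (m\<^sub>2, a\<^sub>2). (m\<^sub>1 \<oplus>\<^bsub>M\<^esub> m\<^sub>2, a\<^sub>1 \<oplus>\<^bsub>A\<^esub> a\<^sub>2)),
     module.smult = (\<lambda>k (m, a). (k \<odot>\<^bsub>M\<^esub> m, k \<odot>\<^bsub>A\<^esub> a)),
     nrm = (\<lambda>(m, a). nrm M m + nrm A a)\<rparr>"


section \<open>Duality\<close>

text \<open>Functionals are made extensional, so that they are determined by their values on the carrier.\<close>

definition dual :: "'v normed \<Rightarrow> ('v \<Rightarrow> complex) normed" where
  "dual V =
    \<lparr>carrier = {f \<in> extensional (carrier V).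
        (\<forall>x\<in>carrier V. \<forall>y\<in>carrier V. f (x \<oplus>\<^bsub>V\<^esub> y) = f x + f y) \<and>
        (\<forall>c. \<forall>x\<in>carrier V. f (c \<odot>\<^bsub>V\<^esub> x) = c * f x) \<and>
        (\<exists>K. \<forall>x\<in>carrier V. cmod (f x) \<le> K * nrm V x)},
     monoid.mult = (\<lambda>_ _. undefined),
     monoid.one = undefined,
     ring.zero = (\<lambda>x\<in>carrier V. 0),
     ring.add = (\<lambda>f g. \<lambda>x\<in>carrier V. f x + g x),
     module.smult = (\<lambda>c f. \<lambda>x\<in>carrier V. c * f x),
     nrm = (\<lambda>f. SUP x\<in>{x \<in> carrier V. nrm V x \<le> 1}. cmod (f x))\<rparr>"

definition weak_star :: "'v normed \<Rightarrow> ('v \<Rightarrow> complex) topology" where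
  "weak_star V = subtopology (product_topology (\<lambda>_. euclidean) (carrier V)) (carrier (dual V))"

definition canonical :: "'v normed \<Rightarrow> 'v \<Rightarrow> ('v \<Rightarrow> complex) \<Rightarrow> complex" where
  "canonical V x = (\<lambda>f\<in>carrier (dual V). f x)"

definition reflexive :: "'v normed \<Rightarrow> bool" where
  "reflexive V \<longleftrightarrow> canonical V ` carrier V = carrier (dual (dual V))"

text \<open>The dual actions on the dual of a bimodule: \<open>(a \<cdot> x)(y) = x(y \<cdot> a)\<close>, \<open>(x \<cdot> a)(y) = x(a \<cdot> y)\<close>.\<close>

definition dual_l :: "'y normed \<Rightarrow> ('y \<Rightarrow> 'a \<Rightarrow> 'y) \<Rightarrow> 'a \<Rightarrow> ('y \<Rightarrow> complex) \<Rightarrow> 'y \<Rightarrow> complex" where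
  "dual_l Y r a x = (\<lambda>y\<in>carrier Y. x (r y a))"

definition dual_r :: "'y normed \<Rightarrow> ('a \<Rightarrow> 'y \<Rightarrow> 'y) \<Rightarrow> ('y \<Rightarrow> complex) \<Rightarrow> 'a \<Rightarrow> 'y \<Rightarrow> complex" where
  "dual_r Y l x a = (\<lambda>y\<in>carrier Y. x (l a y))"


section \<open>Arens products\<close>

text \<open>
  The usual three-step definition, written out: with \<open>(f \<cdot> a)(b) = f(a b)\<close> and
  \<open>(G \<cdot> f)(a) = G(f \<cdot> a)\<close> the first product is \<open>(F G)(f) = F(G \<cdot> f)\<close>; the second one is its mirror
  image. By the lemmas \<open>arens_first_iterated_limit\<close> and \<open>arens_second_iterated_limit\<close> below
  these are the iterated weak* limits of products of nets in \<open>C\<close> that converge weak* to \<open>F\<close> and \<open>G\<close>.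
\<close>

definition arens_first :: "'c normed \<Rightarrow> (('c \<Rightarrow> complex) \<Rightarrow> complex) \<Rightarrow> (('c \<Rightarrow> complex) \<Rightarrow> complex) \<Rightarrow>
    ('c \<Rightarrow> complex) \<Rightarrow> complex" where
  "arens_first C F G = (\<lambda>f\<in>carrier (dual C).
     F (\<lambda>a\<in>carrier C. G (\<lambda>b\<in>carrier C. f (a \<otimes>\<^bsub>C\<^esub> b))))"

definition arens_second :: "'c normed \<Rightarrow> (('c \<Rightarrow> complex) \<Rightarrow> complex) \<Rightarrow> (('c \<Rightarrow> complex) \<Rightarrow> complex) \<Rightarrow>
    ('c \<Rightarrow> complex) \<Rightarrow> complex" where
  "arens_second C F G = (\<lambda>f\<in>carrier (dual C).
     G (\<lambda>b\<in>carrier C. F (\<lambda>a\<in>carrier C. f (a \<otimes>\<^bsub>C\<^esub> b))))"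

definition arens_regular :: "'c normed \<Rightarrow> bool" where
  "arens_regular C \<longleftrightarrow> (\<forall>F\<in>carrier (dual (dual C)). \<forall>G\<in>carrier (dual (dual C)).
     arens_first C F G = arens_second C F G)"

definition second_dual :: "'c normed \<Rightarrow> (('c \<Rightarrow> complex) \<Rightarrow> complex) normed" where
  "second_dual C = (dual (dual C))\<lparr>monoid.mult := arens_first C\<rparr>"

text \<open>The dual of \<open>C\<close>, regarded as a set of functionals on the second dual.\<close>

definition second_dual_predual :: "'c normed \<Rightarrow> ((('c \<Rightarrow> complex) \<Rightarrow> complex) \<Rightarrow> complex) set" where
  "second_dual_predual C = canonical (dual C) ` carrier (dual C)"


section \<open>Connes amenability\<close>

text \<open>
  \<open>P\<close> is a closed submodule of the dual of \<open>D\<close> such that evaluation identifies \<open>D\<close> isometrically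
  with the dual of \<open>P\<close>; here \<open>(dual D)\<lparr>carrier := P\<rparr>\<close> is \<open>P\<close> as a normed space.
\<close>

definition is_predual :: "'d normed \<Rightarrow> ('d \<Rightarrow> complex) set \<Rightarrow> bool" where
  "is_predual D P \<longleftrightarrow>
     submodule P complex_ring (dual D) \<and>
     (\<forall>\<phi>\<in>P. \<forall>a\<in>carrier D.
        dual_l D (\<lambda>b a. b \<otimes>\<^bsub>D\<^esub> a) a \<phi> \<in> P \<and> dual_r D (\<lambda>a b. a \<otimes>\<^bsub>D\<^esub> b) \<phi> a \<in> P) \<and>
     (\<forall>s \<phi>. (\<forall>n. s n \<in> P) \<and> \<phi> \<in> carrier (dual D) \<and>
        (\<lambda>n::nat. nrm (dual D) (s n \<ominus>\<^bsub>dual D\<^esub> \<phi>)) \<longlonglongrightarrow> 0 \<longrightarrow> \<phi> \<in> P) \<and>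
     bij_betw (\<lambda>a. \<lambda>\<phi>\<in>P. \<phi> a) (carrier D) (carrier (dual ((dual D)\<lparr>carrier := P\<rparr>))) \<and>
     (\<forall>a\<in>carrier D. nrm (dual ((dual D)\<lparr>carrier := P\<rparr>)) (\<lambda>\<phi>\<in>P. \<phi> a) = nrm D a)"

text \<open>The weak* topology of \<open>D\<close> with respect to the predual \<open>P\<close>.\<close>

definition weak_star_alg :: "'d normed \<Rightarrow> ('d \<Rightarrow> complex) set \<Rightarrow> 'd topology" where
  "weak_star_alg D P =
     pullback_topology (carrier D) (\<lambda>a. \<lambda>\<phi>\<in>P. \<phi> a) (product_topology (\<lambda>_. euclidean) P)"

text \<open>The dual module of \<open>Y\<close> is normal.\<close>

definition normal_dual :: "'d normed \<Rightarrow> ('d \<Rightarrow> complex) set \<Rightarrow> 'y normed \<Rightarrow>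
    ('d \<Rightarrow> 'y \<Rightarrow> 'y) \<Rightarrow> ('y \<Rightarrow> 'd \<Rightarrow> 'y) \<Rightarrow> bool" where
  "normal_dual D P Y l r \<longleftrightarrow> (\<forall>x\<in>carrier (dual Y).
     continuous_map (weak_star_alg D P) (weak_star Y) (\<lambda>a. dual_l Y r a x) \<and>
     continuous_map (weak_star_alg D P) (weak_star Y) (\<lambda>a. dual_r Y l x a))"

text \<open>\<open>\<delta>\<close> is a derivation from \<open>D\<close> into the dual of \<open>Y\<close>.\<close>

definition derivation :: "'d normed \<Rightarrow> 'y normed \<Rightarrow>
    ('d \<Rightarrow> 'y \<Rightarrow> 'y) \<Rightarrow> ('y \<Rightarrow> 'd \<Rightarrow> 'y) \<Rightarrow> ('d \<Rightarrow> 'y \<Rightarrow> complex) \<Rightarrow> bool" where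
  "derivation D Y l r \<delta> \<longleftrightarrow>
     (\<forall>a\<in>carrier D. \<delta> a \<in> carrier (dual Y)) \<and>
     (\<forall>a\<in>carrier D. \<forall>b\<in>carrier D. \<delta> (a \<oplus>\<^bsub>D\<^esub> b) = \<delta> a \<oplus>\<^bsub>dual Y\<^esub> \<delta> b) \<and>
     (\<forall>k. \<forall>a\<in>carrier D. \<delta> (k \<odot>\<^bsub>D\<^esub> a) = k \<odot>\<^bsub>dual Y\<^esub> \<delta> a) \<and>
     (\<forall>a\<in>carrier D. \<forall>b\<in>carrier D.
        \<delta> (a \<otimes>\<^bsub>D\<^esub> b) = dual_r Y l (\<delta> a) b \<oplus>\<^bsub>dual Y\<^esub> dual_l Y r a (\<delta> b))"

definition inner_derivation :: "'d normed \<Rightarrow> 'y normed \<Rightarrow>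
    ('d \<Rightarrow> 'y \<Rightarrow> 'y) \<Rightarrow> ('y \<Rightarrow> 'd \<Rightarrow> 'y) \<Rightarrow> ('d \<Rightarrow> 'y \<Rightarrow> complex) \<Rightarrow> bool" where
  "inner_derivation D Y l r \<delta> \<longleftrightarrow> (\<exists>x\<in>carrier (dual Y). \<forall>a\<in>carrier D.
     \<delta> a = dual_l Y r a x \<ominus>\<^bsub>dual Y\<^esub> dual_r Y l x a)"

definition connes_amenable_over :: "'u itself \<Rightarrow> 'd normed \<Rightarrow> ('d \<Rightarrow> complex) set \<Rightarrow> bool" where
  "connes_amenable_over U D P \<longleftrightarrow>
     (\<forall>(Y :: 'u normed) l r \<delta>. banach_bimodule D Y l r \<and> normal_dual D P Y l r \<and>
        derivation D Y l r \<delta> \<and> continuous_map (weak_star_alg D P) (weak_star Y) \<delta>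
        \<longrightarrow> inner_derivation D Y l r \<delta>)"

text \<open>
  A formula cannot quantify over the Banach modules of all types at once. The definition uses
  the following type, which is large enough to hold a copy of every closed submodule generated by a
  sequence \<open>(y\<^sub>n)\<close>: an element of such a submodule is the limit of a sequence of finite sums of terms
  \<open>k \<odot> y\<^sub>n\<close>, \<open>k \<odot> (a \<cdot> y\<^sub>n)\<close>, \<open>k \<odot> (y\<^sub>n \<cdot> b)\<close>, \<open>k \<odot> (a \<cdot> y\<^sub>n \<cdot> b)\<close>. Theorem
  \<open>connes_amenable_imp_over\<close> below shows that it then holds for Banach modules of every type.
\<close>

type_synonym 'd sequence_code = "nat \<Rightarrow> (complex \<times> nat \<times> 'd option \<times> 'd option) list"

definition connes_amenable :: "'d normed \<Rightarrow> ('d \<Rightarrow> complex) set \<Rightarrow> bool" where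
  "connes_amenable D P \<longleftrightarrow>
     is_predual D P \<and> connes_amenable_over TYPE('d sequence_code) D P"


section \<open>Basic facts\<close>

lemma complex_ring_simps [simp]:
  "carrier complex_ring = UNIV" "x \<otimes>\<^bsub>complex_ring\<^esub> y = x * y" "x \<oplus>\<^bsub>complex_ring\<^esub> y = x + y"
  "\<one>\<^bsub>complex_ring\<^esub> = 1" "\<zero>\<^bsub>complex_ring\<^esub> = 0"
  by (simp_all add: complex_ring_def)

lemma cring_complex_ring: "cring complex_ring"
proof -
  have "\<exists>y. x + y = 0" for x :: complex
    using add.right_inverse by blast
  then show ?thesis
    using add.right_inverse by unfold_locales (auto simp: algebra_simps Units_def)
qed

lemma complex_ring_uminus [simp]: "\<ominus>\<^bsub>complex_ring\<^esub> x = - x"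
proof -
  interpret cring complex_ring by (rule cring_complex_ring)
  show ?thesis by (rule minus_equality) auto
qed

lemma (in normed_space) smult_closed' [simp]: "x \<in> carrier V \<Longrightarrow> c \<odot> x \<in> carrier V"
  by (rule smult_closed) auto

lemma (in normed_space) smult_add: "x \<in> carrier V \<Longrightarrow> (a + b) \<odot> x = a \<odot> x \<oplus> b \<odot> x"
  using smult_l_distr[of a b x] by simp

lemma (in normed_space) smult_right_add:
  "x \<in> carrier V \<Longrightarrow> y \<in> carrier V \<Longrightarrow> a \<odot> (x \<oplus> y) = a \<odot> x \<oplus> a \<odot> y"
  using smult_r_distr[of a x y] by simp

lemma (in normed_space) smult_smult: "x \<in> carrier V \<Longrightarrow> a \<odot> (b \<odot> x) = (a * b) \<odot> x"
  using smult_assoc1[of a b x] by simp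

lemma (in normed_space) smult_1 [simp]: "x \<in> carrier V \<Longrightarrow> 1 \<odot> x = x"
  using smult_one[of x] by simp

lemma (in normed_space) smult_0 [simp]: "x \<in> carrier V \<Longrightarrow> 0 \<odot> x = \<zero>"
  using smult_l_null[of x] by simp

lemma (in normed_space) minus_smult: "x \<in> carrier V \<Longrightarrow> \<ominus> x = (-1) \<odot> x"
  using smult_l_minus[of 1 x] by simp

lemma (in normed_space) diff_smult: "x \<ominus> y = x \<oplus> (-1) \<odot> y" if "y \<in> carrier V"
  using that by (simp add: a_minus_def minus_smult)

lemma (in normed_space) nrm_0 [simp]: "nrm V \<zero> = 0"
  using nrm_smult[of \<zero> 0] by simp

lemma (in normed_space) nrm_minus: "x \<in> carrier V \<Longrightarrow> nrm V (\<ominus> x) = nrm V x"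
  using nrm_smult[of x "-1"] by (simp add: minus_smult)

lemma (in normed_space) nrm_diff_commute:
  assumes "x \<in> carrier V" "y \<in> carrier V"
  shows "nrm V (x \<ominus> y) = nrm V (y \<ominus> x)"
proof -
  have "y \<ominus> x = \<ominus> (x \<ominus> y)"
    using assms by (simp add: a_minus_def minus_add a_comm)
  then show ?thesis using assms nrm_minus[of "x \<ominus> y"] by simp
qed

lemma (in normed_space) nrm_diff_triangle:
  assumes "x \<in> carrier V" "y \<in> carrier V" "z \<in> carrier V"
  shows "nrm V (x \<ominus> z) \<le> nrm V (x \<ominus> y) + nrm V (y \<ominus> z)"
proof -
  have "(\<ominus> y) \<oplus> (y \<oplus> \<ominus> z) = \<ominus> z"
    using assms by (simp add: a_assoc[symmetric] l_neg)
  then have "x \<ominus> z = (x \<ominus> y) \<oplus> (y \<ominus> z)"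
    using assms by (simp add: a_minus_def a_assoc)
  then show ?thesis using assms nrm_triangle[of "x \<ominus> y" "y \<ominus> z"] by simp
qed

lemma (in normed_space) diff_eq_0: 
  assumes "x \<in> carrier V" "y \<in> carrier V" "nrm V (x \<ominus> y) = 0" shows "x = y"
  using assms nrm_eq_0[of "x \<ominus> y"]
  by (metis M.minus_closed M.minus_eq M.add.inv_closed M.add.inv_equality M.add.m_comm M.minus_minus M.minus_equality)

lemma (in normed_space) add4:
  assumes "a \<in> carrier V" "b \<in> carrier V" "c \<in> carrier V" "d \<in> carrier V"
  shows "(a \<oplus> b) \<oplus> (c \<oplus> d) = (a \<oplus> c) \<oplus> (b \<oplus> d)"
  using assms by (simp add: a_assoc a_lcomm)

lemma (in normed_space) add_diff:
  assumes "a \<in> carrier V" "b \<in> carrier V" "c \<in> carrier V" "d \<in> carrier V"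
  shows "(a \<oplus> b) \<ominus> (c \<oplus> d) = (a \<ominus> c) \<oplus> (b \<ominus> d)"
  using assms by (simp add: diff_smult smult_right_add add4)

lemma (in normed_space) smult_diff:
  assumes "a \<in> carrier V" "b \<in> carrier V"
  shows "k \<odot> (a \<ominus> b) = k \<odot> a \<ominus> k \<odot> b"
  using assms by (simp add: diff_smult smult_right_add smult_smult)

lemma dualD:
  assumes "f \<in> carrier (dual V)"
  shows "f \<in> extensional (carrier V)"
    "x \<in> carrier V \<Longrightarrow> y \<in> carrier V \<Longrightarrow> f (x \<oplus>\<^bsub>V\<^esub> y) = f x + f y"
    "x \<in> carrier V \<Longrightarrow> f (c \<odot>\<^bsub>V\<^esub> x) = c * f x"
  using assms by (auto simp: dual_def)

lemma (in normed_space) dual_bound: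
  assumes "f \<in> carrier (dual V)"
  obtains K where "K \<ge> 0" "\<And>x. x \<in> carrier V \<Longrightarrow> cmod (f x) \<le> K * nrm V x"
proof -
  have "\<exists>K. \<forall>x\<in>carrier V. cmod (f x) \<le> K * nrm V x" using assms by (simp add: dual_def)
  then obtain K where K: "\<And>x. x \<in> carrier V \<Longrightarrow> cmod (f x) \<le> K * nrm V x" by blast
  have "cmod (f x) \<le> \<bar>K\<bar> * nrm V x" if "x \<in> carrier V" for x
    using K[OF that] mult_right_mono[OF abs_ge_self[of K] nrm_nonneg[OF that]] by linarith
  then show ?thesis using that[of "\<bar>K\<bar>"] by auto
qed

lemma (in normed_space) dual_diff: "f (x \<ominus> y) = f x - f y"
  if "f \<in> carrier (dual V)" "x \<in> carrier V" "y \<in> carrier V"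
  using that by (simp add: diff_smult dualD)

lemma (in normed_space) abelian_group_dual: "abelian_group (dual V)"
proof (rule abelian_groupI)
  fix f g h assume f: "f \<in> carrier (dual V)" and g: "g \<in> carrier (dual V)" and h: "h \<in> carrier (dual V)"
  obtain K where K: "\<And>x. x \<in> carrier V \<Longrightarrow> cmod (f x) \<le> K * nrm V x" using dual_bound[OF f] by metis
  obtain L where L: "\<And>x. x \<in> carrier V \<Longrightarrow> cmod (g x) \<le> L * nrm V x" using dual_bound[OF g] by metis
  have "cmod (f x + g x) \<le> (K + L) * nrm V x" if "x \<in> carrier V" for x
    using norm_triangle_ineq[of "f x" "g x"] K[OF that] L[OF that] by (simp add: distrib_right)
  then have "\<exists>K. \<forall>x\<in>carrier V. cmod (f x + g x) \<le> K * nrm V x" by blast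
  then show "f \<oplus>\<^bsub>dual V\<^esub> g \<in> carrier (dual V)"
    using dualD[OF f] dualD[OF g] by (simp add: dual_def algebra_simps)
  show "f \<oplus>\<^bsub>dual V\<^esub> g \<oplus>\<^bsub>dual V\<^esub> h = f \<oplus>\<^bsub>dual V\<^esub> (g \<oplus>\<^bsub>dual V\<^esub> h)"
    "f \<oplus>\<^bsub>dual V\<^esub> g = g \<oplus>\<^bsub>dual V\<^esub> f"
    by (simp_all add: dual_def fun_eq_iff restrict_def)
  show "\<zero>\<^bsub>dual V\<^esub> \<oplus>\<^bsub>dual V\<^esub> f = f"
    using dualD(1)[OF f] by (auto simp: dual_def fun_eq_iff restrict_def extensional_def)
  have "\<exists>K. \<forall>x\<in>carrier V. cmod (f x) \<le> K * nrm V x" using K by blast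
  then have "(\<lambda>x\<in>carrier V. - f x) \<in> carrier (dual V)"
    using dualD[OF f] by (simp add: dual_def)
  moreover have "(\<lambda>x\<in>carrier V. - f x) \<oplus>\<^bsub>dual V\<^esub> f = \<zero>\<^bsub>dual V\<^esub>"
    by (simp add: dual_def fun_eq_iff restrict_def)
  ultimately show "\<exists>g\<in>carrier (dual V). g \<oplus>\<^bsub>dual V\<^esub> f = \<zero>\<^bsub>dual V\<^esub>" by blast
next
  show "\<zero>\<^bsub>dual V\<^esub> \<in> carrier (dual V)"
    using nrm_nonneg by (auto simp: dual_def intro!: exI[of _ 0])
qed

lemma (in normed_space) dual_minus:
  assumes f: "f \<in> carrier (dual V)" and g: "g \<in> carrier (dual V)"
  shows "f \<ominus>\<^bsub>dual V\<^esub> g = (\<lambda>x\<in>carrier V. f x - g x)"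
proof -
  interpret d: abelian_group "dual V" by (rule abelian_group_dual)
  have *: "(\<lambda>x\<in>carrier V. - g x) \<in> carrier (dual V)"
    using g by (auto simp: dual_def)
  have "(\<lambda>x\<in>carrier V. - g x) \<oplus>\<^bsub>dual V\<^esub> g = \<zero>\<^bsub>dual V\<^esub>"
    by (simp add: dual_def fun_eq_iff restrict_def)
  then have "\<ominus>\<^bsub>dual V\<^esub> g = (\<lambda>x\<in>carrier V. - g x)"
    using d.minus_equality[OF _ g *] by simp
  then show ?thesis by (simp add: a_minus_def dual_def fun_eq_iff restrict_def)
qed

lemma continuous_map_weak_star:
  "continuous_map T (weak_star V) f \<longleftrightarrow>
     (\<forall>a\<in>topspace T. f a \<in> carrier (dual V)) \<and>
     (\<forall>y\<in>carrier V. continuous_map T euclidean (\<lambda>a. f a y))"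
  unfolding weak_star_def continuous_map_in_subtopology continuous_map_componentwise
  by (auto simp: Pi_iff dest: dualD(1))

lemma topspace_weak_star_alg [simp]: "topspace (weak_star_alg D P) = carrier D"
  unfolding weak_star_alg_def topspace_pullback_topology by auto


section \<open>Arens products as iterated limits\<close>

context banach_algebra begin

lemma dual_right_mult:
  assumes f: "f \<in> carrier (dual A)" and a: "a \<in> carrier A"
  shows "(\<lambda>b\<in>carrier A. f (a \<otimes> b)) \<in> carrier (dual A)"
    and "(\<lambda>b\<in>carrier A. f (b \<otimes> a)) \<in> carrier (dual A)"
proof -
  obtain K where K: "K \<ge> 0" "\<And>x. x \<in> carrier A \<Longrightarrow> cmod (f x) \<le> K * nrm A x"
    using dual_bound[OF f] by metis
  have "cmod (f (a \<otimes> b)) \<le> (K * nrm A a) * nrm A b" "cmod (f (b \<otimes> a)) \<le> (K * nrm A a) * nrm A b"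
    if "b \<in> carrier A" for b
    using K(2)[OF mult_closed[OF a that]] mult_left_mono[OF nrm_mult[OF a that] K(1)]
      K(2)[OF mult_closed[OF that a]] mult_left_mono[OF nrm_mult[OF that a] K(1)]
    by (simp_all add: ac_simps)
  then have "\<exists>K. \<forall>b\<in>carrier A. cmod (f (a \<otimes> b)) \<le> K * nrm A b"
    "\<exists>K. \<forall>b\<in>carrier A. cmod (f (b \<otimes> a)) \<le> K * nrm A b" by blast+
  then show "(\<lambda>b\<in>carrier A. f (a \<otimes> b)) \<in> carrier (dual A)"
    "(\<lambda>b\<in>carrier A. f (b \<otimes> a)) \<in> carrier (dual A)"
    using a dualD(2,3)[OF f]
    by (simp_all add: dual_def mult_closed mult_add_left mult_add_right mult_smult_left mult_smult_right)
qed

lemma dual_of_bilinear: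
  assumes H: "H \<in> carrier (dual (dual A))"
    and p: "\<And>a. a \<in> carrier A \<Longrightarrow> p a \<in> carrier (dual A)"
      "\<And>a a' b. \<lbrakk>a \<in> carrier A; a' \<in> carrier A; b \<in> carrier A\<rbrakk> \<Longrightarrow> p (a \<oplus> a') b = p a b + p a' b"
      "\<And>a b c. \<lbrakk>a \<in> carrier A; b \<in> carrier A\<rbrakk> \<Longrightarrow> p (c \<odot> a) b = c * p a b"
    and K: "\<And>a b. \<lbrakk>a \<in> carrier A; b \<in> carrier A\<rbrakk> \<Longrightarrow> cmod (p a b) \<le> K * nrm A a * nrm A b" "K \<ge> 0"
  shows "(\<lambda>a\<in>carrier A. H (p a)) \<in> carrier (dual A)"
proof -
  have "\<exists>L. \<forall>f\<in>carrier (dual A). cmod (H f) \<le> L * nrm (dual A) f"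
    using H by (simp add: dual_def[of "dual A"])
  then obtain L where L: "\<And>f. f \<in> carrier (dual A) \<Longrightarrow> cmod (H f) \<le> L * nrm (dual A) f" by blast
  have "cmod (H (p a)) \<le> (\<bar>L\<bar> * K) * nrm A a" if a: "a \<in> carrier A" for a
  proof -
    have le: "cmod (p a b) \<le> K * nrm A a" if "b \<in> carrier A" "nrm A b \<le> 1" for b
      using K(1)[OF a that(1)] mult_left_mono[OF that(2), of "K * nrm A a"] K(2) nrm_nonneg[OF a]
      by simp
    have z: "\<zero> \<in> {x \<in> carrier A. nrm A x \<le> 1}" by simp
    have n1: "nrm (dual A) (p a) \<le> K * nrm A a"
      unfolding dual_def using z le by (simp, intro cSUP_least) auto
    have "cmod (p a \<zero>) \<le> nrm (dual A) (p a)"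
      unfolding dual_def using z le by (simp, intro cSUP_upper) (auto intro!: bdd_aboveI)
    then have n0: "0 \<le> nrm (dual A) (p a)" using norm_ge_zero order_trans by blast
    have "cmod (H (p a)) \<le> L * nrm (dual A) (p a)" using L p(1)[OF a] by blast
    also have "\<dots> \<le> \<bar>L\<bar> * nrm (dual A) (p a)" using n0 by (intro mult_right_mono) auto
    also have "\<dots> \<le> \<bar>L\<bar> * (K * nrm A a)" using n1 by (intro mult_left_mono) auto
    finally show ?thesis by (simp add: ac_simps)
  qed
  then have b: "\<exists>K. \<forall>a\<in>carrier A. cmod (H (p a)) \<le> K * nrm A a" by blast
  have "p (a \<oplus> a') = p a \<oplus>\<^bsub>dual A\<^esub> p a'" if "a \<in> carrier A" "a' \<in> carrier A" for a a'
  proof (rule extensionalityI[of _ "carrier A"])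
    show "p a \<oplus>\<^bsub>dual A\<^esub> p a' \<in> extensional (carrier A)" by (simp add: dual_def)
    show "p (a \<oplus> a') x = (p a \<oplus>\<^bsub>dual A\<^esub> p a') x" if "x \<in> carrier A" for x
      using p(2)[OF \<open>a \<in> carrier A\<close> \<open>a' \<in> carrier A\<close> that] that by (simp add: dual_def)
  qed (rule dualD(1)[OF p(1)], use that in simp)
  moreover have "p (c \<odot> a) = c \<odot>\<^bsub>dual A\<^esub> p a" if "a \<in> carrier A" for a c
  proof (rule extensionalityI[of _ "carrier A"])
    show "c \<odot>\<^bsub>dual A\<^esub> p a \<in> extensional (carrier A)" by (simp add: dual_def)
    show "p (c \<odot> a) x = (c \<odot>\<^bsub>dual A\<^esub> p a) x" if "x \<in> carrier A" for x
      using p(3)[OF \<open>a \<in> carrier A\<close> that] that by (simp add: dual_def)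
  qed (rule dualD(1)[OF p(1)], use that in simp)
  ultimately show ?thesis
    using b dualD(2,3)[OF H] p(1) by (simp add: dual_def[of A])
qed

text \<open>Nets are given by families \<open>a\<close>, \<open>b\<close> together with filters \<open>I\<close>, \<open>J\<close> on their index types.\<close>

lemma
  assumes F: "F \<in> carrier (dual (dual A))" and G: "G \<in> carrier (dual (dual A))"
    and f: "f \<in> carrier (dual A)"
    and a: "\<And>i. a i \<in> carrier A" "\<And>f. f \<in> carrier (dual A) \<Longrightarrow> ((\<lambda>i. f (a i)) \<longlongrightarrow> F f) I"
    and b: "\<And>j. b j \<in> carrier A" "\<And>f. f \<in> carrier (dual A) \<Longrightarrow> ((\<lambda>j. f (b j)) \<longlongrightarrow> G f) J"
  shows arens_first_iterated_limit: "\<exists>h. (\<forall>i. ((\<lambda>j. f (a i \<otimes> b j)) \<longlongrightarrow> h i) J) \<and>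
      (h \<longlongrightarrow> arens_first A F G f) I"
    and arens_second_iterated_limit: "\<exists>h. (\<forall>j. ((\<lambda>i. f (a i \<otimes> b j)) \<longlongrightarrow> h j) I) \<and>
      (h \<longlongrightarrow> arens_second A F G f) J"
proof -
  obtain K where K: "K \<ge> 0" "\<And>x. x \<in> carrier A \<Longrightarrow> cmod (f x) \<le> K * nrm A x"
    using dual_bound[OF f] by metis
  have le: "cmod (f (x \<otimes> y)) \<le> K * nrm A x * nrm A y" "cmod (f (x \<otimes> y)) \<le> K * nrm A y * nrm A x"
    if "x \<in> carrier A" "y \<in> carrier A" for x y
    using K(2)[OF mult_closed[OF that]] mult_left_mono[OF nrm_mult[OF that] K(1)]
    by (simp_all add: ac_simps)
  define p where "p = (\<lambda>x. \<lambda>y\<in>carrier A. f (x \<otimes> y))"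
  define q where "q = (\<lambda>y. \<lambda>x\<in>carrier A. f (x \<otimes> y))"
  have p: "p x \<in> carrier (dual A)" and q: "q x \<in> carrier (dual A)" if "x \<in> carrier A" for x
    using dual_right_mult[OF f that] by (simp_all add: p_def q_def)
  have P: "(\<lambda>x\<in>carrier A. G (p x)) \<in> carrier (dual A)"
    by (rule dual_of_bilinear[OF G p _ _ _ K(1)])
      (simp_all add: p_def le mult_closed mult_add_left mult_smult_left dualD(2,3)[OF f])
  have Q: "(\<lambda>y\<in>carrier A. F (q y)) \<in> carrier (dual A)"
    by (rule dual_of_bilinear[OF F q _ _ _ K(1)])
      (simp_all add: q_def le mult_closed mult_add_right mult_smult_right dualD(2,3)[OF f])
  have "((\<lambda>j. f (a i \<otimes> b j)) \<longlongrightarrow> G (p (a i))) J" for i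
    using b(2)[OF p[OF a(1)[of i]]] b(1) by (simp add: p_def)
  moreover have "((\<lambda>i. G (p (a i))) \<longlongrightarrow> arens_first A F G f) I"
    using a(2)[OF P] a(1) f by (simp add: arens_first_def p_def)
  ultimately show "\<exists>h. (\<forall>i. ((\<lambda>j. f (a i \<otimes> b j)) \<longlongrightarrow> h i) J) \<and> (h \<longlongrightarrow> arens_first A F G f) I"
    by (intro exI[of _ "\<lambda>i. G (p (a i))"]) blast
  have "((\<lambda>i. f (a i \<otimes> b j)) \<longlongrightarrow> F (q (b j))) I" for j
    using a(2)[OF q[OF b(1)[of j]]] a(1) by (simp add: q_def)
  moreover have "((\<lambda>j. F (q (b j))) \<longlongrightarrow> arens_second A F G f) J"
    using b(2)[OF Q] b(1) f by (simp add: arens_second_def q_def)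
  ultimately show "\<exists>h. (\<forall>j. ((\<lambda>i. f (a i \<otimes> b j)) \<longlongrightarrow> h j) I) \<and> (h \<longlongrightarrow> arens_second A F G f) J"
    by (intro exI[of _ "\<lambda>j. F (q (b j))"]) blast
qed

end


section \<open>The Hahn-Banach theorem\<close>

definition (in normed_space) dominated_graphs :: "real \<Rightarrow> ('v \<times> real) set set" where
  "dominated_graphs K = {G. G \<subseteq> carrier V \<times> UNIV \<and> (\<zero>, 0) \<in> G \<and>
     (\<forall>x s y t. (x, s) \<in> G \<longrightarrow> (y, t) \<in> G \<longrightarrow> (x \<oplus> y, s + t) \<in> G) \<and>
     (\<forall>x s c. (x, s) \<in> G \<longrightarrow> (complex_of_real c \<odot> x, c * s) \<in> G) \<and>
     (\<forall>x s. (x, s) \<in> G \<longrightarrow> s \<le> K * nrm V x)}"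

lemma (in normed_space) dominated_graph_extend:
  assumes K: "K \<ge> 0" and G: "G \<in> dominated_graphs K" and u: "u \<in> carrier V"
  shows "\<exists>G'\<in>dominated_graphs K. G \<subseteq> G' \<and> (\<exists>c. (u, c) \<in> G')"
proof -
  have Gc: "\<And>x s. (x, s) \<in> G \<Longrightarrow> x \<in> carrier V" and G0: "(\<zero>, 0) \<in> G"
    and Ga: "\<And>x s y t. (x, s) \<in> G \<Longrightarrow> (y, t) \<in> G \<Longrightarrow> (x \<oplus> y, s + t) \<in> G"
    and Gm: "\<And>x s c. (x, s) \<in> G \<Longrightarrow> (complex_of_real c \<odot> x, c * s) \<in> G"
    and Gb: "\<And>x s. (x, s) \<in> G \<Longrightarrow> s \<le> K * nrm V x"
    using G unfolding dominated_graphs_def by blast+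
  have key: "s - K * nrm V (x \<ominus> u) \<le> K * nrm V (y \<oplus> u) - t" if "(x, s) \<in> G" "(y, t) \<in> G" for x s y t
  proof -
    have c: "x \<in> carrier V" "y \<in> carrier V" using that Gc by auto
    have "x \<oplus> y = (x \<ominus> u) \<oplus> (y \<oplus> u)"
      using c u add4[of x "\<ominus> u" y u] by (simp add: a_minus_def l_neg)
    then have "nrm V (x \<oplus> y) \<le> nrm V (x \<ominus> u) + nrm V (y \<oplus> u)"
      using c u nrm_triangle[of "x \<ominus> u" "y \<oplus> u"] by simp
    then have "K * nrm V (x \<oplus> y) \<le> K * nrm V (x \<ominus> u) + K * nrm V (y \<oplus> u)"
      using K by (metis distrib_left mult_left_mono)
    with Gb[OF Ga[OF that]] show ?thesis by linarith
  qed
  define c where "c = (SUP (x, s)\<in>G. s - K * nrm V (x \<ominus> u))"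
  have bdd: "bdd_above ((\<lambda>(x, s). s - K * nrm V (x \<ominus> u)) ` G)"
    using key[OF _ G0] by (intro bdd_aboveI[where M = "K * nrm V (\<zero> \<oplus> u) - 0"]) auto
  have c1: "s - K * nrm V (x \<ominus> u) \<le> c" if "(x, s) \<in> G" for x s
    using cSUP_upper[OF that bdd] by (simp add: c_def)
  have c2: "c \<le> K * nrm V (x \<oplus> u) - s" if "(x, s) \<in> G" for x s
    unfolding c_def using G0 key[OF _ that] by (intro cSUP_least) auto
  define G' where "G' = {(x \<oplus> complex_of_real a \<odot> u, s + a * c) | x s a. (x, s) \<in> G}"
  have dom: "s + a * c \<le> K * nrm V (x \<oplus> complex_of_real a \<odot> u)" if xs: "(x, s) \<in> G" for x s a
  proof (cases "a = 0")
    case True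
    then show ?thesis using Gb[OF xs] Gc[OF xs] u by simp
  next
    case False
    have x: "x \<in> carrier V" using Gc xs by auto
    define z where "z = complex_of_real (1 / \<bar>a\<bar>) \<odot> x"
    have zc: "z \<in> carrier V" using x by (simp add: z_def)
    have zG: "(z, s / \<bar>a\<bar>) \<in> G" using Gm[OF xs, of "1 / \<bar>a\<bar>"] by (simp add: z_def)
    have xz: "x = complex_of_real \<bar>a\<bar> \<odot> z" using x False by (simp add: z_def smult_smult flip: of_real_mult)
    show ?thesis
    proof (cases "a > 0")
      case True
      have "x \<oplus> complex_of_real a \<odot> u = complex_of_real a \<odot> (z \<oplus> u)"
        using True xz zc u by (simp add: smult_right_add)
      then have "K * nrm V (x \<oplus> complex_of_real a \<odot> u) = a * (K * nrm V (z \<oplus> u))"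
        using True zc u by (simp only: nrm_smult) (simp add: nrm_smult)
      moreover have "c \<le> K * nrm V (z \<oplus> u) - s / a" using c2[OF zG] True by simp
      then have "a * c \<le> a * (K * nrm V (z \<oplus> u) - s / a)" using True by (intro mult_left_mono) auto
      then have "a * c \<le> a * (K * nrm V (z \<oplus> u)) - s" using True by (simp add: right_diff_distrib)
      ultimately show ?thesis by linarith
    next
      case F: False
      have a: "a < 0" using F False by simp
      have "x \<oplus> complex_of_real a \<odot> u = complex_of_real \<bar>a\<bar> \<odot> (z \<ominus> u)"
        using a xz zc u by (simp add: diff_smult smult_right_add smult_smult)
      then have "K * nrm V (x \<oplus> complex_of_real a \<odot> u) = \<bar>a\<bar> * (K * nrm V (z \<ominus> u))"
        using zc u by (simp add: nrm_smult)
      moreover have "s / \<bar>a\<bar> - K * nrm V (z \<ominus> u) \<le> c" using c1[OF zG] by simp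
      then have "\<bar>a\<bar> * (s / \<bar>a\<bar> - K * nrm V (z \<ominus> u)) \<le> \<bar>a\<bar> * c" by (intro mult_left_mono) auto
      ultimately show ?thesis using a by (simp add: right_diff_distrib)
    qed
  qed
  have "G' \<in> dominated_graphs K"
    unfolding dominated_graphs_def
  proof (intro CollectI conjI allI impI)
    show "G' \<subseteq> carrier V \<times> UNIV" using Gc u by (auto simp: G'_def)
    show "(\<zero>, 0) \<in> G'" unfolding G'_def using G0 u
      by (intro CollectI exI[of _ \<zero>] exI[of _ 0]) auto
    fix x s assume "(x, s) \<in> G'"
    then obtain y t a where y: "(y, t) \<in> G" "x = y \<oplus> complex_of_real a \<odot> u" "s = t + a * c"
      unfolding G'_def by blast
    show "s \<le> K * nrm V x" using dom[OF y(1)] y by simp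
    show "(complex_of_real k \<odot> x, k * s) \<in> G'" for k
      unfolding G'_def using y Gm[OF y(1), of k] Gc[OF y(1)] u
      by (intro CollectI exI[of _ "complex_of_real k \<odot> y"] exI[of _ "k * t"] exI[of _ "k * a"])
        (simp add: smult_right_add smult_smult algebra_simps)
    fix x' s' assume "(x', s') \<in> G'"
    then obtain y' t' a' where y': "(y', t') \<in> G" "x' = y' \<oplus> complex_of_real a' \<odot> u" "s' = t' + a' * c"
      unfolding G'_def by blast
    show "(x \<oplus> x', s + s') \<in> G'"
      unfolding G'_def using y(2,3) y'(2,3) Ga[OF y(1) y'(1)] Gc[OF y(1)] Gc[OF y'(1)] u
      by (intro CollectI exI[of _ "y \<oplus> y'"] exI[of _ "t + t'"] exI[of _ "a + a'"])
        (simp add: add4 smult_add distrib_right)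
  qed
  moreover have "G \<subseteq> G'"
  proof (rule subrelI)
    fix x s assume xs: "(x, s) \<in> G"
    then have "(x \<oplus> complex_of_real 0 \<odot> u, s + 0 * c) \<in> G'" unfolding G'_def by blast
    then show "(x, s) \<in> G'" using Gc[OF xs] u by simp
  qed
  moreover have "(u, c) \<in> G'" unfolding G'_def using G0 u
    by (intro CollectI exI[of _ \<zero>] exI[of _ 0] exI[of _ 1]) auto
  ultimately show ?thesis by blast
qed

lemma (in normed_space) hahn_banach:
  assumes W: "W \<subseteq> carrier V" "\<zero> \<in> W" "\<And>x y. x \<in> W \<Longrightarrow> y \<in> W \<Longrightarrow> x \<oplus> y \<in> W"
      "\<And>c x. x \<in> W \<Longrightarrow> c \<odot> x \<in> W"
    and f: "\<And>x y. x \<in> W \<Longrightarrow> y \<in> W \<Longrightarrow> f (x \<oplus> y) = f x + f y"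
      "\<And>c x. x \<in> W \<Longrightarrow> f (c \<odot> x) = c * f x"
      "\<And>x. x \<in> W \<Longrightarrow> cmod (f x) \<le> K * nrm V x"
    and K: "K \<ge> 0"
  shows "\<exists>g\<in>carrier (dual V). (\<forall>x\<in>W. g x = f x) \<and> (\<forall>x\<in>carrier V. cmod (g x) \<le> K * nrm V x)"
proof -
  define G0 where "G0 = {(x, Re (f x)) | x. x \<in> W}"
  have f0: "f \<zero> = 0" using f(2)[of \<zero> 0] W by simp
  have G0: "G0 \<in> dominated_graphs K"
    unfolding dominated_graphs_def
  proof (intro CollectI conjI allI impI)
    show "(\<zero>, 0) \<in> G0" unfolding G0_def using f0 W(2) by force
    show "G0 \<subseteq> carrier V \<times> UNIV" using W by (auto simp: G0_def)
    fix x s assume x: "(x, s) \<in> G0"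
    then show "s \<le> K * nrm V x" using f(3)[of x] complex_Re_le_cmod[of "f x"] by (auto simp: G0_def)
    show "(complex_of_real c \<odot> x, c * s) \<in> G0" for c using x f(2) W(4) by (auto simp: G0_def)
    fix y t assume "(y, t) \<in> G0"
    with x show "(x \<oplus> y, s + t) \<in> G0" using f(1) W(3) by (auto simp: G0_def)
  qed
  define AA where "AA = {G \<in> dominated_graphs K. G0 \<subseteq> G}"
  have "\<exists>U\<in>AA. \<forall>Z\<in>C. Z \<subseteq> U" if C: "subset.chain AA C" for C
  proof (cases "C = {}")
    case True
    then show ?thesis using G0 by (auto simp: AA_def)
  next
    case False
    have CA: "C \<subseteq> AA" and tot: "\<And>Z Z'. Z \<in> C \<Longrightarrow> Z' \<in> C \<Longrightarrow> Z \<subseteq> Z' \<or> Z' \<subseteq> Z"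
      using C by (auto simp: subset.chain_def)
    have "\<Union>C \<in> dominated_graphs K"
      unfolding dominated_graphs_def
    proof (intro CollectI conjI allI impI)
      show "\<Union>C \<subseteq> carrier V \<times> UNIV" "(\<zero>, 0) \<in> \<Union>C"
        using CA False by (auto simp: AA_def dominated_graphs_def)
      fix x s assume x: "(x, s) \<in> \<Union>C"
      then obtain Z where Z: "Z \<in> C" "(x, s) \<in> Z" by blast
      then have "Z \<in> dominated_graphs K" using CA by (auto simp: AA_def)
      then have "s \<le> K * nrm V x" "(complex_of_real c \<odot> x, c * s) \<in> Z" for c
        using Z unfolding dominated_graphs_def by blast+
      then show "s \<le> K * nrm V x" "(complex_of_real c \<odot> x, c * s) \<in> \<Union>C" for c
        using Z by blast+
      fix y t assume "(y, t) \<in> \<Union>C"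
      then obtain Z' where Z': "Z' \<in> C" "(y, t) \<in> Z'" by blast
      from x obtain Z where Z: "Z \<in> C" "(x, s) \<in> Z" by blast
      have "\<exists>U\<in>C. (x, s) \<in> U \<and> (y, t) \<in> U" using tot[OF Z(1) Z'(1)] Z Z' by blast
      then obtain U where U: "U \<in> C" "(x, s) \<in> U" "(y, t) \<in> U" by blast
      then have "U \<in> dominated_graphs K" using CA by (auto simp: AA_def)
      then have "(x \<oplus> y, s + t) \<in> U" using U(2,3) unfolding dominated_graphs_def by blast
      then show "(x \<oplus> y, s + t) \<in> \<Union>C" using U(1) by blast
    qed
    moreover have "G0 \<subseteq> \<Union>C" using CA False by (auto simp: AA_def)
    ultimately have "\<Union>C \<in> AA" by (simp add: AA_def)
    then show ?thesis by blast
  qed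
  from subset_Zorn[OF this] obtain G where G: "G \<in> AA" and max: "\<And>Z. Z \<in> AA \<Longrightarrow> G \<subseteq> Z \<Longrightarrow> Z = G"
    by blast
  have Gd: "G \<in> dominated_graphs K" and G0G: "G0 \<subseteq> G" using G by (auto simp: AA_def)
  have Gc: "\<And>x s. (x, s) \<in> G \<Longrightarrow> x \<in> carrier V"
    and Ga: "\<And>x s y t. (x, s) \<in> G \<Longrightarrow> (y, t) \<in> G \<Longrightarrow> (x \<oplus> y, s + t) \<in> G"
    and Gm: "\<And>x s c. (x, s) \<in> G \<Longrightarrow> (complex_of_real c \<odot> x, c * s) \<in> G"
    and Gb: "\<And>x s. (x, s) \<in> G \<Longrightarrow> s \<le> K * nrm V x"
    using Gd unfolding dominated_graphs_def by blast+
  have total: "\<exists>c. (u, c) \<in> G" if "u \<in> carrier V" for u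
    using dominated_graph_extend[OF K Gd that] max G0G unfolding AA_def by blast
  have single: "s = t" if "(x, s) \<in> G" "(x, t) \<in> G" for x s t
  proof -
    have "s' \<le> t'" if a: "(x, s') \<in> G" "(x, t') \<in> G" for s' t'
    proof -
      have "(x \<oplus> complex_of_real (-1) \<odot> x, s' + (-1) * t') \<in> G" using Ga[OF a(1) Gm[OF a(2)]] .
      moreover have "x \<oplus> complex_of_real (-1) \<odot> x = \<zero>"
        using Gc[OF a(1)] diff_smult[of x x] r_neg[of x] by (simp add: a_minus_def)
      ultimately show ?thesis using Gb by fastforce
    qed
    then show ?thesis using that by (meson order_antisym)
  qed
  define h where "h x = (THE s. (x, s) \<in> G)" for x
  have hG: "(x, h x) \<in> G" if "x \<in> carrier V" for x
  proof -
    have "\<exists>!s. (x, s) \<in> G" using total[OF that] single by blast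
    then show ?thesis unfolding h_def by (rule theI')
  qed
  have heq: "h x = s" if "(x, s) \<in> G" for x s
    using single[OF that hG[OF Gc[OF that]]] by simp
  have h_add: "h (x \<oplus> y) = h x + h y" if "x \<in> carrier V" "y \<in> carrier V" for x y
    using heq[OF Ga[OF hG[OF that(1)] hG[OF that(2)]]] .
  have h_mult: "h (complex_of_real c \<odot> x) = c * h x" if "x \<in> carrier V" for x c
    using heq[OF Gm[OF hG[OF that]]] .
  have h_le: "h x \<le> K * nrm V x" if "x \<in> carrier V" for x using Gb[OF hG[OF that]] .
  have h_W: "h x = Re (f x)" if "x \<in> W" for x
  proof (rule heq)
    show "(x, Re (f x)) \<in> G" using that G0G by (auto simp: G0_def)
  qed
  define g where "g = (\<lambda>x\<in>carrier V. Complex (h x) (- h (\<i> \<odot> x)))"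
  have g_add: "g (x \<oplus> y) = g x + g y" if "x \<in> carrier V" "y \<in> carrier V" for x y
    using that by (simp add: g_def h_add smult_right_add complex_eq_iff)
  have g_mult: "g (c \<odot> x) = c * g x" if x: "x \<in> carrier V" for c x
  proof -
    have e: "c' \<odot> x = complex_of_real (Re c') \<odot> x \<oplus> complex_of_real (Im c') \<odot> (\<i> \<odot> x)" for c'
    proof -
      have "c' = complex_of_real (Re c') + complex_of_real (Im c') * \<i>" by (simp add: complex_eq_iff)
      then have "c' \<odot> x = (complex_of_real (Re c') + complex_of_real (Im c') * \<i>) \<odot> x" by simp
      also have "\<dots> = complex_of_real (Re c') \<odot> x \<oplus> complex_of_real (Im c') \<odot> (\<i> \<odot> x)"
        using x by (simp only: smult_add smult_smult)
      finally show ?thesis .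
    qed
    have hh: "h (c' \<odot> x) = Re c' * h x + Im c' * h (\<i> \<odot> x)" for c'
      by (subst e) (use x in \<open>simp add: h_add h_mult\<close>)
    show ?thesis using x hh[of c] hh[of "\<i> * c"] by (simp add: g_def complex_eq_iff smult_smult)
  qed
  have g_le: "cmod (g x) \<le> K * nrm V x" if x: "x \<in> carrier V" for x
  proof -
    define c where "c = cnj (sgn (g x))"
    have "cmod c \<le> 1" by (simp add: c_def norm_sgn)
    have "c * g x = complex_of_real (cmod (g x))"
    proof (cases "g x = 0")
      case False
      have "c * g x = (g x * cnj (g x)) / complex_of_real (cmod (g x))"
        by (simp add: c_def sgn_eq mult.commute)
      also have "\<dots> = complex_of_real (cmod (g x))"
        using False by (simp add: power2_eq_square flip: complex_norm_square)
      finally show ?thesis .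
    qed simp
    then have "cmod (g x) = Re (g (c \<odot> x))" using x by (simp add: g_mult)
    also have "\<dots> = h (c \<odot> x)" using x by (simp add: g_def)
    also have "\<dots> \<le> K * (cmod c * nrm V x)" using h_le[of "c \<odot> x"] x by (simp add: nrm_smult)
    also have "\<dots> \<le> K * nrm V x" using \<open>cmod c \<le> 1\<close> K nrm_nonneg[OF x]
      by (intro mult_left_mono) (simp_all add: mult_left_le_one_le)
    finally show ?thesis .
  qed
  have "\<exists>K. \<forall>x\<in>carrier V. cmod (g x) \<le> K * nrm V x" using g_le by blast
  moreover have "g \<in> extensional (carrier V)" by (simp add: g_def)
  ultimately have "g \<in> carrier (dual V)" using g_add g_mult by (simp add: dual_def)
  moreover have "g x = f x" if "x \<in> W" for x
  proof -
    have x: "x \<in> carrier V" using that W(1) by blast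
    have "h (\<i> \<odot> x) = - Im (f x)" using h_W[OF W(4)[OF that]] f(2)[OF that, of \<i>] by simp
    then show ?thesis using x h_W[OF that] by (simp add: g_def complex_eq_iff)
  qed
  ultimately show ?thesis using g_le by blast
qed


section \<open>Connes amenability does not depend on the type of the modules\<close>

text \<open>
  The submodule generated by a sequence, and its coding by elements of the index type.
\<close>

context banach_bimodule begin

definition code_ok :: "(complex \<times> nat \<times> 'a option \<times> 'a option) list \<Rightarrow> bool" where
  "code_ok q \<longleftrightarrow> (\<forall>(k, n, a, b)\<in>set q. set_option a \<union> set_option b \<subseteq> carrier A)"

definition l_opt :: "'a option \<Rightarrow> 'y \<Rightarrow> 'y" where
  "l_opt a y = (case a of None \<Rightarrow> y | Some a \<Rightarrow> l a y)"

definition r_opt :: "'y \<Rightarrow> 'a option \<Rightarrow> 'y" where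
  "r_opt y b = (case b of None \<Rightarrow> y | Some b \<Rightarrow> r y b)"

fun code_val :: "(nat \<Rightarrow> 'y) \<Rightarrow> (complex \<times> nat \<times> 'a option \<times> 'a option) list \<Rightarrow> 'y" where
  "code_val g [] = \<zero>"
| "code_val g ((k, n, a, b) # q) = k \<odot> r_opt (l_opt a (g n)) b \<oplus> code_val g q"

lemma code_term_closed [simp]:
  assumes "y \<in> carrier Y" "set_option a \<subseteq> carrier A" "set_option b \<subseteq> carrier A"
  shows "r_opt (l_opt a y) b \<in> carrier Y"
  using assms by (auto simp: r_opt_def l_opt_def l_closed r_closed split: option.splits)

lemma code_ok_Cons: "code_ok ((k, n, a, b) # q) \<longleftrightarrow>
    set_option a \<subseteq> carrier A \<and> set_option b \<subseteq> carrier A \<and> code_ok q"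
  by (auto simp: code_ok_def)

lemma code_ok_append: "code_ok (p @ q) \<longleftrightarrow> code_ok p \<and> code_ok q"
  unfolding code_ok_def by (simp only: set_append ball_Un)

lemma code_val_closed [simp]:
  assumes "\<And>n. g n \<in> carrier Y" "code_ok q" shows "code_val g q \<in> carrier Y"
  using assms(2) by (induction q) (auto simp: code_ok_Cons assms(1))

lemma code_val_append:
  assumes g: "\<And>n. g n \<in> carrier Y" and "code_ok p" "code_ok q"
  shows "code_val g (p @ q) = code_val g p \<oplus> code_val g q"
  using assms(2,3) by (induction p) (auto simp: code_ok_Cons g a_assoc)

lemma code_val_map:
  assumes g: "\<And>n. g n \<in> carrier Y"
    and T: "T \<zero> = \<zero>" "\<And>y z. y \<in> carrier Y \<Longrightarrow> z \<in> carrier Y \<Longrightarrow> T (y \<oplus> z) = T y \<oplus> T z"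
    and t: "\<And>k n a b. set_option a \<subseteq> carrier A \<Longrightarrow> set_option b \<subseteq> carrier A \<Longrightarrow>
      code_ok [t (k, n, a, b)] \<and> code_val g [t (k, n, a, b)] = T (k \<odot> r_opt (l_opt a (g n)) b)"
    and q: "code_ok q"
  shows "code_ok (map t q) \<and> code_val g (map t q) = T (code_val g q)"
  using q
proof (induction q)
  case Nil
  then show ?case by (simp add: T code_ok_def)
next
  case (Cons c q)
  obtain k n a b where c: "c = (k, n, a, b)" by (cases c) auto
  have ab: "set_option a \<subseteq> carrier A" "set_option b \<subseteq> carrier A" and q: "code_ok q"
    using Cons.prems by (auto simp: c code_ok_Cons)
  have IH: "code_ok (map t q)" "code_val g (map t q) = T (code_val g q)" using Cons.IH q by auto
  have t': "code_ok [t c]" "code_val g [t c] = T (k \<odot> r_opt (l_opt a (g n)) b)"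
    using t[OF ab] by (auto simp: c)
  have "code_ok ([t c] @ map t q)" using t' IH by (simp only: code_ok_append)
  moreover have "code_val g ([t c] @ map t q) = T (code_val g (c # q))"
    using code_val_append[OF g t'(1) IH(1)] t'(2) IH(2) T(2)[of "k \<odot> r_opt (l_opt a (g n)) b" "code_val g q"] g ab q
    by (simp add: c)
  ultimately show ?case by simp
qed

definition code_closure :: "(nat \<Rightarrow> 'y) \<Rightarrow> 'y set" where
  "code_closure g = {y \<in> carrier Y. \<forall>e>0. \<exists>q. code_ok q \<and> nrm Y (code_val g q \<ominus> y) < e}"

lemma code_closure_map:
  assumes g: "\<And>n. g n \<in> carrier Y"
    and T: "\<And>y. y \<in> carrier Y \<Longrightarrow> T y \<in> carrier Y" "T \<zero> = \<zero>"
      "\<And>y z. y \<in> carrier Y \<Longrightarrow> z \<in> carrier Y \<Longrightarrow> T (y \<oplus> z) = T y \<oplus> T z"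
      "\<And>y z. y \<in> carrier Y \<Longrightarrow> z \<in> carrier Y \<Longrightarrow> T (y \<ominus> z) = T y \<ominus> T z"
      "\<And>y. y \<in> carrier Y \<Longrightarrow> nrm Y (T y) \<le> C * nrm Y y"
    and t: "\<And>k n a b. set_option a \<subseteq> carrier A \<Longrightarrow> set_option b \<subseteq> carrier A \<Longrightarrow>
      code_ok [t (k, n, a, b)] \<and> code_val g [t (k, n, a, b)] = T (k \<odot> r_opt (l_opt a (g n)) b)"
    and y: "y \<in> code_closure g"
  shows "T y \<in> code_closure g"
proof -
  have yc: "y \<in> carrier Y" using y by (simp add: code_closure_def)
  have "\<exists>q. code_ok q \<and> nrm Y (code_val g q \<ominus> T y) < e" if e: "e > 0" for e :: real
  proof -
    have "e / (\<bar>C\<bar> + 1) > 0" using e by simp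
    then obtain q where q: "code_ok q" "nrm Y (code_val g q \<ominus> y) < e / (\<bar>C\<bar> + 1)"
      using y by (force simp: code_closure_def)
    note m = code_val_map[of g T t q, OF g T(2,3) t q(1)]
    have c: "code_val g q \<in> carrier Y" using g q by simp
    have "nrm Y (code_val g (map t q) \<ominus> T y) = nrm Y (T (code_val g q \<ominus> y))"
      using m c yc T(4) by simp
    also have "\<dots> \<le> C * nrm Y (code_val g q \<ominus> y)" using c yc T(5) by simp
    also have "\<dots> \<le> (\<bar>C\<bar> + 1) * nrm Y (code_val g q \<ominus> y)"
      using c yc nrm_nonneg by (intro mult_right_mono) auto
    also have "\<dots> < e" using q(2) by (simp add: field_simps add_pos_nonneg)
    finally show ?thesis using m by blast
  qed
  then show ?thesis using T(1) yc by (simp add: code_closure_def)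
qed

lemma code_closure_add:
  assumes g: "\<And>n. g n \<in> carrier Y" and y: "y \<in> code_closure g" and z: "z \<in> code_closure g"
  shows "y \<oplus> z \<in> code_closure g"
proof -
  have c: "y \<in> carrier Y" "z \<in> carrier Y" using y z by (auto simp: code_closure_def)
  have "\<exists>q. code_ok q \<and> nrm Y (code_val g q \<ominus> (y \<oplus> z)) < e" if e: "e > 0" for e :: real
  proof -
    have "e / 2 > 0" using e by simp
    then obtain p q where p: "code_ok p" "nrm Y (code_val g p \<ominus> y) < e / 2"
      and q: "code_ok q" "nrm Y (code_val g q \<ominus> z) < e / 2"
      using y z unfolding code_closure_def by blast
    have cc: "code_val g p \<in> carrier Y" "code_val g q \<in> carrier Y" using g p q by auto
    have "nrm Y (code_val g (p @ q) \<ominus> (y \<oplus> z)) < e"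
      using nrm_triangle[of "code_val g p \<ominus> y" "code_val g q \<ominus> z"] cc c p q
      by (simp add: code_val_append[OF g p(1) q(1)] add_diff)
    moreover have "code_ok (p @ q)" using p q by (simp add: code_ok_append)
    ultimately show ?thesis by blast
  qed
  then show ?thesis using c by (simp add: code_closure_def)
qed

lemma code_val_in_closure:
  assumes g: "\<And>n. g n \<in> carrier Y" and q: "code_ok q"
  shows "code_val g q \<in> code_closure g"
proof -
  have "code_val g q \<in> carrier Y" using g q by simp
  moreover from this have "nrm Y (code_val g q \<ominus> code_val g q) = 0"
    using r_neg by (simp add: a_minus_def)
  ultimately show ?thesis using q unfolding code_closure_def by force
qed

lemma code_closure_closed:
  assumes g: "\<And>n. g n \<in> carrier Y" and s: "\<And>n. s n \<in> code_closure g"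
    and y: "y \<in> carrier Y" and lim: "(\<lambda>n::nat. nrm Y (s n \<ominus> y)) \<longlonglongrightarrow> 0"
  shows "y \<in> code_closure g"
proof -
  have "\<exists>q. code_ok q \<and> nrm Y (code_val g q \<ominus> y) < e" if e: "e > 0" for e :: real
  proof -
    have e2: "e / 2 > 0" using e by simp
    have "eventually (\<lambda>n. nrm Y (s n \<ominus> y) < e / 2) sequentially"
      using order_tendstoD(2)[OF lim e2] .
    then obtain n where n: "nrm Y (s n \<ominus> y) < e / 2" by (auto simp: eventually_sequentially)
    have sc: "s n \<in> carrier Y" using s[of n] by (simp add: code_closure_def)
    obtain q where q: "code_ok q" "nrm Y (code_val g q \<ominus> s n) < e / 2"
      using s[of n] e2 unfolding code_closure_def by blast
    have "nrm Y (code_val g q \<ominus> y) < e"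
      using nrm_diff_triangle[of "code_val g q" "s n" y] g q n sc y by simp
    then show ?thesis using q by blast
  qed
  then show ?thesis using y by (simp add: code_closure_def)
qed

lemma code_closure_inj:
  assumes g: "\<And>n. g n \<in> carrier Y"
  obtains J :: "'y \<Rightarrow> 'a sequence_code" where "inj_on J (code_closure g)"
proof -
  have "\<exists>q. \<forall>k. code_ok (q k) \<and> nrm Y (code_val g (q k) \<ominus> y) < 1 / real (Suc k)"
    if "y \<in> code_closure g" for y
    using that by (intro choice) (auto simp: code_closure_def)
  then obtain J where J: "\<And>y k. y \<in> code_closure g \<Longrightarrow> code_ok (J y k) \<and>
      nrm Y (code_val g (J y k) \<ominus> y) < 1 / real (Suc k)"
    by metis
  have "inj_on J (code_closure g)"
  proof (rule inj_onI)
    fix y z assume y: "y \<in> code_closure g" and z: "z \<in> code_closure g" and eq: "J y = J z"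
    have c: "y \<in> carrier Y" "z \<in> carrier Y" using y z by (auto simp: code_closure_def)
    have "nrm Y (y \<ominus> z) \<le> 2 * inverse (real (Suc k))" for k
    proof -
      let ?v = "code_val g (J y k)"
      have "?v \<in> carrier Y" using J[OF y] g by simp
      then have "nrm Y (y \<ominus> z) \<le> nrm Y (?v \<ominus> y) + nrm Y (?v \<ominus> z)"
        using nrm_diff_triangle[of y ?v z] nrm_diff_commute[of y ?v] c by simp
      also have "\<dots> \<le> 1 / real (Suc k) + 1 / real (Suc k)"
        using J[OF y, of k] J[OF z, of k] eq by (intro add_mono) auto
      finally show ?thesis by (simp add: field_simps)
    qed
    moreover have "(\<lambda>k. 2 * inverse (real (Suc k))) \<longlonglongrightarrow> 2 * 0"
      by (intro tendsto_mult LIMSEQ_inverse_real_of_nat tendsto_const)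
    ultimately have "nrm Y (y \<ominus> z) \<le> 2 * 0"
      by (intro LIMSEQ_le_const[where X = "\<lambda>k. 2 * inverse (real (Suc k))"]) auto
    then have "nrm Y (y \<ominus> z) \<le> 0" by simp
    then show "y = z" using c nrm_nonneg[of "y \<ominus> z"] by (intro diff_eq_0) auto
  qed
  then show ?thesis using that by blast
qed

lemma l_zero: "a \<in> carrier A \<Longrightarrow> l a \<zero> = \<zero>"
  using l_smult[of a \<zero> 0] l_closed[of a \<zero>] by simp

lemma r_zero': "a \<in> carrier A \<Longrightarrow> r \<zero> a = \<zero>"
  using r_smult[of a \<zero> 0] r_closed[of a \<zero>] by simp

lemma code_closure_smult:
  assumes g: "\<And>n. g n \<in> carrier Y" and y: "y \<in> code_closure g"
  shows "c \<odot> y \<in> code_closure g"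
proof -
  define t :: "complex \<times> nat \<times> 'a option \<times> 'a option \<Rightarrow> _" where
    "t = (\<lambda>(k, n, a, b). (c * k, n, a, b))"
  have c0: "c \<odot> \<zero> = \<zero>" using smult_smult[of \<zero> c 0] by simp
  show ?thesis
  proof (rule code_closure_map[of g "\<lambda>y. c \<odot> y" "cmod c" t y])
    fix k n and a b :: "'a option" assume "set_option a \<subseteq> carrier A" "set_option b \<subseteq> carrier A"
    then show "code_ok [t (k, n, a, b)] \<and> code_val g [t (k, n, a, b)] = c \<odot> (k \<odot> r_opt (l_opt a (g n)) b)"
      using g by (simp add: t_def code_ok_def smult_smult)
  qed (use assms c0 in \<open>simp_all add: smult_right_add smult_diff nrm_smult\<close>)
qed

lemma code_closure_l:
  assumes A: "\<And>a b. a \<in> carrier A \<Longrightarrow> b \<in> carrier A \<Longrightarrow> a \<otimes>\<^bsub>A\<^esub> b \<in> carrier A"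
    and g: "\<And>n. g n \<in> carrier Y" and y: "y \<in> code_closure g" and c: "c \<in> carrier A"
  shows "l c y \<in> code_closure g"
proof -
  obtain K where K: "\<And>y. y \<in> carrier Y \<Longrightarrow> nrm Y (l c y) \<le> K * nrm A c * nrm Y y"
    using bounded_actions c by blast
  define t :: "complex \<times> nat \<times> 'a option \<times> 'a option \<Rightarrow> _" where
    "t = (\<lambda>(k, n, a, b). (k, n, Some (case a of None \<Rightarrow> c | Some a \<Rightarrow> c \<otimes>\<^bsub>A\<^esub> a), b))"
  show ?thesis
  proof (rule code_closure_map[of g "l c" "K * nrm A c" t y])
    fix k n and a b :: "'a option" assume ab: "set_option a \<subseteq> carrier A" "set_option b \<subseteq> carrier A"
    have la: "l_opt a (g n) \<in> carrier Y" using ab g by (auto simp: l_opt_def l_closed split: option.splits)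
    have e: "l_opt (Some (case a of None \<Rightarrow> c | Some a \<Rightarrow> c \<otimes>\<^bsub>A\<^esub> a)) (g n) = l c (l_opt a (g n))"
      using ab g c by (auto simp: l_opt_def l_mult split: option.splits)
    have r: "r_opt (l c (l_opt a (g n))) b = l c (r_opt (l_opt a (g n)) b)"
      using ab c la by (auto simp: r_opt_def l_r split: option.splits)
    show "code_ok [t (k, n, a, b)] \<and> code_val g [t (k, n, a, b)] = l c (k \<odot> r_opt (l_opt a (g n)) b)"
      using ab c g A code_term_closed[OF g ab]
      by (auto simp: t_def code_ok_def e r l_smult l_closed split: option.splits)
  qed (use g y c K in \<open>simp_all add: l_zero l_closed l_add diff_smult l_smult\<close>)
qed

lemma code_closure_r:
  assumes A: "\<And>a b. a \<in> carrier A \<Longrightarrow> b \<in> carrier A \<Longrightarrow> a \<otimes>\<^bsub>A\<^esub> b \<in> carrier A"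
    and g: "\<And>n. g n \<in> carrier Y" and y: "y \<in> code_closure g" and c: "c \<in> carrier A"
  shows "r y c \<in> code_closure g"
proof -
  obtain K where K: "\<And>y. y \<in> carrier Y \<Longrightarrow> nrm Y (r y c) \<le> K * nrm A c * nrm Y y"
    using bounded_actions c by blast
  define t :: "complex \<times> nat \<times> 'a option \<times> 'a option \<Rightarrow> _" where
    "t = (\<lambda>(k, n, a, b). (k, n, a, Some (case b of None \<Rightarrow> c | Some b \<Rightarrow> b \<otimes>\<^bsub>A\<^esub> c)))"
  show ?thesis
  proof (rule code_closure_map[of g "\<lambda>y. r y c" "K * nrm A c" t y])
    fix k n and a b :: "'a option" assume ab: "set_option a \<subseteq> carrier A" "set_option b \<subseteq> carrier A"
    have la: "l_opt a (g n) \<in> carrier Y" using ab g by (auto simp: l_opt_def l_closed split: option.splits)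
    have e: "r_opt (l_opt a (g n)) (Some (case b of None \<Rightarrow> c | Some b \<Rightarrow> b \<otimes>\<^bsub>A\<^esub> c)) =
        r (r_opt (l_opt a (g n)) b) c"
      using ab c la by (auto simp: r_opt_def r_mult split: option.splits)
    show "code_ok [t (k, n, a, b)] \<and> code_val g [t (k, n, a, b)] = r (k \<odot> r_opt (l_opt a (g n)) b) c"
      using ab c g A code_term_closed[OF g ab]
      by (auto simp: t_def code_ok_def e r_smult r_closed split: option.splits)
  qed (use g y c K in \<open>simp_all add: r_zero' r_closed r_add diff_smult r_smult\<close>)
qed

end

definition transport :: "'y normed \<Rightarrow> 'y set \<Rightarrow> ('y \<Rightarrow> 'u) \<Rightarrow> 'u normed" where
  "transport Y S J = (let I = inv_into S J in
    \<lparr>carrier = J ` S, monoid.mult = (\<lambda>_ _. undefined), monoid.one = undefined,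
     ring.zero = J \<zero>\<^bsub>Y\<^esub>, ring.add = (\<lambda>u v. J (I u \<oplus>\<^bsub>Y\<^esub> I v)),
     module.smult = (\<lambda>k u. J (k \<odot>\<^bsub>Y\<^esub> I u)), nrm = (\<lambda>u. nrm Y (I u))\<rparr>)"

context banach_bimodule begin

context
  fixes S :: "'y set" and J :: "'y \<Rightarrow> 'u"
  assumes S: "S \<subseteq> carrier Y" "\<zero> \<in> S" "\<And>y z. y \<in> S \<Longrightarrow> z \<in> S \<Longrightarrow> y \<oplus> z \<in> S"
      "\<And>k y. y \<in> S \<Longrightarrow> k \<odot> y \<in> S" "\<And>a y. a \<in> carrier A \<Longrightarrow> y \<in> S \<Longrightarrow> l a y \<in> S"
      "\<And>a y. a \<in> carrier A \<Longrightarrow> y \<in> S \<Longrightarrow> r y a \<in> S"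
      "\<And>s y. (\<And>n. s n \<in> S) \<Longrightarrow> y \<in> carrier Y \<Longrightarrow> (\<lambda>n::nat. nrm Y (s n \<ominus> y)) \<longlonglongrightarrow> 0 \<Longrightarrow> y \<in> S"
    and J: "inj_on J S"
begin

abbreviation "I \<equiv> inv_into S J"
abbreviation "l' \<equiv> \<lambda>a u. J (l a (I u))"
abbreviation "r' \<equiv> \<lambda>u a. J (r (I u) a)"

lemma SY: "y \<in> S \<Longrightarrow> y \<in> carrier Y" using S(1) by blast

lemma IJ [simp]: "y \<in> S \<Longrightarrow> I (J y) = y"
  using J by simp

lemma transport_simps:
  "carrier (transport Y S J) = J ` S" "\<zero>\<^bsub>transport Y S J\<^esub> = J \<zero>"
  "u \<oplus>\<^bsub>transport Y S J\<^esub> v = J (I u \<oplus> I v)" "k \<odot>\<^bsub>transport Y S J\<^esub> u = J (k \<odot> I u)"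
  "nrm (transport Y S J) u = nrm Y (I u)"
  by (simp_all add: transport_def Let_def)

lemma normed_space_transport: "normed_space (transport Y S J)"
proof -
  have "abelian_group (transport Y S J)"
  proof (rule abelian_groupI)
    fix u assume "u \<in> carrier (transport Y S J)"
    then obtain y where y: "y \<in> S" "u = J y" by (auto simp: transport_simps)
    have "J ((-1) \<odot> y) \<oplus>\<^bsub>transport Y S J\<^esub> u = \<zero>\<^bsub>transport Y S J\<^esub>"
      using y S(2-6) SY l_neg[of y] by (simp add: transport_simps minus_smult)
    then show "\<exists>v\<in>carrier (transport Y S J). v \<oplus>\<^bsub>transport Y S J\<^esub> u = \<zero>\<^bsub>transport Y S J\<^esub>"
      using y S(2-6) by (intro bexI[of _ "J ((-1) \<odot> y)"]) (auto simp: transport_simps)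
  qed (use S(2-6) SY in \<open>auto simp: transport_simps a_ac\<close>)
  then have "module complex_ring (transport Y S J)"
    by (intro moduleI cring_complex_ring)
      (use S(2-6) SY in \<open>auto simp: transport_simps smult_add smult_right_add smult_smult\<close>)
  then show ?thesis
    by (intro normed_space.intro normed_space_axioms.intro)
      (use S(2-6) SY in \<open>auto simp: transport_simps nrm_nonneg nrm_smult nrm_triangle
        intro!: arg_cong[where f = J] intro: nrm_eq_0\<close>)
qed

lemma banach_bimodule_transport: "banach_bimodule A (transport Y S J) l' r'"
proof -
  interpret T: normed_space "transport Y S J" by (rule normed_space_transport)
  have minus: "J y \<ominus>\<^bsub>transport Y S J\<^esub> J z = J (y \<ominus> z)" "y \<ominus> z \<in> S" if "y \<in> S" "z \<in> S" for y z
    using that S(2-6) SY T.diff_smult[of "J z" "J y"] by (auto simp: transport_simps diff_smult)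
  have "banach_space (transport Y S J)"
  proof (intro banach_space.intro normed_space_transport banach_space_axioms.intro)
    fix s :: "nat \<Rightarrow> 'u" assume s: "\<And>n. s n \<in> carrier (transport Y S J)"
      and cauchy: "\<forall>e>0. \<exists>N. \<forall>m\<ge>N. \<forall>n\<ge>N.
        nrm (transport Y S J) (s m \<ominus>\<^bsub>transport Y S J\<^esub> s n) < e"
    have "\<exists>y. \<forall>n. y n \<in> S \<and> s n = J (y n)"
      using s by (intro choice) (auto simp: transport_simps)
    then obtain y where y: "\<And>n. y n \<in> S" "\<And>n. s n = J (y n)" by blast
    have "\<exists>x\<in>carrier Y. (\<lambda>n. nrm Y (y n \<ominus> x)) \<longlonglongrightarrow> 0"
      using y SY cauchy by (intro complete) (auto simp: minus transport_simps)
    then obtain x where x: "x \<in> carrier Y" "(\<lambda>n. nrm Y (y n \<ominus> x)) \<longlonglongrightarrow> 0" by blast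
    then have "x \<in> S" using S(7)[of y x] y by blast
    then show "\<exists>x\<in>carrier (transport Y S J).
        (\<lambda>n. nrm (transport Y S J) (s n \<ominus>\<^bsub>transport Y S J\<^esub> x)) \<longlonglongrightarrow> 0"
      using x y by (intro bexI[of _ "J x"]) (auto simp: minus transport_simps)
  qed
  moreover have "banach_bimodule_axioms A (transport Y S J) l' r'"
  proof (rule banach_bimodule_axioms.intro)
    obtain K where K: "\<And>a y. a \<in> carrier A \<Longrightarrow> y \<in> carrier Y \<Longrightarrow>
      nrm Y (l a y) \<le> K * nrm A a * nrm Y y \<and> nrm Y (r y a) \<le> K * nrm A a * nrm Y y"
      using bounded_actions by blast
    then show "\<exists>K. \<forall>a\<in>carrier A. \<forall>u\<in>carrier (transport Y S J).
        nrm (transport Y S J) (l' a u) \<le> K * nrm A a * nrm (transport Y S J) u \<and>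
        nrm (transport Y S J) (r' u a) \<le> K * nrm A a * nrm (transport Y S J) u"
      using S(2-6) SY by (intro exI[of _ K]) (auto simp: transport_simps)
  qed (use S(2-6) SY in \<open>auto simp: transport_simps l_add r_add l_smult r_smult l_add_alg r_add_alg
         l_smult_alg r_smult_alg l_mult r_mult l_r\<close>)
  ultimately show ?thesis by (rule banach_bimodule.intro)
qed

lemma dual_transport_extend:
  assumes x': "x' \<in> carrier (dual (transport Y S J))"
  obtains x where "x \<in> carrier (dual Y)" "\<And>y. y \<in> S \<Longrightarrow> x y = x' (J y)"
proof -
  interpret T: normed_space "transport Y S J" by (rule normed_space_transport)
  obtain K where K: "K \<ge> 0" "\<And>u. u \<in> carrier (transport Y S J) \<Longrightarrow> cmod (x' u) \<le> K * nrm (transport Y S J) u"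
    using T.dual_bound[OF x'] by metis
  have "\<exists>x\<in>carrier (dual Y). (\<forall>y\<in>S. x y = x' (J y)) \<and> (\<forall>y\<in>carrier Y. cmod (x y) \<le> K * nrm Y y)"
  proof (rule hahn_banach)
    fix y assume y: "y \<in> S"
    show "cmod (x' (J y)) \<le> K * nrm Y y" using K(2)[of "J y"] y by (simp add: transport_simps)
    show "x' (J (c \<odot> y)) = c * x' (J y)" for c
      using dualD(3)[OF x', of "J y" c] y by (simp add: transport_simps)
    show "x' (J (y \<oplus> z)) = x' (J y) + x' (J z)" if "z \<in> S" for z
      using dualD(2)[OF x', of "J y" "J z"] y that by (simp add: transport_simps)
  qed (use S(1-4) K in auto)
  then show ?thesis using that by blast
qed

lemma implement_on_submodule:
  assumes A: "connes_amenable_over TYPE('u) A P"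
    and N: "normal_dual A P Y l r"
    and D: "derivation A Y l r \<delta>" "continuous_map (weak_star_alg A P) (weak_star Y) \<delta>"
  obtains x where "x \<in> carrier (dual Y)"
    "\<And>a y. a \<in> carrier A \<Longrightarrow> y \<in> S \<Longrightarrow> \<delta> a y = x (r y a) - x (l a y)"
proof -
  interpret T: normed_space "transport Y S J" by (rule normed_space_transport)
  let ?T = "transport Y S J"
  have dl: "\<delta> a \<in> carrier (dual Y)" if "a \<in> carrier A" for a using D(1) that by (auto simp: derivation_def)
  have restr: "(\<lambda>u\<in>J ` S. x (I u)) \<in> carrier (dual ?T)" if x: "x \<in> carrier (dual Y)" for x
  proof -
    obtain K where K: "\<And>y. y \<in> carrier Y \<Longrightarrow> cmod (x y) \<le> K * nrm Y y" using dual_bound[OF x] by metis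
    then have "\<exists>K. \<forall>u\<in>J ` S. cmod (x (I u)) \<le> K * nrm Y (I u)" using SY by (intro exI[of _ K]) auto
    then show ?thesis
      using S(2-6) SY dualD[OF x] by (auto simp: dual_def transport_simps)
  qed
  define \<delta>' where "\<delta>' = (\<lambda>a. \<lambda>u\<in>J ` S. \<delta> a (I u))"
  have d': "derivation A ?T l' r' \<delta>'"
    unfolding derivation_def
  proof (intro conjI ballI allI)
    fix a assume a: "a \<in> carrier A"
    show "\<delta>' a \<in> carrier (dual ?T)" using restr[OF dl[OF a]] by (simp add: \<delta>'_def)
    show "\<delta>' (k \<odot>\<^bsub>A\<^esub> a) = k \<odot>\<^bsub>dual ?T\<^esub> \<delta>' a" for k
      using D(1) a SY by (auto simp: \<delta>'_def derivation_def dual_def transport_simps fun_eq_iff restrict_def)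
    fix b assume b: "b \<in> carrier A"
    show "\<delta>' (a \<oplus>\<^bsub>A\<^esub> b) = \<delta>' a \<oplus>\<^bsub>dual ?T\<^esub> \<delta>' b"
      using D(1) a b SY by (auto simp: \<delta>'_def derivation_def dual_def transport_simps fun_eq_iff restrict_def)
    have "\<delta> (a \<otimes>\<^bsub>A\<^esub> b) y = \<delta> a (l b y) + \<delta> b (r y a)" if "y \<in> carrier Y" for y
      using D(1) a b that by (auto simp: derivation_def dual_def dual_l_def dual_r_def)
    then have *: "\<delta>' (a \<otimes>\<^bsub>A\<^esub> b) (J y) = \<delta>' a (J (l b y)) + \<delta>' b (J (r y a))" if "y \<in> S" for y
      using that a b S(2-6) SY by (simp add: \<delta>'_def)
    show "\<delta>' (a \<otimes>\<^bsub>A\<^esub> b) = dual_r ?T l' (\<delta>' a) b \<oplus>\<^bsub>dual ?T\<^esub> dual_l ?T r' a (\<delta>' b)"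
    proof
      fix u show "(\<delta>' (a \<otimes>\<^bsub>A\<^esub> b)) u = (dual_r ?T l' (\<delta>' a) b \<oplus>\<^bsub>dual ?T\<^esub> dual_l ?T r' a (\<delta>' b)) u"
      proof (cases "u \<in> J ` S")
        case True
        then obtain y where "y \<in> S" "u = J y" by blast
        then show ?thesis using * by (simp add: dual_def dual_l_def dual_r_def transport_simps)
      qed (simp add: \<delta>'_def dual_def transport_simps)
    qed
  qed
  have c': "continuous_map (weak_star_alg A P) (weak_star ?T) \<delta>'"
    unfolding continuous_map_weak_star
  proof (intro conjI ballI)
    fix u assume "u \<in> carrier ?T"
    then obtain y where y: "y \<in> S" "u = J y" by (auto simp: transport_simps)
    have "continuous_map (weak_star_alg A P) euclidean (\<lambda>a. \<delta> a y)"
      using D(2) SY[OF y(1)] by (simp add: continuous_map_weak_star)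
    then show "continuous_map (weak_star_alg A P) euclidean (\<lambda>a. \<delta>' a u)"
      using y by (simp add: \<delta>'_def)
  qed (use d' in \<open>auto simp: derivation_def\<close>)
  have dual_in: "dual_l ?T r' a x' = (\<lambda>u\<in>J ` S. dual_l Y r a x (I u))"
    "dual_r ?T l' x' a = (\<lambda>u\<in>J ` S. dual_r Y l x a (I u))"
    if "\<And>y. y \<in> S \<Longrightarrow> x y = x' (J y)" "a \<in> carrier A" for a x x'
    using that S(2-6) SY by (auto simp: dual_l_def dual_r_def transport_simps fun_eq_iff restrict_def)
  have n': "normal_dual A P ?T l' r'"
    unfolding normal_dual_def
  proof (intro ballI conjI)
    fix x' assume x': "x' \<in> carrier (dual ?T)"
    obtain x where x: "x \<in> carrier (dual Y)" "\<And>y. y \<in> S \<Longrightarrow> x y = x' (J y)"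
      using dual_transport_extend[OF x'] by metis
    have cl: "continuous_map (weak_star_alg A P) (weak_star Y) (\<lambda>a. dual_l Y r a x)"
      and cr: "continuous_map (weak_star_alg A P) (weak_star Y) (\<lambda>a. dual_r Y l x a)"
      using N x(1) by (auto simp: normal_dual_def)
    have gen: "continuous_map (weak_star_alg A P) (weak_star ?T) f'"
      if f: "continuous_map (weak_star_alg A P) (weak_star Y) f"
        and f': "\<And>a. a \<in> carrier A \<Longrightarrow> f' a = (\<lambda>u\<in>J ` S. f a (I u))" for f f'
      unfolding continuous_map_weak_star
    proof (intro conjI ballI)
      fix a assume "a \<in> topspace (weak_star_alg A P)"
      then have a: "a \<in> carrier A" by simp
      have "f a \<in> carrier (dual Y)" using f a by (simp add: continuous_map_weak_star)
      then show "f' a \<in> carrier (dual ?T)" using f'[OF a] restr by simp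
    next
      fix u assume "u \<in> carrier ?T"
      then obtain y where y: "y \<in> S" "u = J y" by (auto simp: transport_simps)
      have "continuous_map (weak_star_alg A P) euclidean (\<lambda>a. f a y)"
        using f SY[OF y(1)] by (simp add: continuous_map_weak_star)
      then show "continuous_map (weak_star_alg A P) euclidean (\<lambda>a. f' a u)"
        by (rule continuous_map_eq) (use y f' in simp)
    qed
    show "continuous_map (weak_star_alg A P) (weak_star ?T) (\<lambda>a. dual_l ?T r' a x')"
      by (rule gen[OF cl]) (use dual_in(1)[of x x'] x(2) in blast)
    show "continuous_map (weak_star_alg A P) (weak_star ?T) (\<lambda>a. dual_r ?T l' x' a)"
      by (rule gen[OF cr]) (use dual_in(2)[of x x'] x(2) in blast)
  qed
  have "inner_derivation A ?T l' r' \<delta>'"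
    using A banach_bimodule_transport n' d' c' unfolding connes_amenable_over_def by blast
  then obtain x' where x': "x' \<in> carrier (dual ?T)"
    and eq: "\<And>a. a \<in> carrier A \<Longrightarrow> \<delta>' a = dual_l ?T r' a x' \<ominus>\<^bsub>dual ?T\<^esub> dual_r ?T l' x' a"
    unfolding inner_derivation_def by blast
  obtain x where x: "x \<in> carrier (dual Y)" "\<And>y. y \<in> S \<Longrightarrow> x y = x' (J y)"
    using dual_transport_extend[OF x'] by metis
  have "\<delta> a y = x (r y a) - x (l a y)" if a: "a \<in> carrier A" and y: "y \<in> S" for a y
  proof -
    have "dual_l ?T r' a x' \<in> carrier (dual ?T)" "dual_r ?T l' x' a \<in> carrier (dual ?T)"
      using n' x' a unfolding normal_dual_def continuous_map_weak_star by auto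
    then have "\<delta>' a (J y) = dual_l ?T r' a x' (J y) - dual_r ?T l' x' a (J y)"
      using eq[OF a] y by (simp add: T.dual_minus transport_simps)
    then show ?thesis using y a S(2-6) x(2) by (simp add: \<delta>'_def dual_l_def dual_r_def transport_simps)
  qed
  then show ?thesis using that x(1) by blast
qed

end

text \<open>
  A map \<open>\<delta>\<close> is implemented by a functional of norm at most \<open>K\<close> iff finitely many values of \<open>\<delta>\<close> always
  satisfy the corresponding inequality.
\<close>

definition comm_sum :: "('a \<times> 'y) list \<Rightarrow> 'y" where
  "comm_sum L = foldr (\<lambda>(a, y) z. (r y a \<ominus> l a y) \<oplus> z) L \<zero>"

definition pairs :: "('a \<times> 'y) list set" where
  "pairs = lists (carrier A \<times> carrier Y)"

lemma pairs_simps [simp]: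
  "[] \<in> pairs" "(a, y) # L \<in> pairs \<longleftrightarrow> a \<in> carrier A \<and> y \<in> carrier Y \<and> L \<in> pairs"
  "L @ L' \<in> pairs \<longleftrightarrow> L \<in> pairs \<and> L' \<in> pairs"
  by (auto simp: pairs_def)

lemma pairs_induct [consumes 1, case_names Nil Cons]:
  assumes "L \<in> pairs" "Q []"
    "\<And>a y L. a \<in> carrier A \<Longrightarrow> y \<in> carrier Y \<Longrightarrow> L \<in> pairs \<Longrightarrow> Q L \<Longrightarrow> Q ((a, y) # L)"
  shows "Q L"
  using assms(1)
proof (induction L)
  case (Cons p L)
  then show ?case using assms(3) by (cases p) simp
qed (rule assms(2))

lemma comm_sum_simps [simp]:
  "comm_sum [] = \<zero>" "comm_sum ((a, y) # L) = (r y a \<ominus> l a y) \<oplus> comm_sum L"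
  by (simp_all add: comm_sum_def)

lemma comm_diff_closed [simp]:
  "a \<in> carrier A \<Longrightarrow> y \<in> carrier Y \<Longrightarrow> r y a \<ominus> l a y \<in> carrier Y"
  by (simp add: l_closed r_closed)

lemma comm_sum_closed [simp]: "L \<in> pairs \<Longrightarrow> comm_sum L \<in> carrier Y"
  by (induction rule: pairs_induct) simp_all

lemma comm_sum_append: "L \<in> pairs \<Longrightarrow> L' \<in> pairs \<Longrightarrow> comm_sum (L @ L') = comm_sum L \<oplus> comm_sum L'"
  by (induction rule: pairs_induct) (simp_all add: a_assoc)

lemma comm_sum_smult:
  "L \<in> pairs \<Longrightarrow> comm_sum (map (\<lambda>(a, y). (a, k \<odot> y)) L) = k \<odot> comm_sum L"
proof (induction rule: pairs_induct)
  case Nil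
  then show ?case using smult_smult[of \<zero> k 0] by simp
next
  case (Cons a y L)
  then have "k \<odot> (r y a \<ominus> l a y) = k \<odot> r y a \<ominus> k \<odot> l a y"
    by (simp add: smult_diff l_closed r_closed)
  with Cons show ?case by (simp add: l_smult r_smult smult_right_add)
qed

lemma helly:
  fixes \<delta> :: "'a \<Rightarrow> 'y \<Rightarrow> complex"
  assumes D: "\<And>a. a \<in> carrier A \<Longrightarrow> \<delta> a \<in> carrier (dual Y)"
    and K: "K \<ge> 0" "\<And>L. L \<in> pairs \<Longrightarrow> cmod (\<Sum>(a, y)\<leftarrow>L. \<delta> a y) \<le> K * nrm Y (comm_sum L)"
  obtains x where "x \<in> carrier (dual Y)"
    "\<And>a y. a \<in> carrier A \<Longrightarrow> y \<in> carrier Y \<Longrightarrow> \<delta> a y = x (r y a) - x (l a y)"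
proof -
  define t where "t = (\<lambda>L. \<Sum>(a, y)\<leftarrow>L. \<delta> a y)"
  define m where "m = (\<lambda>k. map (\<lambda>(a :: 'a, y). (a, k \<odot> y)))"
  have tK: "cmod (t L) \<le> K * nrm Y (comm_sum L)" if "L \<in> pairs" for L
    using K(2)[OF that] by (simp add: t_def)
  have t_append: "t (L @ L') = t L + t L'" for L L' by (simp add: t_def)
  have m_pairs: "m k L \<in> pairs" if "L \<in> pairs" for k L
    using that by (induction rule: pairs_induct) (simp_all add: m_def)
  have t_m: "t (m k L) = k * t L" if "L \<in> pairs" for k L
    using that by (induction rule: pairs_induct) (simp_all add: t_def m_def dualD(3)[OF D] distrib_left)
  have uniq: "t L = t L'" if L: "L \<in> pairs" "L' \<in> pairs" and eq: "comm_sum L = comm_sum L'" for L L'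
  proof -
    have "comm_sum (L @ m (-1) L') = comm_sum L \<ominus> comm_sum L'"
      using L m_pairs by (simp add: comm_sum_append diff_smult) (simp add: m_def comm_sum_smult)
    also have "\<dots> = \<zero>" using eq L r_neg by (simp add: a_minus_def)
    finally have "cmod (t (L @ m (-1) L')) \<le> 0"
      using tK[of "L @ m (-1) L'"] L m_pairs by simp
    then show ?thesis using t_m[OF L(2)] by (simp add: t_append)
  qed
  define W where "W = comm_sum ` pairs"
  define f where "f w = t (SOME L. L \<in> pairs \<and> comm_sum L = w)" for w
  have f: "f (comm_sum L) = t L" if "L \<in> pairs" for L
    unfolding f_def
  proof (rule someI2[of _ L])
    show "L \<in> pairs \<and> comm_sum L = comm_sum L" using that by simp
    show "t L' = t L" if "L' \<in> pairs \<and> comm_sum L' = comm_sum L" for L'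
      by (rule uniq) (use that \<open>L \<in> pairs\<close> in blast)+
  qed
  have "\<exists>x\<in>carrier (dual Y). (\<forall>w\<in>W. x w = f w) \<and> (\<forall>y\<in>carrier Y. cmod (x y) \<le> K * nrm Y y)"
  proof (rule hahn_banach)
    show "W \<subseteq> carrier Y" by (auto simp: W_def)
    show "\<zero> \<in> W" unfolding W_def by (rule image_eqI[of _ _ "[]"]) auto
    fix v assume "v \<in> W"
    then obtain L where L: "L \<in> pairs" "v = comm_sum L" by (auto simp: W_def)
    show "cmod (f v) \<le> K * nrm Y v" using tK[OF L(1)] f[OF L(1)] L by simp
    have cm: "c \<odot> v = comm_sum (m c L)" for c using L by (simp add: m_def comm_sum_smult)
    show "c \<odot> v \<in> W" for c unfolding cm W_def using m_pairs[OF L(1)] by blast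
    show "f (c \<odot> v) = c * f v" for c
      unfolding cm using f[OF m_pairs[OF L(1)]] f[OF L(1)] t_m[OF L(1)] L(2) by simp
    fix w assume "w \<in> W"
    then obtain L' where L': "L' \<in> pairs" "w = comm_sum L'" by (auto simp: W_def)
    have s: "v \<oplus> w = comm_sum (L @ L')" and p: "L @ L' \<in> pairs" using L L' by (auto simp: comm_sum_append)
    show "v \<oplus> w \<in> W" unfolding s W_def using p by blast
    show "f (v \<oplus> w) = f v + f w" unfolding s using f[OF p] f L L' by (simp add: t_append)
  qed (rule K(1))
  then obtain x where x: "x \<in> carrier (dual Y)" "\<And>w. w \<in> W \<Longrightarrow> x w = f w" by blast
  have "\<delta> a y = x (r y a) - x (l a y)" if a: "a \<in> carrier A" and y: "y \<in> carrier Y" for a y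
  proof -
    have L: "[(a, y)] \<in> pairs" using a y by simp
    then have "comm_sum [(a, y)] \<in> W" unfolding W_def by (rule imageI)
    then have "x (comm_sum [(a, y)]) = t [(a, y)]" using x(2) f[OF L] by simp
    then show ?thesis using a y x(1) by (simp add: t_def dual_diff l_closed r_closed)
  qed
  then show ?thesis using that x(1) by blast
qed

end

theorem connes_amenable_imp_over:
  fixes D :: "'d normed"
  assumes closed: "\<And>a b. a \<in> carrier D \<Longrightarrow> b \<in> carrier D \<Longrightarrow> a \<otimes>\<^bsub>D\<^esub> b \<in> carrier D"
    and A: "connes_amenable_over TYPE('d sequence_code) D P"
  shows "connes_amenable_over TYPE('u) D P"
  unfolding connes_amenable_over_def
proof (intro allI impI, elim conjE)
  fix Y :: "'u normed" and l r \<delta>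
  assume bm: "banach_bimodule D Y l r" and N: "normal_dual D P Y l r"
    and d: "derivation D Y l r \<delta>" "continuous_map (weak_star_alg D P) (weak_star Y) \<delta>"
  interpret banach_bimodule D Y l r by (rule bm)
  have dl: "\<delta> a \<in> carrier (dual Y)" if "a \<in> carrier D" for a using d(1) that by (auto simp: derivation_def)
  have "\<exists>K\<ge>0. \<forall>L\<in>pairs. cmod (\<Sum>(a, y)\<leftarrow>L. \<delta> a y) \<le> K * nrm Y (comm_sum L)"
  proof (rule ccontr)
    assume "\<not> ?thesis"
    then have "\<exists>L\<in>pairs. real n * nrm Y (comm_sum L) < cmod (\<Sum>(a, y)\<leftarrow>L. \<delta> a y)" for n :: nat
      by (metis not_le of_nat_0_le_iff)
    then obtain L where L: "\<And>n::nat. L n \<in> pairs"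
        "\<And>n. real n * nrm Y (comm_sum (L n)) < cmod (\<Sum>(a, y)\<leftarrow>L n. \<delta> a y)"
      by metis
    define G where "G = insert \<zero>\<^bsub>Y\<^esub> (\<Union>n. snd ` set (L n))"
    have "countable (\<Union>n. snd ` set (L n))"
      by (rule countable_UN) (auto intro: countable_finite)
    then have "countable G" "G \<noteq> {}" unfolding G_def by auto
    then have rg: "range (from_nat_into G) = G" by (simp add: range_from_nat_into)
    define g where "g = from_nat_into G"
    have GY: "G \<subseteq> carrier Y" using L(1) by (fastforce simp: G_def pairs_def in_lists_conv_set)
    have g: "g n \<in> carrier Y" for n using rg GY by (auto simp: g_def)
    have GS: "y \<in> code_closure g" if "y \<in> G" for y
    proof -
      have "y \<in> range g" using rg that by (simp add: g_def)
      then obtain n where n: "y = g n" by blast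
      have "code_val g [(1, n, None, None)] \<in> code_closure g"
        by (rule code_val_in_closure[OF g]) (simp add: code_ok_def)
      then show ?thesis using g[of n] by (simp add: n r_opt_def l_opt_def)
    qed
    obtain J :: "'u \<Rightarrow> 'd sequence_code" where J: "inj_on J (code_closure g)"
      using code_closure_inj[of g] g by metis
    obtain x where x: "x \<in> carrier (dual Y)"
        "\<And>a y. a \<in> carrier D \<Longrightarrow> y \<in> code_closure g \<Longrightarrow> \<delta> a y = x (r y a) - x (l a y)"
    proof (rule implement_on_submodule[of "code_closure g" J P \<delta>, OF _ _ _ _ _ _ _ J A N d])
      show "code_closure g \<subseteq> carrier Y" by (auto simp: code_closure_def)
      show "\<zero>\<^bsub>Y\<^esub> \<in> code_closure g" by (rule GS) (simp add: G_def)
      show "y \<in> code_closure g"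
        if "\<And>n. s n \<in> code_closure g" "y \<in> carrier Y" "(\<lambda>n::nat. nrm Y (s n \<ominus>\<^bsub>Y\<^esub> y)) \<longlonglongrightarrow> 0" for s y
        using code_closure_closed[of g s y] g that by blast
    qed (use g closed in
        \<open>auto intro: code_closure_add code_closure_smult code_closure_l code_closure_r\<close>)
    obtain K where K: "K \<ge> 0" "\<And>y. y \<in> carrier Y \<Longrightarrow> cmod (x y) \<le> K * nrm Y y"
      using dual_bound[OF x(1)] by metis
    obtain n :: nat where n: "K \<le> real n" using real_arch_simple by blast
    have "(\<Sum>(a, y)\<leftarrow>M. \<delta> a y) = x (comm_sum M)" if "M \<in> pairs" "snd ` set M \<subseteq> G" for M
      using that
    proof (induction rule: pairs_induct)
      case Nil
      then show ?case using dualD(3)[OF x(1), of "\<zero>\<^bsub>Y\<^esub>" 0] by simp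
    next
      case (Cons a y M)
      then have "\<delta> a y = x (r y a) - x (l a y)" using x(2) GS by simp
      then show ?case using Cons x(1)
        by (simp add: dualD(2)[OF x(1)] dual_diff l_closed r_closed)
    qed
    moreover have "snd ` set (L n) \<subseteq> G" unfolding G_def by blast
    ultimately have "cmod (\<Sum>(a, y)\<leftarrow>L n. \<delta> a y) \<le> K * nrm Y (comm_sum (L n))"
      using K(2)[OF comm_sum_closed[OF L(1)]] L(1) by simp
    also have "\<dots> \<le> real n * nrm Y (comm_sum (L n))"
      using n nrm_nonneg L(1) by (intro mult_right_mono) auto
    finally show False using L(2)[of n] by simp
  qed
  then obtain K where K: "K \<ge> 0" "\<And>L. L \<in> pairs \<Longrightarrow> cmod (\<Sum>(a, y)\<leftarrow>L. \<delta> a y) \<le> K * nrm Y (comm_sum L)"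
    by blast
  obtain x where x: "x \<in> carrier (dual Y)"
      "\<And>a y. a \<in> carrier D \<Longrightarrow> y \<in> carrier Y \<Longrightarrow> \<delta> a y = x (r y a) - x (l a y)"
    using helly[OF dl K] by metis
  have "\<delta> a = dual_l Y r a x \<ominus>\<^bsub>dual Y\<^esub> dual_r Y l x a" if a: "a \<in> carrier D" for a
  proof -
    have "dual_l Y r a x \<in> carrier (dual Y)" "dual_r Y l x a \<in> carrier (dual Y)"
      using N x(1) a unfolding normal_dual_def continuous_map_weak_star by auto
    then have "dual_l Y r a x \<ominus>\<^bsub>dual Y\<^esub> dual_r Y l x a = (\<lambda>y\<in>carrier Y. x (r y a) - x (l a y))"
      by (simp add: dual_minus dual_l_def dual_r_def fun_eq_iff restrict_def)
    also have "\<dots> = \<delta> a"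
      using x(2)[OF a] dualD(1)[OF dl[OF a]] by (auto simp: fun_eq_iff restrict_def extensional_def)
    finally show ?thesis by simp
  qed
  then show "inner_derivation D Y l r \<delta>" using x(1) unfolding inner_derivation_def by blast
qed

end

theory Submission
  imports Defs
begin

text \<open>
  Let \<open>B\<close> be the module extension. The projections of \<open>B\<close> to \<open>A\<close> and \<open>M\<close> have second adjoints
  \<open>\<pi> : B\<^sup>*\<^sup>* \<rightarrow> A\<^sup>*\<^sup>*\<close> and \<open>\<delta> : B\<^sup>*\<^sup>* \<rightarrow> M\<^sup>*\<^sup>*\<close>, and every functional on \<open>B\<close> is a sum \<open>\<phi> \<circ> fst + g \<circ> snd\<close> with \<open>\<phi>\<close> in \<open>M\<^sup>*\<close> and
  \<open>g\<close> in \<open>A\<^sup>*\<close>. So an Arens product of \<open>F\<close> and \<open>G\<close> in \<open>B\<^sup>*\<^sup>*\<close> is known from its values at these two kinds of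
  functionals. At \<open>g \<circ> snd\<close> it is the corresponding product of \<open>\<pi> F\<close> and \<open>\<pi> G\<close> in \<open>A\<^sup>*\<^sup>*\<close>. At \<open>\<phi> \<circ> fst\<close> the iterated limit
  of \<open>\<phi> (m \<cdot> b) + \<phi> (a \<cdot> n)\<close> has to be taken; in each summand one of the two limits runs in \<open>M\<close>, and since \<open>M\<close>
  is reflexive it is attained at a point of \<open>M\<close>. Limits can then be exchanged, and both Arens products have the value
  \<open>\<delta> F (\<pi> G \<cdot> \<phi>) + \<delta> G (\<phi> \<cdot> \<pi> F)\<close> (lemma \<open>arens_adjoint_fst\<close>). This proves that \<open>B\<close> is Arens regular.

  The same formula says that \<open>\<delta>\<close> is a derivation from \<open>B\<^sup>*\<^sup>*\<close> into the dual of \<open>M\<^sup>*\<close>, on which \<open>B\<^sup>*\<^sup>*\<close> acts through \<open>\<pi>\<close>;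
  reflexivity of \<open>M\<close> also makes \<open>M\<^sup>*\<close> a bimodule over \<open>A\<^sup>*\<^sup>*\<close> and its dual normal (lemmas \<open>banach_bimodule_dual\<close> and
  \<open>normal_dual_reflexive\<close>). If \<open>B\<^sup>*\<^sup>*\<close> is Connes amenable, then \<open>\<delta>\<close> is inner. At the image of \<open>(m, 0)\<close>, where \<open>\<pi>\<close> vanishes,
  an inner derivation is zero, whereas \<open>\<delta>\<close> is evaluation at \<open>m\<close>. Hence \<open>m = 0\<close> by the Hahn-Banach theorem.

  Finally, Connes amenability passes to the image of a weak*-continuous homomorphism
  (theorem \<open>connes_amenable_over_image\<close>). It passes from \<open>B\<^sup>*\<^sup>*\<close> to \<open>A\<^sup>*\<^sup>*\<close> by \<open>\<pi>\<close>, and if \<open>M = 0\<close> it passes from \<open>A\<^sup>*\<^sup>*\<close> to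
  \<open>B\<^sup>*\<^sup>*\<close> by the second adjoint of \<open>a \<mapsto> (0, a)\<close>. That the two biduals are dual Banach algebras with preduals \<open>A\<^sup>*\<close> and \<open>B\<^sup>*\<close>
  is theorem \<open>is_predual_second_dual\<close>.
\<close>

section \<open>Norms on dual spaces\<close>

lemma dual_simps:
  "f \<oplus>\<^bsub>dual V\<^esub> g = (\<lambda>x\<in>carrier V. f x + g x)"
  "c \<odot>\<^bsub>dual V\<^esub> f = (\<lambda>x\<in>carrier V. c * f x)"
  "\<zero>\<^bsub>dual V\<^esub> = (\<lambda>x\<in>carrier V. 0)"
  by (simp_all add: dual_def)

lemma dualI:
  assumes "\<And>x y. x \<in> carrier V \<Longrightarrow> y \<in> carrier V \<Longrightarrow> f (x \<oplus>\<^bsub>V\<^esub> y) = f x + f y"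
    and "\<And>c x. x \<in> carrier V \<Longrightarrow> f (c \<odot>\<^bsub>V\<^esub> x) = c * f x"
    and "\<And>x. x \<in> carrier V \<Longrightarrow> cmod (f x) \<le> K * nrm V x"
    and "f \<in> extensional (carrier V)"
  shows "f \<in> carrier (dual V)"
proof -
  have "\<exists>K. \<forall>x\<in>carrier V. cmod (f x) \<le> K * nrm V x" using assms(3) by blast
  then show ?thesis using assms(1,2,4) by (simp add: dual_def)
qed

lemma dual_eqI:
  assumes "f \<in> carrier (dual V)" "g \<in> carrier (dual V)" "\<And>x. x \<in> carrier V \<Longrightarrow> f x = g x"
  shows "f = g"
  using assms by (blast intro: extensionalityI dualD(1))

context normed_space begin

lemma bdd_above_unit_ball:
  assumes f: "f \<in> carrier (dual V)"
  shows "bdd_above ((\<lambda>x. cmod (f x)) ` {x \<in> carrier V. nrm V x \<le> 1})"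
proof -
  obtain K where K: "K \<ge> 0" "\<And>x. x \<in> carrier V \<Longrightarrow> cmod (f x) \<le> K * nrm V x"
    using dual_bound[OF f] by metis
  show ?thesis
  proof (rule bdd_aboveI2)
    show "cmod (f y) \<le> K" if "y \<in> {x \<in> carrier V. nrm V x \<le> 1}" for y
      using K(2)[of y] that mult_left_mono[of "nrm V y" 1 K] K(1) by simp
  qed
qed

lemma norm_functional_le:
  assumes f: "f \<in> carrier (dual V)" and x: "x \<in> carrier V"
  shows "cmod (f x) \<le> nrm (dual V) f * nrm V x"
proof (cases "nrm V x = 0")
  case True
  then have "x = 0 \<odot> x" using nrm_eq_0 x by simp
  then have "f x = 0 * f x" using dualD(3)[OF f x, of 0] by metis
  then show ?thesis using True by simp
next
  case False
  then have pos: "nrm V x > 0" using nrm_nonneg[OF x] by simp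
  define y where "y = complex_of_real (1 / nrm V x) \<odot> x"
  have "cmod (f y) \<le> nrm (dual V) f"
    using bdd_above_unit_ball[OF f] unfolding dual_def using x pos by (simp, intro cSUP_upper) (auto simp: y_def nrm_smult norm_divide)
  then have "cmod (f x) / nrm V x \<le> nrm (dual V) f"
    using pos by (simp add: y_def dualD(3)[OF f x] norm_mult norm_divide)
  then show ?thesis using pos by (simp add: field_simps)
qed

lemma dual_nrm_le:
  assumes "K \<ge> 0" "\<And>x. x \<in> carrier V \<Longrightarrow> cmod (f x) \<le> K * nrm V x"
  shows "nrm (dual V) f \<le> K"
proof -
  have "cmod (f x) \<le> K" if "x \<in> carrier V" "nrm V x \<le> 1" for x
    using assms(2)[OF that(1)] mult_left_mono[OF that(2) assms(1)] by simp
  moreover have "\<zero> \<in> {x \<in> carrier V. nrm V x \<le> 1}" by simp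
  ultimately show ?thesis unfolding dual_def by (simp, intro cSUP_least) auto
qed

lemma dual_nrm_nonneg:
  assumes f: "f \<in> carrier (dual V)"
  shows "0 \<le> nrm (dual V) f"
proof -
  have "cmod (f \<zero>) \<le> nrm (dual V) f"
    using bdd_above_unit_ball[OF f] unfolding dual_def by (simp, intro cSUP_upper) auto
  then show ?thesis using norm_ge_zero order_trans by blast
qed

lemma normed_space_dual: "normed_space (dual V)"
proof -
  interpret d: abelian_group "dual V" by (rule abelian_group_dual)
  have "module complex_ring (dual V)"
  proof (intro moduleI cring_complex_ring abelian_group_dual)
    fix c f assume f: "f \<in> carrier (dual V)"
    obtain K where K: "\<And>x. x \<in> carrier V \<Longrightarrow> cmod (f x) \<le> K * nrm V x"
      using dual_bound[OF f] by metis
    have "cmod (c * f x) \<le> (cmod c * K) * nrm V x" if "x \<in> carrier V" for x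
      using mult_left_mono[OF K[OF that], of "cmod c"] by (simp add: norm_mult mult.assoc)
    then show "c \<odot>\<^bsub>dual V\<^esub> f \<in> carrier (dual V)"
      by (intro dualI) (auto simp: dual_simps dualD(2,3)[OF f] distrib_left)
    show "\<one>\<^bsub>complex_ring\<^esub> \<odot>\<^bsub>dual V\<^esub> f = f"
      using dualD(1)[OF f] by (auto simp: dual_simps fun_eq_iff restrict_def extensional_def)
  qed (auto simp: dual_simps fun_eq_iff restrict_def algebra_simps)
  then show ?thesis
  proof (intro normed_space.intro normed_space_axioms.intro)
    fix f assume f: "f \<in> carrier (dual V)"
    show "0 \<le> nrm (dual V) f" by (rule dual_nrm_nonneg[OF f])
    show "f = \<zero>\<^bsub>dual V\<^esub>" if "nrm (dual V) f = 0"
      by (rule dual_eqI[OF f d.zero_closed]) (use norm_functional_le[OF f] that in \<open>auto simp: dual_simps(3)\<close>)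
    show "nrm (dual V) (c \<odot>\<^bsub>dual V\<^esub> f) = cmod c * nrm (dual V) f" for c
    proof (rule antisym)
      have le: "nrm (dual V) (k \<odot>\<^bsub>dual V\<^esub> g) \<le> cmod k * nrm (dual V) g" if g: "g \<in> carrier (dual V)" for k g
      proof (rule dual_nrm_le)
        show "cmod ((k \<odot>\<^bsub>dual V\<^esub> g) x) \<le> cmod k * nrm (dual V) g * nrm V x" if "x \<in> carrier V" for x
          using mult_left_mono[OF norm_functional_le[OF g that], of "cmod k"] that
          by (simp add: dual_simps norm_mult mult.assoc)
      qed (simp add: dual_nrm_nonneg[OF g])
      show "nrm (dual V) (c \<odot>\<^bsub>dual V\<^esub> f) \<le> cmod c * nrm (dual V) f" by (rule le[OF f])
      show "cmod c * nrm (dual V) f \<le> nrm (dual V) (c \<odot>\<^bsub>dual V\<^esub> f)"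
      proof (cases "c = 0")
        case False
        interpret module complex_ring "dual V" by fact
        have cf: "c \<odot>\<^bsub>dual V\<^esub> f \<in> carrier (dual V)" using f by simp
        have "inverse c \<odot>\<^bsub>dual V\<^esub> (c \<odot>\<^bsub>dual V\<^esub> f) = f"
          using False dualD(1)[OF f]
          by (auto simp: dual_simps fun_eq_iff restrict_def extensional_def field_simps)
        with le[OF cf, of "inverse c"] False show ?thesis by (simp add: norm_divide field_simps)
      qed (use \<open>module complex_ring (dual V)\<close> f in
            \<open>simp add: dual_nrm_nonneg module.smult_closed complex_ring_simps\<close>)
    qed
    fix g assume g: "g \<in> carrier (dual V)"
    show "nrm (dual V) (f \<oplus>\<^bsub>dual V\<^esub> g) \<le> nrm (dual V) f + nrm (dual V) g"
    proof (rule dual_nrm_le)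
      show "cmod ((f \<oplus>\<^bsub>dual V\<^esub> g) x) \<le> (nrm (dual V) f + nrm (dual V) g) * nrm V x"
        if "x \<in> carrier V" for x
        using norm_triangle_ineq[of "f x" "g x"] norm_functional_le[OF f that]
          norm_functional_le[OF g that] that by (simp add: dual_simps distrib_right)
    qed (simp add: dual_nrm_nonneg f g)
  qed
qed

lemma banach_space_dual: "banach_space (dual V)"
proof (intro banach_space.intro banach_space_axioms.intro normed_space_dual)
  interpret d: normed_space "dual V" by (rule normed_space_dual)
  fix s :: "nat \<Rightarrow> 'v \<Rightarrow> complex"
  assume s: "\<And>n. s n \<in> carrier (dual V)"
    and C: "\<forall>e>0. \<exists>N. \<forall>m\<ge>N. \<forall>n\<ge>N. nrm (dual V) (s m \<ominus>\<^bsub>dual V\<^esub> s n) < e"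
  have le: "cmod (s m x - s n x) \<le> nrm (dual V) (s m \<ominus>\<^bsub>dual V\<^esub> s n) * nrm V x"
    if "x \<in> carrier V" for m n x
    using norm_functional_le[OF d.minus_closed[OF s[of m] s[of n]] that] that
    by (simp add: dual_minus s)
  \<comment> \<open>the Cauchy condition, with the norm of the dual unfolded to an estimate at every point\<close>
  have uniform: "\<exists>N. \<forall>m\<ge>N. \<forall>n\<ge>N. \<forall>x\<in>carrier V. cmod (s m x - s n x) \<le> e * nrm V x" if e: "e > 0" for e
  proof -
    obtain N where "\<And>m n. m \<ge> N \<Longrightarrow> n \<ge> N \<Longrightarrow> nrm (dual V) (s m \<ominus>\<^bsub>dual V\<^esub> s n) < e"
      using C e by meson
    then have "cmod (s m x - s n x) \<le> e * nrm V x" if "m \<ge> N" "n \<ge> N" "x \<in> carrier V" for m n x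
      using le[OF that(3), of m n] mult_right_mono[OF less_imp_le, of "nrm (dual V) (s m \<ominus>\<^bsub>dual V\<^esub> s n)" e "nrm V x"]
        that nrm_nonneg by fastforce
    then show ?thesis by blast
  qed
  have lim: "(\<lambda>n. s n x) \<longlonglongrightarrow> lim (\<lambda>n. s n x)" if x: "x \<in> carrier V" for x
  proof -
    have "Cauchy (\<lambda>n. s n x)"
    proof (rule metric_CauchyI)
      fix e :: real assume e: "e > 0"
      define e' where "e' = e / (nrm V x + 1)"
      have "e' > 0" "e' * nrm V x < e"
        using e nrm_nonneg[OF x] by (auto simp: e'_def field_simps add_pos_nonneg)
      then show "\<exists>M. \<forall>m\<ge>M. \<forall>n\<ge>M. dist (s m x) (s n x) < e"
        using uniform[of e'] x unfolding dist_norm by (meson le_less_trans)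
    qed
    then show ?thesis by (simp add: Cauchy_convergent_iff convergent_LIMSEQ_iff)
  qed
  define f where "f = (\<lambda>x\<in>carrier V. lim (\<lambda>n. s n x))"
  have f: "(\<lambda>n. s n x) \<longlonglongrightarrow> f x" if "x \<in> carrier V" for x using lim that by (simp add: f_def)
  have near: "\<exists>N. \<forall>n\<ge>N. \<forall>x\<in>carrier V. cmod (s n x - f x) \<le> e * nrm V x" if e: "e > 0" for e
  proof -
    obtain N where N: "\<And>m n x. m \<ge> N \<Longrightarrow> n \<ge> N \<Longrightarrow> x \<in> carrier V \<Longrightarrow> cmod (s m x - s n x) \<le> e * nrm V x"
      using uniform[OF e] by blast
    have "cmod (s n x - f x) \<le> e * nrm V x" if "n \<ge> N" "x \<in> carrier V" for n x
    proof (rule LIMSEQ_le_const2)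
      show "(\<lambda>m. cmod (s n x - s m x)) \<longlonglongrightarrow> cmod (s n x - f x)"
        by (intro tendsto_intros f that)
      show "\<exists>N. \<forall>m\<ge>N. cmod (s n x - s m x) \<le> e * nrm V x" using N that by blast
    qed
    then show ?thesis by blast
  qed
  obtain N where N: "\<And>x. x \<in> carrier V \<Longrightarrow> cmod (s N x - f x) \<le> 1 * nrm V x"
    using near[of 1] by auto
  obtain K where K: "\<And>x. x \<in> carrier V \<Longrightarrow> cmod (s N x) \<le> K * nrm V x"
    using dual_bound[OF s[of N]] by metis
  have fd: "f \<in> carrier (dual V)"
  proof (rule dualI)
    fix x assume x: "x \<in> carrier V"
    show "cmod (f x) \<le> (K + 1) * nrm V x"
      using norm_triangle_ineq4[of "s N x" "s N x - f x"] N[OF x] K[OF x]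
      by (simp add: distrib_right)
    have "(\<lambda>n. s n (c \<odot> x)) \<longlonglongrightarrow> c * f x" for c
      using tendsto_mult_left[OF f[OF x], of c] by (simp add: dualD(3)[OF s x])
    then show "f (c \<odot> x) = c * f x" for c using f[of "c \<odot> x"] x LIMSEQ_unique smult_closed' by blast
    fix y assume y: "y \<in> carrier V"
    have "(\<lambda>n. s n (x \<oplus> y)) \<longlonglongrightarrow> f x + f y"
      using tendsto_add[OF f[OF x] f[OF y]] by (simp add: dualD(2)[OF s x y])
    then show "f (x \<oplus> y) = f x + f y" using f[of "x \<oplus> y"] x y LIMSEQ_unique by blast
  qed (simp add: f_def)
  have "(\<lambda>n. nrm (dual V) (s n \<ominus>\<^bsub>dual V\<^esub> f)) \<longlonglongrightarrow> 0"
  proof (rule LIMSEQ_I)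
    fix e :: real assume e: "e > 0"
    obtain N where "\<And>n x. n \<ge> N \<Longrightarrow> x \<in> carrier V \<Longrightarrow> cmod (s n x - f x) \<le> e / 2 * nrm V x"
      using near[of "e / 2"] e by auto
    then have "nrm (dual V) (s n \<ominus>\<^bsub>dual V\<^esub> f) \<le> e / 2" if "n \<ge> N" for n
      using that e by (intro dual_nrm_le) (auto simp: dual_minus s fd)
    then show "\<exists>N. \<forall>n\<ge>N. norm (nrm (dual V) (s n \<ominus>\<^bsub>dual V\<^esub> f) - 0) < e"
      using e by (intro exI[of _ N]) (fastforce simp: d.nrm_nonneg s fd)
  qed
  then show "\<exists>f\<in>carrier (dual V). (\<lambda>n. nrm (dual V) (s n \<ominus>\<^bsub>dual V\<^esub> f)) \<longlonglongrightarrow> 0"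
    using fd by blast
qed

lemma canonical_closed:
  assumes x: "x \<in> carrier V"
  shows "canonical V x \<in> carrier (dual (dual V))"
proof -
  interpret d: normed_space "dual V" by (rule normed_space_dual)
  show ?thesis
  proof (rule dualI)
    fix f g c assume f: "f \<in> carrier (dual V)"
    show "canonical V x (f \<oplus>\<^bsub>dual V\<^esub> g) = canonical V x f + canonical V x g"
      if g: "g \<in> carrier (dual V)"
      using d.a_closed[OF f g] f g x by (simp add: canonical_def dual_simps)
    show "canonical V x (c \<odot>\<^bsub>dual V\<^esub> f) = c * canonical V x f"
      using d.smult_closed'[OF f, of c] f x by (simp add: canonical_def dual_simps)
    show "cmod (canonical V x f) \<le> nrm V x * nrm (dual V) f"
      using norm_functional_le[OF f x] f by (simp add: canonical_def mult.commute)
  qed (simp add: canonical_def)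
qed

text \<open>
  On the line through a nonzero \<open>x\<close> the functional \<open>c \<odot> x \<mapsto> c * nrm V x\<close> is well defined and of norm \<open>1\<close>;
  its Hahn-Banach extension does not vanish at \<open>x\<close>.
\<close>

lemma functionals_separate:
  assumes x: "x \<in> carrier V" and "\<And>f. f \<in> carrier (dual V) \<Longrightarrow> f x = 0"
  shows "x = \<zero>"
proof (rule ccontr)
  assume nz: "x \<noteq> \<zero>"
  have uniq: "c = d" if "c \<odot> x = d \<odot> x" for c d
  proof (rule ccontr)
    assume "c \<noteq> d"
    have "(c - d) \<odot> x = \<zero>"
      using that smult_add[OF x, of c "- d"] smult_add[OF x, of d "- d"] x by simp
    then have "cmod (c - d) * nrm V x = 0" using nrm_smult[OF x, of "c - d"] by simp
    then show False using \<open>c \<noteq> d\<close> nrm_eq_0[OF x] nz by simp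
  qed
  define f where "f y = (THE c. y = c \<odot> x) * complex_of_real (nrm V x)" for y
  have f: "f (c \<odot> x) = c * complex_of_real (nrm V x)" for c
    unfolding f_def using uniq by (metis (mono_tags, lifting) the_equality)
  have "\<exists>g\<in>carrier (dual V). (\<forall>y\<in>range (\<lambda>c. c \<odot> x). g y = f y) \<and>
      (\<forall>y\<in>carrier V. cmod (g y) \<le> 1 * nrm V y)"
  proof (rule hahn_banach)
    show "\<zero> \<in> range (\<lambda>c. c \<odot> x)" using x by (intro range_eqI[of _ _ 0]) simp
    fix y assume "y \<in> range (\<lambda>c. c \<odot> x)"
    then obtain c where c: "y = c \<odot> x" by blast
    show "k \<odot> y \<in> range (\<lambda>c. c \<odot> x)" "f (k \<odot> y) = k * f y" for k
      using x by (auto simp: c smult_smult f)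
    show "cmod (f y) \<le> 1 * nrm V y" using x nrm_nonneg by (simp add: c f nrm_smult norm_mult)
    fix z assume "z \<in> range (\<lambda>c. c \<odot> x)"
    then obtain d where d: "z = d \<odot> x" by blast
    show "y \<oplus> z \<in> range (\<lambda>c. c \<odot> x)" "f (y \<oplus> z) = f y + f z"
      using x by (auto simp: c d f distrib_right simp flip: smult_add)
  qed (use x in auto)
  then obtain g where "g \<in> carrier (dual V)" "g (1 \<odot> x) = f (1 \<odot> x)" by blast
  then have "complex_of_real (nrm V x) = 0" using assms(2)[of g] x f[of 1] by simp
  then show False using nrm_eq_0[OF x] nz by simp
qed

end

section \<open>Bounded bilinear forms\<close>

text \<open>
  An element \<open>G\<close> of a bidual is applied to the slices \<open>\<beta> u\<close> of a bounded bilinear form \<open>\<beta>\<close>: this is the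
  weak* limit of \<open>\<beta> u v\<^sub>j\<close> along a net \<open>v\<^sub>j\<close> that converges to \<open>G\<close>. The result is again a bounded functional of
  \<open>u\<close>. The Arens products and the actions of \<open>A\<^sup>*\<^sup>*\<close> on \<open>M\<^sup>*\<close> arise by repeating this step.
\<close>

locale bounded_form = U: normed_space U + V: normed_space V
  for U :: "'u normed" and V :: "'v normed" +
  fixes \<beta> :: "'u \<Rightarrow> 'v \<Rightarrow> complex"
  assumes add_left: "u \<in> carrier U \<Longrightarrow> u' \<in> carrier U \<Longrightarrow> v \<in> carrier V
      \<Longrightarrow> \<beta> (u \<oplus>\<^bsub>U\<^esub> u') v = \<beta> u v + \<beta> u' v"
    and add_right: "u \<in> carrier U \<Longrightarrow> v \<in> carrier V \<Longrightarrow> v' \<in> carrier V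
      \<Longrightarrow> \<beta> u (v \<oplus>\<^bsub>V\<^esub> v') = \<beta> u v + \<beta> u v'"
    and smult_left: "u \<in> carrier U \<Longrightarrow> v \<in> carrier V \<Longrightarrow> \<beta> (c \<odot>\<^bsub>U\<^esub> u) v = c * \<beta> u v"
    and smult_right: "u \<in> carrier U \<Longrightarrow> v \<in> carrier V \<Longrightarrow> \<beta> u (c \<odot>\<^bsub>V\<^esub> v) = c * \<beta> u v"
    and bounded: "\<exists>K. \<forall>u\<in>carrier U. \<forall>v\<in>carrier V. cmod (\<beta> u v) \<le> K * nrm U u * nrm V v"
begin

lemma flip: "bounded_form V U (\<lambda>v u. \<beta> u v)"
proof (intro bounded_form.intro bounded_form_axioms.intro U.normed_space_axioms V.normed_space_axioms)
  show "\<exists>K. \<forall>v\<in>carrier V. \<forall>u\<in>carrier U. cmod (\<beta> u v) \<le> K * nrm V v * nrm U u"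
    using bounded by (metis mult.assoc mult.commute)
qed (simp_all add: add_left add_right smult_left smult_right)

lemma slice: "u \<in> carrier U \<Longrightarrow> (\<lambda>v\<in>carrier V. \<beta> u v) \<in> carrier (dual V)"
  using bounded by (elim exE, intro dualI) (auto simp: add_right smult_right)

lemma apply_bidual_bound:
  assumes G: "G \<in> carrier (dual (dual V))" and K: "K \<ge> 0"
      "\<And>u v. u \<in> carrier U \<Longrightarrow> v \<in> carrier V \<Longrightarrow> cmod (\<beta> u v) \<le> K * nrm U u * nrm V v"
    and u: "u \<in> carrier U"
  shows "cmod (G (\<lambda>v\<in>carrier V. \<beta> u v)) \<le> nrm (dual (dual V)) G * K * nrm U u"
proof -
  interpret dV: normed_space "dual V" by (rule V.normed_space_dual)
  have "nrm (dual V) (\<lambda>v\<in>carrier V. \<beta> u v) \<le> K * nrm U u"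
    using K(2)[OF u] by (intro V.dual_nrm_le) (auto simp: K(1) U.nrm_nonneg u)
  then show ?thesis
    using dV.norm_functional_le[OF G slice[OF u]] mult_left_mono dV.dual_nrm_nonneg[OF G]
    by (smt (verit) mult.assoc)
qed

lemma apply_bidual:
  assumes G: "G \<in> carrier (dual (dual V))"
  shows "(\<lambda>u\<in>carrier U. G (\<lambda>v\<in>carrier V. \<beta> u v)) \<in> carrier (dual U)"
proof -
  obtain K where K: "\<And>u v. u \<in> carrier U \<Longrightarrow> v \<in> carrier V \<Longrightarrow> cmod (\<beta> u v) \<le> K * nrm U u * nrm V v"
    using bounded by blast
  have K': "cmod (\<beta> u v) \<le> \<bar>K\<bar> * nrm U u * nrm V v" if "u \<in> carrier U" "v \<in> carrier V" for u v
  proof -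
    have "K * (nrm U u * nrm V v) \<le> \<bar>K\<bar> * (nrm U u * nrm V v)"
      using U.nrm_nonneg V.nrm_nonneg that by (intro mult_right_mono) auto
    then show ?thesis using K[OF that] by (simp add: mult.assoc)
  qed
  show ?thesis
  proof (rule dualI)
    fix u c assume u: "u \<in> carrier U"
    have "(\<lambda>v\<in>carrier V. \<beta> (u \<oplus>\<^bsub>U\<^esub> u') v) = (\<lambda>v\<in>carrier V. \<beta> u v) \<oplus>\<^bsub>dual V\<^esub> (\<lambda>v\<in>carrier V. \<beta> u' v)"
      if "u' \<in> carrier U" for u'
      using u that by (auto simp: dual_simps add_left)
    then show "(\<lambda>u\<in>carrier U. G (\<lambda>v\<in>carrier V. \<beta> u v)) (u \<oplus>\<^bsub>U\<^esub> u') =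
        (\<lambda>u\<in>carrier U. G (\<lambda>v\<in>carrier V. \<beta> u v)) u + (\<lambda>u\<in>carrier U. G (\<lambda>v\<in>carrier V. \<beta> u v)) u'"
      if "u' \<in> carrier U" for u'
      using u that dualD(2)[OF G slice[OF u] slice[OF that]] by simp
    have "(\<lambda>v\<in>carrier V. \<beta> (c \<odot>\<^bsub>U\<^esub> u) v) = c \<odot>\<^bsub>dual V\<^esub> (\<lambda>v\<in>carrier V. \<beta> u v)"
      using u by (auto simp: dual_simps smult_left)
    then show "(\<lambda>u\<in>carrier U. G (\<lambda>v\<in>carrier V. \<beta> u v)) (c \<odot>\<^bsub>U\<^esub> u) =
        c * (\<lambda>u\<in>carrier U. G (\<lambda>v\<in>carrier V. \<beta> u v)) u"
      using u dualD(3)[OF G slice[OF u]] by simp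
    show "cmod ((\<lambda>u\<in>carrier U. G (\<lambda>v\<in>carrier V. \<beta> u v)) u) \<le> nrm (dual (dual V)) G * \<bar>K\<bar> * nrm U u"
      using apply_bidual_bound[OF G abs_ge_zero K' u] u by simp
  qed simp
qed

end

section \<open>Adjoints\<close>

locale bounded_map = V: normed_space V + W: normed_space W
  for V :: "'v normed" and W :: "'w normed" +
  fixes T :: "'v \<Rightarrow> 'w"
  assumes closed: "x \<in> carrier V \<Longrightarrow> T x \<in> carrier W"
    and add: "x \<in> carrier V \<Longrightarrow> y \<in> carrier V \<Longrightarrow> T (x \<oplus>\<^bsub>V\<^esub> y) = T x \<oplus>\<^bsub>W\<^esub> T y"
    and smult: "x \<in> carrier V \<Longrightarrow> T (c \<odot>\<^bsub>V\<^esub> x) = c \<odot>\<^bsub>W\<^esub> T x"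
    and bounded: "\<exists>K. \<forall>x\<in>carrier V. nrm W (T x) \<le> K * nrm V x"

definition adjoint :: "'v normed \<Rightarrow> ('v \<Rightarrow> 'w) \<Rightarrow> ('w \<Rightarrow> complex) \<Rightarrow> 'v \<Rightarrow> complex" where
  "adjoint V T f = (\<lambda>x\<in>carrier V. f (T x))"

definition second_adjoint :: "'v normed \<Rightarrow> 'w normed \<Rightarrow> ('v \<Rightarrow> 'w) \<Rightarrow>
    (('v \<Rightarrow> complex) \<Rightarrow> complex) \<Rightarrow> ('w \<Rightarrow> complex) \<Rightarrow> complex" where
  "second_adjoint V W T = adjoint (dual W) (adjoint V T)"

lemma second_adjoint_apply:
  "f \<in> carrier (dual W) \<Longrightarrow> second_adjoint V W T F f = F (adjoint V T f)"
  by (simp add: second_adjoint_def adjoint_def)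

context bounded_map begin

lemma bound: obtains K where "K \<ge> 0" "\<And>x. x \<in> carrier V \<Longrightarrow> nrm W (T x) \<le> K * nrm V x"
proof -
  obtain K where K: "\<And>x. x \<in> carrier V \<Longrightarrow> nrm W (T x) \<le> K * nrm V x" using bounded by blast
  have "nrm W (T x) \<le> \<bar>K\<bar> * nrm V x" if "x \<in> carrier V" for x
    using K[OF that] mult_right_mono[OF abs_ge_self[of K] V.nrm_nonneg[OF that]] by linarith
  then show ?thesis using that[of "\<bar>K\<bar>"] by simp
qed

lemma bounded_map_adjoint: "bounded_map (dual W) (dual V) (adjoint V T)"
proof (intro bounded_map.intro bounded_map_axioms.intro V.normed_space_dual W.normed_space_dual)
  obtain K where K: "K \<ge> 0" "\<And>x. x \<in> carrier V \<Longrightarrow> nrm W (T x) \<le> K * nrm V x" using bound by metis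
  have le: "cmod (adjoint V T f x) \<le> K * nrm (dual W) f * nrm V x"
    if f: "f \<in> carrier (dual W)" and x: "x \<in> carrier V" for f x
    using W.norm_functional_le[OF f closed[OF x]]
      mult_left_mono[OF K(2)[OF x] W.dual_nrm_nonneg[OF f]] x
    by (simp add: adjoint_def mult.commute mult.left_commute)
  show "\<exists>K. \<forall>f\<in>carrier (dual W). nrm (dual V) (adjoint V T f) \<le> K * nrm (dual W) f"
    using le K(1) W.dual_nrm_nonneg by (intro exI[of _ K] ballI V.dual_nrm_le) auto
  fix f assume f: "f \<in> carrier (dual W)"
  have "adjoint V T f \<in> extensional (carrier V)"
    unfolding adjoint_def by (rule restrict_extensional)
  from dualI[OF _ _ le[OF f] this] show "adjoint V T f \<in> carrier (dual V)"
    by (simp add: adjoint_def closed add smult dualD(2,3)[OF f])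
qed (auto simp: adjoint_def dual_simps closed)

lemma bounded_map_second_adjoint:
  "bounded_map (dual (dual V)) (dual (dual W)) (second_adjoint V W T)"
  unfolding second_adjoint_def using bounded_map.bounded_map_adjoint[OF bounded_map_adjoint] .

lemmas adjoint_closed = bounded_map.closed[OF bounded_map_adjoint]
lemmas second_adjoint_closed = bounded_map.closed[OF bounded_map_second_adjoint]

lemma second_adjoint_right_inverse:
  assumes S: "bounded_map W V S" and TS: "\<And>y. y \<in> carrier W \<Longrightarrow> T (S y) = y"
    and G: "G \<in> carrier (dual (dual W))"
  shows "second_adjoint V W T (second_adjoint W V S G) = G"
proof (rule dual_eqI[OF second_adjoint_closed G])
  interpret S: bounded_map W V S by (rule S)
  show "second_adjoint W V S G \<in> carrier (dual (dual V))" by (rule S.second_adjoint_closed[OF G])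
  fix f assume f: "f \<in> carrier (dual W)"
  have "adjoint W S (adjoint V T f) = f"
    using dualD(1)[OF f] S.closed TS
    by (auto simp: adjoint_def fun_eq_iff restrict_def extensional_def)
  then show "second_adjoint V W T (second_adjoint W V S G) f = G f"
    using f by (simp add: second_adjoint_apply adjoint_closed)
qed

end

section \<open>Second duals of Banach algebras\<close>

text \<open>
  The product is bounded by a constant instead of being submultiplicative, so that a module extension is
  covered although its actions are merely bounded.
\<close>

locale bounded_algebra = normed_space C for C :: "'c normed" (structure) +
  assumes mult_closed: "a \<in> carrier C \<Longrightarrow> b \<in> carrier C \<Longrightarrow> a \<otimes> b \<in> carrier C"
    and mult_add_left: "a \<in> carrier C \<Longrightarrow> b \<in> carrier C \<Longrightarrow> c \<in> carrier C
      \<Longrightarrow> (a \<oplus> b) \<otimes> c = (a \<otimes> c) \<oplus> (b \<otimes> c)"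
    and mult_add_right: "a \<in> carrier C \<Longrightarrow> b \<in> carrier C \<Longrightarrow> c \<in> carrier C
      \<Longrightarrow> a \<otimes> (b \<oplus> c) = (a \<otimes> b) \<oplus> (a \<otimes> c)"
    and mult_smult_left: "a \<in> carrier C \<Longrightarrow> b \<in> carrier C \<Longrightarrow> (k \<odot> a) \<otimes> b = k \<odot> (a \<otimes> b)"
    and mult_smult_right: "a \<in> carrier C \<Longrightarrow> b \<in> carrier C \<Longrightarrow> a \<otimes> (k \<odot> b) = k \<odot> (a \<otimes> b)"
    and bounded_mult: "\<exists>K. \<forall>a\<in>carrier C. \<forall>b\<in>carrier C. nrm C (a \<otimes> b) \<le> K * nrm C a * nrm C b"

lemma (in banach_algebra) bounded_algebra: "bounded_algebra A"
  by (intro bounded_algebra.intro bounded_algebra_axioms.intro normed_space_axioms exI[of _ 1])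
    (auto simp: mult_closed mult_add_left mult_add_right mult_smult_left mult_smult_right nrm_mult)

lemma second_dual_simps [simp]:
  "carrier (second_dual C) = carrier (dual (dual C))"
  "F \<oplus>\<^bsub>second_dual C\<^esub> G = F \<oplus>\<^bsub>dual (dual C)\<^esub> G"
  "c \<odot>\<^bsub>second_dual C\<^esub> F = c \<odot>\<^bsub>dual (dual C)\<^esub> F"
  "F \<otimes>\<^bsub>second_dual C\<^esub> G = arens_first C F G"
  "nrm (second_dual C) = nrm (dual (dual C))"
  "dual (second_dual C) = dual (dual (dual C))"
  by (simp_all add: second_dual_def dual_def)

context bounded_algebra begin

lemma bounded_form_functional:
  assumes f: "f \<in> carrier (dual C)"
  shows "bounded_form C C (\<lambda>a b. f (a \<otimes> b))"
proof (intro bounded_form.intro bounded_form_axioms.intro normed_space_axioms)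
  obtain K where K: "\<And>a b. a \<in> carrier C \<Longrightarrow> b \<in> carrier C \<Longrightarrow> nrm C (a \<otimes> b) \<le> K * nrm C a * nrm C b"
    using bounded_mult by blast
  have "cmod (f (a \<otimes> b)) \<le> nrm (dual C) f * K * nrm C a * nrm C b" if "a \<in> carrier C" "b \<in> carrier C" for a b
    using norm_functional_le[OF f mult_closed[OF that]]
      mult_left_mono[OF K[OF that] dual_nrm_nonneg[OF f]] by (simp add: mult.assoc)
  then show "\<exists>K. \<forall>a\<in>carrier C. \<forall>b\<in>carrier C. cmod (f (a \<otimes> b)) \<le> K * nrm C a * nrm C b" by blast
qed (simp_all add: mult_closed mult_add_left mult_add_right mult_smult_left mult_smult_right dualD(2,3)[OF f])

lemma arens_slice_right: 
  assumes "G \<in> carrier (dual (dual C))" "f \<in> carrier (dual C)"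
  shows "(\<lambda>a\<in>carrier C. G (\<lambda>b\<in>carrier C. f (a \<otimes> b))) \<in> carrier (dual C)"
  using bounded_form.apply_bidual[OF bounded_form_functional] assms by blast

lemma arens_slice_left: 
  assumes "F \<in> carrier (dual (dual C))" "f \<in> carrier (dual C)"
  shows "(\<lambda>b\<in>carrier C. F (\<lambda>a\<in>carrier C. f (a \<otimes> b))) \<in> carrier (dual C)"
  using bounded_form.apply_bidual[OF bounded_form.flip[OF bounded_form_functional]] assms by blast

text \<open>
  As a function of \<open>f\<close> and \<open>a\<close> together, the inner step of the first Arens product is a bounded form itself, with
  the norm of \<open>G\<close> times the constant of the product as its bound.
\<close>

lemma arens_slice_form:
  assumes G: "G \<in> carrier (dual (dual C))"
  shows "bounded_form (dual C) C (\<lambda>f a. G (\<lambda>b\<in>carrier C. f (a \<otimes> b)))"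
proof (intro bounded_form.intro bounded_form_axioms.intro normed_space_axioms normed_space_dual)
  obtain K where K: "\<And>a b. a \<in> carrier C \<Longrightarrow> b \<in> carrier C \<Longrightarrow> nrm C (a \<otimes> b) \<le> K * nrm C a * nrm C b"
    using bounded_mult by blast
  have le: "cmod (f (a \<otimes> b)) \<le> (nrm (dual C) f * \<bar>K\<bar>) * nrm C a * nrm C b"
    if f: "f \<in> carrier (dual C)" and ab: "a \<in> carrier C" "b \<in> carrier C" for f a b
  proof -
    have "K * (nrm C a * nrm C b) \<le> \<bar>K\<bar> * (nrm C a * nrm C b)"
      using nrm_nonneg ab by (intro mult_right_mono) auto
    then have "nrm C (a \<otimes> b) \<le> \<bar>K\<bar> * nrm C a * nrm C b" using K[OF ab] by (simp add: mult.assoc)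
    from mult_left_mono[OF this dual_nrm_nonneg[OF f]] show ?thesis
      using norm_functional_le[OF f mult_closed[OF ab]] by (simp add: mult.assoc)
  qed
  have "cmod (G (\<lambda>b\<in>carrier C. f (a \<otimes> b))) \<le> (nrm (dual (dual C)) G * \<bar>K\<bar>) * nrm (dual C) f * nrm C a"
    if f: "f \<in> carrier (dual C)" and a: "a \<in> carrier C" for f a
    using bounded_form.apply_bidual_bound[OF bounded_form_functional[OF f] G _ le[OF f] a]
      dual_nrm_nonneg[OF f] by (simp add: ac_simps)
  then show "\<exists>K. \<forall>f\<in>carrier (dual C). \<forall>a\<in>carrier C.
      cmod (G (\<lambda>b\<in>carrier C. f (a \<otimes> b))) \<le> K * nrm (dual C) f * nrm C a" by blast
  fix f a c assume f: "f \<in> carrier (dual C)" and a: "a \<in> carrier C"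
  note sl = bounded_form.slice[OF bounded_form_functional]
  show "G (\<lambda>b\<in>carrier C. f ((c \<odot> a) \<otimes> b)) = c * G (\<lambda>b\<in>carrier C. f (a \<otimes> b))"
    using dualD(3)[OF arens_slice_right[OF G f] a, of c] a by simp
  show "G (\<lambda>b\<in>carrier C. f ((a \<oplus> a') \<otimes> b)) = G (\<lambda>b\<in>carrier C. f (a \<otimes> b)) + G (\<lambda>b\<in>carrier C. f (a' \<otimes> b))"
    if "a' \<in> carrier C" for a'
    using dualD(2)[OF arens_slice_right[OF G f] a that] a that by simp
  have "(\<lambda>b\<in>carrier C. (c \<odot>\<^bsub>dual C\<^esub> f) (a \<otimes> b)) = c \<odot>\<^bsub>dual C\<^esub> (\<lambda>b\<in>carrier C. f (a \<otimes> b))"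
    using a by (auto simp: dual_simps mult_closed)
  then show "G (\<lambda>b\<in>carrier C. (c \<odot>\<^bsub>dual C\<^esub> f) (a \<otimes> b)) = c * G (\<lambda>b\<in>carrier C. f (a \<otimes> b))"
    using dualD(3)[OF G sl[OF f a]] by simp
  fix g assume g: "g \<in> carrier (dual C)"
  have "(\<lambda>b\<in>carrier C. (f \<oplus>\<^bsub>dual C\<^esub> g) (a \<otimes> b)) =
      (\<lambda>b\<in>carrier C. f (a \<otimes> b)) \<oplus>\<^bsub>dual C\<^esub> (\<lambda>b\<in>carrier C. g (a \<otimes> b))"
    using a by (auto simp: dual_simps mult_closed)
  then show "G (\<lambda>b\<in>carrier C. (f \<oplus>\<^bsub>dual C\<^esub> g) (a \<otimes> b)) =
      G (\<lambda>b\<in>carrier C. f (a \<otimes> b)) + G (\<lambda>b\<in>carrier C. g (a \<otimes> b))"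
    using dualD(2)[OF G sl[OF f a] sl[OF g a]] by simp
qed

lemma arens_first_closed:
  "F \<in> carrier (dual (dual C)) \<Longrightarrow> G \<in> carrier (dual (dual C)) \<Longrightarrow> arens_first C F G \<in> carrier (dual (dual C))"
  unfolding arens_first_def using bounded_form.apply_bidual[OF arens_slice_form] by blast

lemma arens_second_add:
  assumes F: "F \<in> carrier (dual (dual C))" and G: "G \<in> carrier (dual (dual C))"
    and f: "f \<in> carrier (dual C)" and g: "g \<in> carrier (dual C)"
  shows "arens_second C F G (f \<oplus>\<^bsub>dual C\<^esub> g) = arens_second C F G f + arens_second C F G g"
proof -
  interpret d: normed_space "dual C" by (rule normed_space_dual)
  note sl = bounded_form.slice[OF bounded_form.flip[OF bounded_form_functional]]
  have "(\<lambda>a\<in>carrier C. (f \<oplus>\<^bsub>dual C\<^esub> g) (a \<otimes> b)) =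
      (\<lambda>a\<in>carrier C. f (a \<otimes> b)) \<oplus>\<^bsub>dual C\<^esub> (\<lambda>a\<in>carrier C. g (a \<otimes> b))"
    if "b \<in> carrier C" for b using that by (auto simp: dual_simps mult_closed)
  then have "(\<lambda>b\<in>carrier C. F (\<lambda>a\<in>carrier C. (f \<oplus>\<^bsub>dual C\<^esub> g) (a \<otimes> b))) =
      (\<lambda>b\<in>carrier C. F (\<lambda>a\<in>carrier C. f (a \<otimes> b))) \<oplus>\<^bsub>dual C\<^esub> (\<lambda>b\<in>carrier C. F (\<lambda>a\<in>carrier C. g (a \<otimes> b)))"
    unfolding dual_simps(1)[where f = "\<lambda>b\<in>carrier C. F (\<lambda>a\<in>carrier C. f (a \<otimes> b))"]
    using dualD(2)[OF F sl[OF f] sl[OF g]] by (intro restrict_ext) simp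
  then show ?thesis
    using dualD(2)[OF G arens_slice_left[OF F f] arens_slice_left[OF F g]] f g
    by (simp add: arens_second_def)
qed

end

context normed_space begin

lemma nrm_canonical_le:
  assumes x: "x \<in> carrier V"
  shows "nrm (dual (dual V)) (canonical V x) \<le> nrm V x"
  by (rule normed_space.dual_nrm_le[OF normed_space_dual nrm_nonneg[OF x]])
    (use norm_functional_le[OF _ x] in \<open>simp add: canonical_def mult.commute[of "nrm V x"]\<close>)

lemma bounded_map_canonical: "bounded_map V (dual (dual V)) (canonical V)"
proof (intro bounded_map.intro bounded_map_axioms.intro normed_space_axioms
    normed_space.normed_space_dual normed_space_dual)
  show "\<exists>K. \<forall>x\<in>carrier V. nrm (dual (dual V)) (canonical V x) \<le> K * nrm V x"
    using nrm_canonical_le by (intro exI[of _ 1]) simp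
  show "canonical V x \<in> carrier (dual (dual V))" if "x \<in> carrier V" for x
    by (rule canonical_closed[OF that])
qed (auto simp: canonical_def dual_simps fun_eq_iff dualD(2,3))

text \<open>
  The embedding of a dual space in its bidual is isometric because \<open>canonical V\<close> maps the unit ball of \<open>V\<close>,
  over which the supremum that defines the norm of \<open>f\<close> is taken, into the unit ball of the bidual.
\<close>

lemma nrm_canonical_dual:
  assumes f: "f \<in> carrier (dual V)"
  shows "nrm (dual (dual (dual V))) (canonical (dual V) f) = nrm (dual V) f"
proof (rule antisym)
  interpret d: normed_space "dual V" by (rule normed_space_dual)
  interpret dd: normed_space "dual (dual V)" by (rule d.normed_space_dual)
  have cf: "canonical (dual V) f \<in> carrier (dual (dual (dual V)))" by (rule d.canonical_closed[OF f])
  show "nrm (dual (dual (dual V))) (canonical (dual V) f) \<le> nrm (dual V) f"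
    by (rule d.nrm_canonical_le[OF f])
  show "nrm (dual V) f \<le> nrm (dual (dual (dual V))) (canonical (dual V) f)"
  proof (rule dual_nrm_le)
    fix x assume x: "x \<in> carrier V"
    have "cmod (f x) = cmod (canonical (dual V) f (canonical V x))"
      using canonical_closed[OF x] f by (simp add: canonical_def)
    also have "\<dots> \<le> nrm (dual (dual (dual V))) (canonical (dual V) f) * nrm (dual (dual V)) (canonical V x)"
      by (rule dd.norm_functional_le[OF cf canonical_closed[OF x]])
    also have "\<dots> \<le> nrm (dual (dual (dual V))) (canonical (dual V) f) * nrm V x"
      by (intro mult_left_mono nrm_canonical_le x dd.dual_nrm_nonneg cf)
    finally show "cmod (f x) \<le> nrm (dual (dual (dual V))) (canonical (dual V) f) * nrm V x" .
  qed (rule dd.dual_nrm_nonneg[OF cf])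
qed

end

lemma (in bounded_map) submodule_image: "submodule (T ` carrier V) complex_ring W"
proof (rule W.submoduleI)
  show "\<zero>\<^bsub>W\<^esub> \<in> T ` carrier V"
    using smult[of "\<zero>\<^bsub>V\<^esub>" 0] closed[of "\<zero>\<^bsub>V\<^esub>"] by (intro image_eqI[of _ _ "\<zero>\<^bsub>V\<^esub>"]) auto
  show "\<ominus>\<^bsub>W\<^esub> w \<in> T ` carrier V" if "w \<in> T ` carrier V" for w
    using that closed by (auto simp: W.minus_smult simp flip: smult)
qed (use closed in \<open>auto simp flip: add smult\<close>)

text \<open>
  An element of \<open>C\<^sup>*\<^sup>*\<close> is by definition a functional on \<open>C\<^sup>*\<close>, and \<open>C\<^sup>*\<close> sits isometrically in \<open>C\<^sup>*\<^sup>*\<^sup>*\<close>; this gives the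
  identification of \<open>C\<^sup>*\<^sup>*\<close> with the dual of the image, and, as \<open>C\<^sup>*\<close> is complete, the image is closed. It is
  invariant because both factors of a product can be reached weak*-continuously: \<open>G \<mapsto> G F\<close> evaluated at \<open>f\<close> is
  evaluation at a functional on \<open>C\<close> by the form of the first Arens product, and \<open>G \<mapsto> F G\<close> is so by the form of
  the second one, which equals the first by regularity.
\<close>

theorem (in bounded_algebra) is_predual_second_dual:
  assumes reg: "arens_regular C"
  shows "is_predual (second_dual C) (second_dual_predual C)"
proof -
  interpret d: banach_space "dual C" by (rule banach_space_dual)
  interpret dd: normed_space "dual (dual C)" by (rule d.normed_space_dual)
  interpret ddd: normed_space "dual (dual (dual C))" by (rule dd.normed_space_dual)
  interpret can: bounded_map "dual C" "dual (dual (dual C))" "canonical (dual C)"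
    by (rule d.bounded_map_canonical)
  let ?P = "second_dual_predual C"
  let ?E = "dual (dual (dual C))\<lparr>carrier := ?P\<rparr>"
  have P_def: "?P = canonical (dual C) ` carrier (dual C)" by (simp add: second_dual_predual_def)
  have canI: "canonical (dual C) f \<in> ?P" if "f \<in> carrier (dual C)" for f using that by (simp add: P_def)
  have can_apply: "canonical (dual C) f F = F f" if "F \<in> carrier (dual (dual C))" for f F
    using that by (simp add: canonical_def)
  have E: "carrier ?E = ?P" "\<And>p q. p \<oplus>\<^bsub>?E\<^esub> q = p \<oplus>\<^bsub>dual (dual (dual C))\<^esub> q"
    "\<And>c p. c \<odot>\<^bsub>?E\<^esub> p = c \<odot>\<^bsub>dual (dual (dual C))\<^esub> p" "nrm ?E = nrm (dual (dual (dual C)))" by simp_all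
  have actions: "dual_l (second_dual C) (\<lambda>b a. b \<otimes>\<^bsub>second_dual C\<^esub> a) F p \<in> ?P"
    "dual_r (second_dual C) (\<lambda>a b. a \<otimes>\<^bsub>second_dual C\<^esub> b) p F \<in> ?P"
    if p: "p \<in> ?P" and F: "F \<in> carrier (dual (dual C))" for p F
  proof -
    obtain f where f: "f \<in> carrier (dual C)" "p = canonical (dual C) f" using p by (auto simp: P_def)
    have "dual_l (second_dual C) (\<lambda>b a. b \<otimes>\<^bsub>second_dual C\<^esub> a) F p =
        canonical (dual C) (\<lambda>a\<in>carrier C. F (\<lambda>b\<in>carrier C. f (a \<otimes> b)))"
      unfolding dual_l_def second_dual_simps
    proof (unfold canonical_def, rule restrict_ext)
      fix G assume G: "G \<in> carrier (dual (dual C))"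
      show "p (arens_first C G F) = G (\<lambda>a\<in>carrier C. F (\<lambda>b\<in>carrier C. f (a \<otimes> b)))"
        using arens_first_closed[OF G F] f by (simp add: can_apply) (simp add: arens_first_def)
    qed
    then show "dual_l (second_dual C) (\<lambda>b a. b \<otimes>\<^bsub>second_dual C\<^esub> a) F p \<in> ?P"
      using canI[OF arens_slice_right[OF F f(1)]] by simp
    have "dual_r (second_dual C) (\<lambda>a b. a \<otimes>\<^bsub>second_dual C\<^esub> b) p F =
        canonical (dual C) (\<lambda>b\<in>carrier C. F (\<lambda>a\<in>carrier C. f (a \<otimes> b)))"
      unfolding dual_r_def second_dual_simps
    proof (unfold canonical_def, rule restrict_ext)
      fix G assume G: "G \<in> carrier (dual (dual C))"
      have "arens_first C F G f = arens_second C F G f"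
        using reg F G by (simp add: arens_regular_def)
      then show "p (arens_first C F G) = G (\<lambda>b\<in>carrier C. F (\<lambda>a\<in>carrier C. f (a \<otimes> b)))"
        using arens_first_closed[OF F G] f by (simp add: can_apply) (simp add: arens_second_def)
    qed
    then show "dual_r (second_dual C) (\<lambda>a b. a \<otimes>\<^bsub>second_dual C\<^esub> b) p F \<in> ?P"
      using canI[OF arens_slice_left[OF F f(1)]] by simp
  qed
  have closed: "\<phi> \<in> ?P"
    if s: "\<And>n::nat. s n \<in> ?P" and \<phi>: "\<phi> \<in> carrier (dual (dual (dual C)))"
      and lim: "(\<lambda>n. nrm (dual (dual (dual C))) (s n \<ominus>\<^bsub>dual (dual (dual C))\<^esub> \<phi>)) \<longlonglongrightarrow> 0" for s \<phi>
  proof -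
    let ?n = "nrm (dual (dual (dual C)))"
    obtain f where f: "\<And>n. f n \<in> carrier (dual C)" "\<And>n. s n = canonical (dual C) (f n)"
      using s unfolding P_def image_iff by metis
    have s3: "s n \<in> carrier (dual (dual (dual C)))" for n using f can.closed by simp
    have diff: "canonical (dual C) (g \<ominus>\<^bsub>dual C\<^esub> h) = canonical (dual C) g \<ominus>\<^bsub>dual (dual (dual C))\<^esub> canonical (dual C) h"
      if "g \<in> carrier (dual C)" "h \<in> carrier (dual C)" for g h
      using that by (simp add: d.diff_smult ddd.diff_smult can.closed can.add can.smult)
    have iso: "nrm (dual C) (g \<ominus>\<^bsub>dual C\<^esub> h) =
        ?n (canonical (dual C) g \<ominus>\<^bsub>dual (dual (dual C))\<^esub> canonical (dual C) h)"
      if "g \<in> carrier (dual C)" "h \<in> carrier (dual C)" for g h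
      using nrm_canonical_dual[of "g \<ominus>\<^bsub>dual C\<^esub> h"] that by (simp add: diff)
    have "\<exists>g\<in>carrier (dual C). (\<lambda>n. nrm (dual C) (f n \<ominus>\<^bsub>dual C\<^esub> g)) \<longlonglongrightarrow> 0"
    proof (rule d.complete[OF f(1)], intro allI impI)
      fix e :: real assume e: "e > 0"
      then have "eventually (\<lambda>n. ?n (s n \<ominus>\<^bsub>dual (dual (dual C))\<^esub> \<phi>) < e / 2) sequentially"
        using order_tendstoD(2)[OF lim half_gt_zero] by blast
      then obtain N where N: "\<And>n. n \<ge> N \<Longrightarrow> ?n (s n \<ominus>\<^bsub>dual (dual (dual C))\<^esub> \<phi>) < e / 2"
        by (auto simp: eventually_sequentially)
      have "nrm (dual C) (f m \<ominus>\<^bsub>dual C\<^esub> f n) < e" if "m \<ge> N" "n \<ge> N" for m n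
        using N[OF that(1)] N[OF that(2)] ddd.nrm_diff_triangle[OF s3[of m] \<phi> s3[of n]]
          ddd.nrm_diff_commute[OF s3[of n] \<phi>] f by (simp add: iso)
      then show "\<exists>N. \<forall>m\<ge>N. \<forall>n\<ge>N. nrm (dual C) (f m \<ominus>\<^bsub>dual C\<^esub> f n) < e" by blast
    qed
    then obtain g where g: "g \<in> carrier (dual C)" "(\<lambda>n. nrm (dual C) (f n \<ominus>\<^bsub>dual C\<^esub> g)) \<longlonglongrightarrow> 0"
      by blast
    let ?g = "canonical (dual C) g"
    have g3: "?g \<in> carrier (dual (dual (dual C)))" using can.closed g(1) .
    have "(\<lambda>n. ?n (s n \<ominus>\<^bsub>dual (dual (dual C))\<^esub> \<phi>) + ?n (s n \<ominus>\<^bsub>dual (dual (dual C))\<^esub> ?g)) \<longlonglongrightarrow> 0 + 0"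
      using tendsto_add[OF lim g(2)] f g(1) by (simp add: iso)
    moreover have "?n (\<phi> \<ominus>\<^bsub>dual (dual (dual C))\<^esub> ?g) \<le>
        ?n (s n \<ominus>\<^bsub>dual (dual (dual C))\<^esub> \<phi>) + ?n (s n \<ominus>\<^bsub>dual (dual (dual C))\<^esub> ?g)" for n
      using ddd.nrm_diff_triangle[OF \<phi> s3[of n] g3] ddd.nrm_diff_commute[OF s3[of n] \<phi>] by simp
    ultimately have "?n (\<phi> \<ominus>\<^bsub>dual (dual (dual C))\<^esub> ?g) \<le> 0"
      using LIMSEQ_le_const by fastforce
    then have "\<phi> = ?g"
      using ddd.diff_eq_0[OF \<phi> g3] ddd.nrm_nonneg[OF ddd.minus_closed[OF \<phi> g3]] by linarith
    then show ?thesis using canI[OF g(1)] by simp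
  qed
  have restr: "(\<lambda>p\<in>?P. p F) \<in> carrier (dual ?E)" if F: "F \<in> carrier (dual (dual C))" for F
  proof (rule dualI)
    show "cmod ((\<lambda>p\<in>?P. p F) p) \<le> nrm (dual (dual C)) F * nrm ?E p" if "p \<in> carrier ?E" for p
      using that d.norm_functional_le[OF F] F nrm_canonical_dual by (auto simp: P_def can_apply)
  next
    fix p q c assume "p \<in> carrier ?E"
    then obtain f where f: "f \<in> carrier (dual C)" "p = canonical (dual C) f" by (auto simp: P_def)
    show "(\<lambda>p\<in>?P. p F) (c \<odot>\<^bsub>?E\<^esub> p) = c * (\<lambda>p\<in>?P. p F) p"
      using canI d.smult_closed' F f by (simp add: can_apply dualD(3)[OF F] flip: can.smult)
    assume "q \<in> carrier ?E"
    then obtain g where g: "g \<in> carrier (dual C)" "q = canonical (dual C) g" by (auto simp: P_def)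
    show "(\<lambda>p\<in>?P. p F) (p \<oplus>\<^bsub>?E\<^esub> q) = (\<lambda>p\<in>?P. p F) p + (\<lambda>p\<in>?P. p F) q"
      using canI F f g by (simp add: can_apply dualD(2)[OF F] flip: can.add)
  qed (simp add: E)
  have "bij_betw (\<lambda>F. \<lambda>p\<in>?P. p F) (carrier (dual (dual C))) (carrier (dual ?E))"
  proof (rule bij_betwI')
    fix F G assume F: "F \<in> carrier (dual (dual C))" and G: "G \<in> carrier (dual (dual C))"
    have "F f = G f" if "(\<lambda>p\<in>?P. p F) = (\<lambda>p\<in>?P. p G)" "f \<in> carrier (dual C)" for f
      using fun_cong[OF that(1), of "canonical (dual C) f"] canI[OF that(2)] F G by (simp add: can_apply)
    then show "((\<lambda>p\<in>?P. p F) = (\<lambda>p\<in>?P. p G)) = (F = G)" using dual_eqI[OF F G] by blast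
  next
    fix X assume X: "X \<in> carrier (dual ?E)"
    define F where "F = (\<lambda>f\<in>carrier (dual C). X (canonical (dual C) f))"
    have "\<exists>K. \<forall>p\<in>carrier ?E. cmod (X p) \<le> K * nrm ?E p" using X unfolding dual_def[of ?E] by simp
    then obtain K where K: "\<And>p. p \<in> ?P \<Longrightarrow> cmod (X p) \<le> K * nrm (dual (dual (dual C))) p"
      unfolding E by blast
    have F: "F \<in> carrier (dual (dual C))"
    proof (rule dualI)
      fix f g c assume f: "f \<in> carrier (dual C)"
      show "cmod (F f) \<le> K * nrm (dual C) f"
        using K[OF canI[OF f]] f by (simp add: F_def nrm_canonical_dual)
      show "F (c \<odot>\<^bsub>dual C\<^esub> f) = c * F f"
        using dualD(3)[OF X, of "canonical (dual C) f" c] f canI by (simp add: F_def can.smult)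
      show "F (f \<oplus>\<^bsub>dual C\<^esub> g) = F f + F g" if "g \<in> carrier (dual C)"
        using dualD(2)[OF X, of "canonical (dual C) f" "canonical (dual C) g"] f that canI
        by (simp add: F_def can.add)
    qed (simp add: F_def)
    have "X = (\<lambda>p\<in>?P. p F)"
      by (rule dual_eqI[OF X restr[OF F]]) (use F in \<open>auto simp: P_def can_apply\<close>, simp add: F_def)
    then show "\<exists>F\<in>carrier (dual (dual C)). X = (\<lambda>p\<in>?P. p F)" using F by blast
  qed (rule restr)
  moreover have "nrm (dual ?E) (\<lambda>p\<in>?P. p F) = nrm (dual (dual C)) F" if F: "F \<in> carrier (dual (dual C))" for F
  proof -
    have "{p \<in> ?P. nrm (dual (dual (dual C))) p \<le> 1} =
        canonical (dual C) ` {f \<in> carrier (dual C). nrm (dual C) f \<le> 1}"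
      using nrm_canonical_dual by (auto simp: P_def)
    moreover have "nrm (dual ?E) (\<lambda>p\<in>?P. p F) =
        (SUP p\<in>{p \<in> ?P. nrm (dual (dual (dual C))) p \<le> 1}. cmod (p F))"
      unfolding dual_def[of ?E] by (auto intro!: SUP_cong)
    ultimately show ?thesis
      using F by (simp add: image_image can_apply dual_def[of "dual C"])
  qed
  moreover have "submodule ?P complex_ring (dual (second_dual C))"
    unfolding P_def second_dual_simps by (rule can.submodule_image)
  ultimately show ?thesis
    unfolding is_predual_def second_dual_simps(1,5,6) using actions closed by blast
qed

section \<open>Weak* continuous homomorphisms and Connes amenability\<close>

lemma connes_amenable_overD:
  fixes Y :: "'u normed"
  assumes "connes_amenable_over TYPE('u) D P" "banach_bimodule D Y l r" "normal_dual D P Y l r"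
    "derivation D Y l r \<delta>" "continuous_map (weak_star_alg D P) (weak_star Y) \<delta>"
  shows "inner_derivation D Y l r \<delta>"
  using assms unfolding connes_amenable_over_def by blast

lemma (in bounded_algebra) connes_amenable_second_dual_over:
  assumes "connes_amenable (second_dual C) P"
  shows "connes_amenable_over TYPE('u) (second_dual C) P"
proof (rule connes_amenable_imp_over)
  show "connes_amenable_over TYPE((('c \<Rightarrow> complex) \<Rightarrow> complex) sequence_code) (second_dual C) P"
    using assms by (simp add: connes_amenable_def)
qed (simp add: arens_first_closed)

lemma continuous_map_apply_functional:
  assumes f: "f \<in> carrier (dual C)"
  shows "continuous_map (weak_star_alg (second_dual C) (second_dual_predual C)) euclidean (\<lambda>F. F f)"
proof -
  let ?P = "second_dual_predual C"
  have f': "canonical (dual C) f \<in> ?P" using f by (simp add: second_dual_predual_def)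
  have "continuous_map (product_topology (\<lambda>_. euclidean) ?P) euclidean (\<lambda>g :: _ \<Rightarrow> complex. g (canonical (dual C) f))"
    by (rule continuous_map_product_projection[OF f'])
  then have "continuous_map (weak_star_alg (second_dual C) ?P) euclidean
      ((\<lambda>g. g (canonical (dual C) f)) \<circ> (\<lambda>F. \<lambda>\<phi>\<in>?P. \<phi> F))"
    unfolding weak_star_alg_def by (rule continuous_map_pullback)
  then show ?thesis
    by (rule continuous_map_eq) (use f' in \<open>simp add: canonical_def\<close>)
qed

lemma continuous_map_into_second_dual:
  assumes "\<And>t. t \<in> topspace T \<Longrightarrow> h t \<in> carrier (dual (dual C))"
    and "\<And>f. f \<in> carrier (dual C) \<Longrightarrow> continuous_map T euclidean (\<lambda>t. h t f)"
  shows "continuous_map T (weak_star_alg (second_dual C) (second_dual_predual C)) h"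
  unfolding weak_star_alg_def
proof (rule continuous_map_pullback')
  show "topspace T \<subseteq> h -` carrier (second_dual C)" using assms(1) by auto
  have "continuous_map T euclidean (\<lambda>t. p (h t))" if p: "p \<in> second_dual_predual C" for p
  proof -
    obtain f where f: "f \<in> carrier (dual C)" "p = canonical (dual C) f"
      using p by (auto simp: second_dual_predual_def)
    show ?thesis by (rule continuous_map_eq[OF assms(2)[OF f(1)]]) (use f assms(1) in \<open>simp add: canonical_def\<close>)
  qed
  then show "continuous_map T (product_topology (\<lambda>_. euclidean) (second_dual_predual C))
      ((\<lambda>F. \<lambda>\<phi>\<in>second_dual_predual C. \<phi> F) \<circ> h)"
    by (auto simp: continuous_map_componentwise)
qed

lemma (in bounded_map) continuous_map_second_adjoint:
  "continuous_map (weak_star_alg (second_dual V) (second_dual_predual V))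
     (weak_star_alg (second_dual W) (second_dual_predual W)) (second_adjoint V W T)"
  by (rule continuous_map_into_second_dual)
    (simp_all add: second_adjoint_closed second_adjoint_apply continuous_map_apply_functional adjoint_closed)

text \<open>
  Both Arens products see a functional \<open>f\<close> on \<open>C'\<close> through its values on products only, and on \<open>T ` carrier C\<close>
  these are the values of \<open>adjoint C T f\<close> on products of \<open>C\<close>.
\<close>

lemma second_adjoint_arens:
  assumes T: "bounded_map C C' T" and C: "bounded_algebra C" "bounded_algebra C'"
    and hom: "\<And>a b. a \<in> carrier C \<Longrightarrow> b \<in> carrier C \<Longrightarrow> T (a \<otimes>\<^bsub>C\<^esub> b) = T a \<otimes>\<^bsub>C'\<^esub> T b"
    and F: "F \<in> carrier (dual (dual C))" and G: "G \<in> carrier (dual (dual C))"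
  shows "second_adjoint C C' T (arens_first C F G) =
      arens_first C' (second_adjoint C C' T F) (second_adjoint C C' T G)"
    and "second_adjoint C C' T (arens_second C F G) =
      arens_second C' (second_adjoint C C' T F) (second_adjoint C C' T G)"
proof -
  interpret T: bounded_map C C' T by (rule T)
  interpret C: bounded_algebra C by (rule C)
  interpret C': bounded_algebra C' by (rule C)
  let ?T = "second_adjoint C C' T"
  note TF = T.second_adjoint_closed[OF F] and TG = T.second_adjoint_closed[OF G]
  have "arens_first C F G (adjoint C T f) = arens_first C' (?T F) (?T G) f"
    and "arens_second C F G (adjoint C T f) = arens_second C' (?T F) (?T G) f"
    if f: "f \<in> carrier (dual C')" for f
  proof -
    note form = C'.bounded_form_functional[OF f]
    note sl = bounded_form.slice[OF form] bounded_form.slice[OF bounded_form.flip[OF form]]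
    have "?T G (\<lambda>d\<in>carrier C'. f (T a \<otimes>\<^bsub>C'\<^esub> d)) = G (\<lambda>b\<in>carrier C. adjoint C T f (a \<otimes>\<^bsub>C\<^esub> b))"
      if a: "a \<in> carrier C" for a
    proof -
      have "adjoint C T (\<lambda>d\<in>carrier C'. f (T a \<otimes>\<^bsub>C'\<^esub> d)) = (\<lambda>b\<in>carrier C. adjoint C T f (a \<otimes>\<^bsub>C\<^esub> b))"
        unfolding adjoint_def using a by (intro restrict_ext) (simp add: T.closed C.mult_closed hom)
      then show ?thesis by (simp only: second_adjoint_apply[OF sl(1)[OF T.closed[OF a]]])
    qed
    then have "adjoint C T (\<lambda>c\<in>carrier C'. ?T G (\<lambda>d\<in>carrier C'. f (c \<otimes>\<^bsub>C'\<^esub> d))) =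
        (\<lambda>a\<in>carrier C. G (\<lambda>b\<in>carrier C. adjoint C T f (a \<otimes>\<^bsub>C\<^esub> b)))"
      unfolding adjoint_def[of C T "restrict _ _"] by (intro restrict_ext) (simp add: T.closed)
    then show "arens_first C F G (adjoint C T f) = arens_first C' (?T F) (?T G) f"
      using second_adjoint_apply[OF C'.arens_slice_right[OF TG f], of C T F] f T.adjoint_closed[OF f]
      by (simp add: arens_first_def)
    have "?T F (\<lambda>d\<in>carrier C'. f (d \<otimes>\<^bsub>C'\<^esub> T b)) = F (\<lambda>a\<in>carrier C. adjoint C T f (a \<otimes>\<^bsub>C\<^esub> b))"
      if b: "b \<in> carrier C" for b
    proof -
      have "adjoint C T (\<lambda>d\<in>carrier C'. f (d \<otimes>\<^bsub>C'\<^esub> T b)) = (\<lambda>a\<in>carrier C. adjoint C T f (a \<otimes>\<^bsub>C\<^esub> b))"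
        unfolding adjoint_def using b by (intro restrict_ext) (simp add: T.closed C.mult_closed hom)
      then show ?thesis by (simp only: second_adjoint_apply[OF sl(2)[OF T.closed[OF b]]])
    qed
    then have "adjoint C T (\<lambda>c\<in>carrier C'. ?T F (\<lambda>d\<in>carrier C'. f (d \<otimes>\<^bsub>C'\<^esub> c))) =
        (\<lambda>b\<in>carrier C. F (\<lambda>a\<in>carrier C. adjoint C T f (a \<otimes>\<^bsub>C\<^esub> b)))"
      unfolding adjoint_def[of C T "restrict _ _"] by (intro restrict_ext) (simp add: T.closed)
    then show "arens_second C F G (adjoint C T f) = arens_second C' (?T F) (?T G) f"
      using second_adjoint_apply[OF C'.arens_slice_left[OF TF f], of C T G] f T.adjoint_closed[OF f]
      by (simp add: arens_second_def)
  qed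
  then show "?T (arens_first C F G) = arens_first C' (?T F) (?T G)"
    "?T (arens_second C F G) = arens_second C' (?T F) (?T G)"
    unfolding second_adjoint_def adjoint_def[of "dual C'"] arens_first_def[of C'] arens_second_def[of C']
    by (auto intro!: restrict_ext)
qed

text \<open>
  The preduals \<open>P\<close> and \<open>Q\<close> enter through the weak* topologies that they induce.
\<close>

locale dual_homomorphism =
  fixes D :: "'d normed" and P :: "('d \<Rightarrow> complex) set"
    and E :: "'e normed" and Q :: "('e \<Rightarrow> complex) set" and h :: "'d \<Rightarrow> 'e"
  assumes h_closed: "a \<in> carrier D \<Longrightarrow> h a \<in> carrier E"
    and h_add: "a \<in> carrier D \<Longrightarrow> b \<in> carrier D \<Longrightarrow> h (a \<oplus>\<^bsub>D\<^esub> b) = h a \<oplus>\<^bsub>E\<^esub> h b"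
    and h_smult: "a \<in> carrier D \<Longrightarrow> h (k \<odot>\<^bsub>D\<^esub> a) = k \<odot>\<^bsub>E\<^esub> h a"
    and h_mult: "a \<in> carrier D \<Longrightarrow> b \<in> carrier D \<Longrightarrow> h (a \<otimes>\<^bsub>D\<^esub> b) = h a \<otimes>\<^bsub>E\<^esub> h b"
    and h_bounded: "\<exists>K. \<forall>a\<in>carrier D. nrm E (h a) \<le> K * nrm D a"
    and h_continuous: "continuous_map (weak_star_alg D P) (weak_star_alg E Q) h"
    and nrm_nonneg: "x \<in> carrier E \<Longrightarrow> 0 \<le> nrm E x"
begin

lemma pullback_bimodule:
  assumes "banach_bimodule E Y l r"
  shows "banach_bimodule D Y (\<lambda>a. l (h a)) (\<lambda>y a. r y (h a))"
proof -
  interpret Y: banach_bimodule E Y l r by (rule assms)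
  obtain K where K: "\<And>a y. a \<in> carrier E \<Longrightarrow> y \<in> carrier Y \<Longrightarrow>
      nrm Y (l a y) \<le> K * nrm E a * nrm Y y \<and> nrm Y (r y a) \<le> K * nrm E a * nrm Y y"
    using Y.bounded_actions by blast
  obtain L where L: "\<And>a. a \<in> carrier D \<Longrightarrow> nrm E (h a) \<le> L * nrm D a" using h_bounded by blast
  have "K * nrm E (h a) * nrm Y y \<le> (\<bar>K\<bar> * L) * nrm D a * nrm Y y"
    if a: "a \<in> carrier D" and y: "y \<in> carrier Y" for a y
  proof -
    have "K * nrm E (h a) \<le> \<bar>K\<bar> * nrm E (h a)"
      using nrm_nonneg[OF h_closed[OF a]] by (intro mult_right_mono) auto
    also have "\<dots> \<le> \<bar>K\<bar> * (L * nrm D a)" using L[OF a] by (intro mult_left_mono) auto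
    finally have le: "K * nrm E (h a) \<le> \<bar>K\<bar> * (L * nrm D a)" .
    show ?thesis using mult_right_mono[OF le Y.nrm_nonneg[OF y]] by (simp only: mult.assoc)
  qed
  then have "nrm Y (l (h a) y) \<le> (\<bar>K\<bar> * L) * nrm D a * nrm Y y \<and>
      nrm Y (r y (h a)) \<le> (\<bar>K\<bar> * L) * nrm D a * nrm Y y" if "a \<in> carrier D" "y \<in> carrier Y" for a y
    using K[OF h_closed[OF that(1)] that(2)] that by (blast intro: order_trans)
  then show ?thesis
    by (intro banach_bimodule.intro banach_bimodule_axioms.intro Y.banach_space_axioms exI[of _ "\<bar>K\<bar> * L"])
      (simp_all add: h_closed h_add h_smult h_mult Y.l_closed Y.r_closed Y.l_add Y.r_add Y.l_smult
        Y.r_smult Y.l_add_alg Y.r_add_alg Y.l_smult_alg Y.r_smult_alg Y.l_mult Y.r_mult Y.l_r)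
qed

lemma pullback_normal:
  assumes "normal_dual E Q Y l r"
  shows "normal_dual D P Y (\<lambda>a. l (h a)) (\<lambda>y a. r y (h a))"
  unfolding normal_dual_def
proof (intro ballI)
  fix x assume x: "x \<in> carrier (dual Y)"
  have "continuous_map (weak_star_alg D P) (weak_star Y) ((\<lambda>a. dual_l Y r a x) \<circ> h)"
    "continuous_map (weak_star_alg D P) (weak_star Y) ((\<lambda>a. dual_r Y l x a) \<circ> h)"
    using assms x by (auto simp: normal_dual_def intro: continuous_map_compose[OF h_continuous])
  then show "continuous_map (weak_star_alg D P) (weak_star Y) (\<lambda>a. dual_l Y (\<lambda>y a. r y (h a)) a x) \<and>
      continuous_map (weak_star_alg D P) (weak_star Y) (dual_r Y (\<lambda>a. l (h a)) x)"
    by (simp add: comp_def dual_l_def dual_r_def[abs_def])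
qed

text \<open>
  A derivation on \<open>E\<close>, composed with \<open>h\<close>, is a derivation on \<open>D\<close> into the pulled back module. A functional that
  implements it on \<open>D\<close> implements the given derivation on the range of \<open>h\<close>, which is all of \<open>E\<close>.
\<close>

theorem connes_amenable_over_image:
  assumes D: "connes_amenable_over TYPE('u) D P" and surj: "h ` carrier D = carrier E"
  shows "connes_amenable_over TYPE('u) E Q"
  unfolding connes_amenable_over_def
proof (intro allI impI, elim conjE)
  fix Y :: "'u normed" and l r \<delta>
  assume Y: "banach_bimodule E Y l r" "normal_dual E Q Y l r"
    and \<delta>: "derivation E Y l r \<delta>" and c: "continuous_map (weak_star_alg E Q) (weak_star Y) \<delta>"
  let ?l = "\<lambda>a. l (h a)" and ?r = "\<lambda>y a. r y (h a)" and ?\<delta> = "\<lambda>a. \<delta> (h a)"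
  have "derivation D Y ?l ?r ?\<delta>"
    using \<delta> by (simp add: derivation_def h_closed h_add h_smult h_mult dual_l_def dual_r_def)
  moreover have "continuous_map (weak_star_alg D P) (weak_star Y) ?\<delta>"
    using continuous_map_compose[OF h_continuous c] by (simp add: comp_def)
  ultimately have "inner_derivation D Y ?l ?r ?\<delta>"
    using D pullback_bimodule[OF Y(1)] pullback_normal[OF Y(2)] unfolding connes_amenable_over_def by blast
  then obtain x where x: "x \<in> carrier (dual Y)"
    and "\<And>a. a \<in> carrier D \<Longrightarrow> \<delta> (h a) = dual_l Y r (h a) x \<ominus>\<^bsub>dual Y\<^esub> dual_r Y l x (h a)"
    unfolding inner_derivation_def dual_l_def dual_r_def by blast
  then have "\<forall>b\<in>h ` carrier D. \<delta> b = dual_l Y r b x \<ominus>\<^bsub>dual Y\<^esub> dual_r Y l x b" by blast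
  then show "inner_derivation E Y l r \<delta>" unfolding inner_derivation_def surj using x by blast
qed

end

lemma dual_homomorphism_second_adjoint:
  assumes T: "bounded_map C C' T" and C: "bounded_algebra C" "bounded_algebra C'"
    and hom: "\<And>a b. a \<in> carrier C \<Longrightarrow> b \<in> carrier C \<Longrightarrow> T (a \<otimes>\<^bsub>C\<^esub> b) = T a \<otimes>\<^bsub>C'\<^esub> T b"
  shows "dual_homomorphism (second_dual C) (second_dual_predual C)
    (second_dual C') (second_dual_predual C') (second_adjoint C C' T)"
proof -
  interpret T: bounded_map C C' T by (rule T)
  interpret T'': bounded_map "dual (dual C)" "dual (dual C')" "second_adjoint C C' T"
    by (rule T.bounded_map_second_adjoint)
  show ?thesis
  proof (rule dual_homomorphism.intro)
    fix F G assume "F \<in> carrier (second_dual C)" "G \<in> carrier (second_dual C)"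
    then have FG: "F \<in> carrier (dual (dual C))" "G \<in> carrier (dual (dual C))" by simp_all
    show "second_adjoint C C' T (F \<otimes>\<^bsub>second_dual C\<^esub> G) =
        second_adjoint C C' T F \<otimes>\<^bsub>second_dual C'\<^esub> second_adjoint C C' T G"
      unfolding second_dual_simps by (rule second_adjoint_arens(1)[OF T C _ FG]) (rule hom)
    show "second_adjoint C C' T (F \<oplus>\<^bsub>second_dual C\<^esub> G) =
        second_adjoint C C' T F \<oplus>\<^bsub>second_dual C'\<^esub> second_adjoint C C' T G"
      unfolding second_dual_simps by (rule T''.add[OF FG])
  next
    show "continuous_map (weak_star_alg (second_dual C) (second_dual_predual C))
        (weak_star_alg (second_dual C') (second_dual_predual C')) (second_adjoint C C' T)"
      by (rule T.continuous_map_second_adjoint)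
    show "\<exists>K. \<forall>F\<in>carrier (second_dual C). nrm (second_dual C') (second_adjoint C C' T F) \<le> K * nrm (second_dual C) F"
      unfolding second_dual_simps by (rule T''.bounded)
  qed (unfold second_dual_simps, (rule T''.closed T''.smult T''.W.nrm_nonneg, assumption)+)
qed

section \<open>Reflexive bimodules\<close>

lemma (in banach_bimodule) dual_actions_closed:
  assumes a: "a \<in> carrier A" and x: "x \<in> carrier (dual Y)"
  shows "dual_l Y r a x \<in> carrier (dual Y)" "dual_r Y l x a \<in> carrier (dual Y)"
proof -
  obtain K where K: "\<And>a y. a \<in> carrier A \<Longrightarrow> y \<in> carrier Y \<Longrightarrow>
      nrm Y (l a y) \<le> K * nrm A a * nrm Y y \<and> nrm Y (r y a) \<le> K * nrm A a * nrm Y y"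
    using bounded_actions by blast
  have "bounded_map Y Y (l a)" "bounded_map Y Y (\<lambda>y. r y a)"
    using K a by (unfold_locales, auto simp: l_closed r_closed l_add r_add l_smult r_smult)
  then show "dual_l Y r a x \<in> carrier (dual Y)" "dual_r Y l x a \<in> carrier (dual Y)"
    using bounded_map.adjoint_closed[OF _ x] by (auto simp: dual_l_def dual_r_def adjoint_def)
qed

locale algebra_bimodule = banach_bimodule A M l r + A: bounded_algebra A
  for A :: "'a normed" and M :: "'m normed" and l r
begin

lemma functional_of_actions_bound:
  obtains K where "K \<ge> 0"
    "\<And>\<phi> a m. \<phi> \<in> carrier (dual M) \<Longrightarrow> a \<in> carrier A \<Longrightarrow> m \<in> carrier M \<Longrightarrow>
      cmod (\<phi> (l a m)) \<le> nrm (dual M) \<phi> * K * nrm A a * nrm M m"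
    "\<And>\<phi> a m. \<phi> \<in> carrier (dual M) \<Longrightarrow> a \<in> carrier A \<Longrightarrow> m \<in> carrier M \<Longrightarrow>
      cmod (\<phi> (r m a)) \<le> nrm (dual M) \<phi> * K * nrm A a * nrm M m"
proof -
  obtain K where K: "\<And>a m. a \<in> carrier A \<Longrightarrow> m \<in> carrier M \<Longrightarrow>
      nrm M (l a m) \<le> K * nrm A a * nrm M m \<and> nrm M (r m a) \<le> K * nrm A a * nrm M m"
    using bounded_actions by blast
  have "cmod (\<phi> y) \<le> nrm (dual M) \<phi> * \<bar>K\<bar> * nrm A a * nrm M m"
    if \<phi>: "\<phi> \<in> carrier (dual M)" and a: "a \<in> carrier A" and m: "m \<in> carrier M"
      and y: "y \<in> carrier M" "nrm M y \<le> K * nrm A a * nrm M m" for \<phi> a m y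
  proof -
    have "K * (nrm A a * nrm M m) \<le> \<bar>K\<bar> * (nrm A a * nrm M m)"
      using a m nrm_nonneg A.nrm_nonneg by (intro mult_right_mono) auto
    with y have "nrm M y \<le> \<bar>K\<bar> * nrm A a * nrm M m" by (simp add: mult.assoc)
    from mult_left_mono[OF this dual_nrm_nonneg[OF \<phi>]] show ?thesis
      using norm_functional_le[OF \<phi> y(1)] by (simp add: mult.assoc)
  qed
  then show ?thesis using that[of "\<bar>K\<bar>"] K l_closed r_closed by simp
qed

lemma bounded_form_left:
  assumes \<phi>: "\<phi> \<in> carrier (dual M)"
  shows "bounded_form M A (\<lambda>m a. \<phi> (l a m))"
proof (intro bounded_form.intro bounded_form_axioms.intro normed_space_axioms A.normed_space_axioms)
  obtain K where "\<And>a m. a \<in> carrier A \<Longrightarrow> m \<in> carrier M \<Longrightarrow>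
      cmod (\<phi> (l a m)) \<le> nrm (dual M) \<phi> * K * nrm A a * nrm M m"
    using functional_of_actions_bound \<phi> by metis
  then show "\<exists>K. \<forall>m\<in>carrier M. \<forall>a\<in>carrier A. cmod (\<phi> (l a m)) \<le> K * nrm M m * nrm A a"
    by (intro exI[of _ "nrm (dual M) \<phi> * K"]) (simp add: ac_simps)
qed (simp_all add: l_closed l_add l_add_alg l_smult l_smult_alg dualD(2,3)[OF \<phi>])

lemma bounded_form_right:
  assumes \<phi>: "\<phi> \<in> carrier (dual M)"
  shows "bounded_form M A (\<lambda>m a. \<phi> (r m a))"
proof (intro bounded_form.intro bounded_form_axioms.intro normed_space_axioms A.normed_space_axioms)
  obtain K where "\<And>a m. a \<in> carrier A \<Longrightarrow> m \<in> carrier M \<Longrightarrow>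
      cmod (\<phi> (r m a)) \<le> nrm (dual M) \<phi> * K * nrm A a * nrm M m"
    using functional_of_actions_bound \<phi> by metis
  then show "\<exists>K. \<forall>m\<in>carrier M. \<forall>a\<in>carrier A. cmod (\<phi> (r m a)) \<le> K * nrm M m * nrm A a"
    by (intro exI[of _ "nrm (dual M) \<phi> * K"]) (simp add: ac_simps)
qed (simp_all add: r_closed r_add r_add_alg r_smult r_smult_alg dualD(2,3)[OF \<phi>])

lemmas slice_left = bounded_form.slice[OF bounded_form_left]
  and slice_right = bounded_form.slice[OF bounded_form_right]
  and slice_left' = bounded_form.slice[OF bounded_form.flip[OF bounded_form_left]]
  and slice_right' = bounded_form.slice[OF bounded_form.flip[OF bounded_form_right]]

text \<open>
  The dual actions of \<open>A\<close> on \<open>M\<^sup>*\<close>, extended to \<open>A\<^sup>*\<^sup>*\<close>: at the canonical image of \<open>a\<close> they are \<open>dual_l M r a \<phi>\<close>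
  and \<open>dual_r M l \<phi> a\<close>.
\<close>

definition bidual_l :: "(('a \<Rightarrow> complex) \<Rightarrow> complex) \<Rightarrow> ('m \<Rightarrow> complex) \<Rightarrow> 'm \<Rightarrow> complex" where
  "bidual_l F \<phi> = (\<lambda>m\<in>carrier M. F (\<lambda>a\<in>carrier A. \<phi> (r m a)))"

definition bidual_r :: "('m \<Rightarrow> complex) \<Rightarrow> (('a \<Rightarrow> complex) \<Rightarrow> complex) \<Rightarrow> 'm \<Rightarrow> complex" where
  "bidual_r \<phi> F = (\<lambda>m\<in>carrier M. F (\<lambda>a\<in>carrier A. \<phi> (l a m)))"

lemma bidual_l_closed:
  "F \<in> carrier (dual (dual A)) \<Longrightarrow> \<phi> \<in> carrier (dual M) \<Longrightarrow> bidual_l F \<phi> \<in> carrier (dual M)"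
  unfolding bidual_l_def by (rule bounded_form.apply_bidual[OF bounded_form_right])

lemma bidual_r_closed:
  "F \<in> carrier (dual (dual A)) \<Longrightarrow> \<phi> \<in> carrier (dual M) \<Longrightarrow> bidual_r \<phi> F \<in> carrier (dual M)"
  unfolding bidual_r_def by (rule bounded_form.apply_bidual[OF bounded_form_left])

lemma bounded_form_bidual:
  assumes m: "m \<in> carrier M"
  shows "bounded_form (dual M) A (\<lambda>\<phi> a. \<phi> (l a m))"
proof (intro bounded_form.intro bounded_form_axioms.intro normed_space_dual A.normed_space_axioms)
  obtain K where "\<And>\<phi> a. \<phi> \<in> carrier (dual M) \<Longrightarrow> a \<in> carrier A \<Longrightarrow>
      cmod (\<phi> (l a m)) \<le> nrm (dual M) \<phi> * K * nrm A a * nrm M m"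
    using functional_of_actions_bound m by metis
  then show "\<exists>K. \<forall>\<phi>\<in>carrier (dual M). \<forall>a\<in>carrier A. cmod (\<phi> (l a m)) \<le> K * nrm (dual M) \<phi> * nrm A a"
    by (intro exI[of _ "K * nrm M m"]) (simp add: ac_simps)
qed (use m in \<open>simp_all add: dual_simps l_closed l_add_alg l_smult_alg dualD(2,3)\<close>)

end

locale reflexive_bimodule = algebra_bimodule A M l r
  for A :: "'a normed" and M :: "'m normed" and l r +
  assumes refl: "reflexive M"
begin

lemma bidual_representative:
  assumes "x \<in> carrier (dual (dual M))"
  obtains m where "m \<in> carrier M" "\<And>\<phi>. \<phi> \<in> carrier (dual M) \<Longrightarrow> x \<phi> = \<phi> m"
proof -
  have "x \<in> canonical M ` carrier M" using assms refl by (simp add: reflexive_def)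
  then obtain m where "m \<in> carrier M" "x = canonical M m" by blast
  then show ?thesis using that[of m] by (simp add: canonical_def)
qed

text \<open>
  The functional \<open>\<phi> \<mapsto> G (b \<mapsto> \<phi> (b \<cdot> m))\<close> on \<open>M\<^sup>*\<close> is evaluation at a point of \<open>M\<close>, which may be called \<open>G \<cdot> m\<close>.
  Replacing \<open>G\<close> by this point lets \<open>G\<close> be exchanged with any other functional.
\<close>

lemma left_action_representative:
  assumes G: "G \<in> carrier (dual (dual A))" and m: "m \<in> carrier M"
  obtains n where "n \<in> carrier M"
    "\<And>\<phi>. \<phi> \<in> carrier (dual M) \<Longrightarrow> G (\<lambda>b\<in>carrier A. \<phi> (l b m)) = \<phi> n"
proof -
  obtain n where "n \<in> carrier M"
    "\<And>\<phi>. \<phi> \<in> carrier (dual M) \<Longrightarrow> (\<lambda>\<phi>\<in>carrier (dual M). G (\<lambda>b\<in>carrier A. \<phi> (l b m))) \<phi> = \<phi> n"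
    using bidual_representative[OF bounded_form.apply_bidual[OF bounded_form_bidual[OF m] G]] by blast
  then show ?thesis using that by simp
qed

text \<open>
  The law \<open>(F G) \<cdot> \<phi> = F \<cdot> (G \<cdot> \<phi>)\<close> is the form of the first Arens product. The laws
  \<open>\<phi> \<cdot> (F G) = (\<phi> \<cdot> F) \<cdot> G\<close> and \<open>F \<cdot> (\<phi> \<cdot> G) = (F \<cdot> \<phi>) \<cdot> G\<close> apply \<open>F\<close> and \<open>G\<close> in different orders on their two
  sides; here the exchange by means of the point \<open>n = G \<cdot> m\<close> is used.
\<close>

lemma banach_bimodule_dual:
  "banach_bimodule (second_dual A) (dual M) bidual_l bidual_r"
proof (intro banach_bimodule.intro banach_bimodule_axioms.intro banach_space_dual; (unfold second_dual_simps)?)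
  fix F \<phi> assume F: "F \<in> carrier (dual (dual A))" and \<phi>: "\<phi> \<in> carrier (dual M)"
  show "bidual_l F \<phi> \<in> carrier (dual M)" "bidual_r \<phi> F \<in> carrier (dual M)"
    using bidual_l_closed bidual_r_closed F \<phi> by auto
  fix k
  show "bidual_l (k \<odot>\<^bsub>dual (dual A)\<^esub> F) \<phi> = k \<odot>\<^bsub>dual M\<^esub> bidual_l F \<phi>"
    "bidual_r \<phi> (k \<odot>\<^bsub>dual (dual A)\<^esub> F) = k \<odot>\<^bsub>dual M\<^esub> bidual_r \<phi> F"
    using slice_right[OF \<phi>] slice_left[OF \<phi>] unfolding bidual_l_def bidual_r_def dual_simps
    by (auto intro!: restrict_ext)
  have "(\<lambda>a\<in>carrier A. (k \<odot>\<^bsub>dual M\<^esub> \<phi>) (r m a)) = k \<odot>\<^bsub>dual A\<^esub> (\<lambda>a\<in>carrier A. \<phi> (r m a))"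
    "(\<lambda>a\<in>carrier A. (k \<odot>\<^bsub>dual M\<^esub> \<phi>) (l a m)) = k \<odot>\<^bsub>dual A\<^esub> (\<lambda>a\<in>carrier A. \<phi> (l a m))"
    if "m \<in> carrier M" for m using that by (auto simp: dual_simps l_closed r_closed)
  then show "bidual_l F (k \<odot>\<^bsub>dual M\<^esub> \<phi>) = k \<odot>\<^bsub>dual M\<^esub> bidual_l F \<phi>"
    "bidual_r (k \<odot>\<^bsub>dual M\<^esub> \<phi>) F = k \<odot>\<^bsub>dual M\<^esub> bidual_r \<phi> F"
    unfolding bidual_l_def bidual_r_def dual_simps(2)[where V = M and f = "restrict _ _"]
    using dualD(3)[OF F slice_right[OF \<phi>]] dualD(3)[OF F slice_left[OF \<phi>]]
    by (auto intro!: restrict_ext)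
next
  fix F \<phi> \<psi> assume F: "F \<in> carrier (dual (dual A))" and \<phi>: "\<phi> \<in> carrier (dual M)" and \<psi>: "\<psi> \<in> carrier (dual M)"
  have "(\<lambda>a\<in>carrier A. (\<phi> \<oplus>\<^bsub>dual M\<^esub> \<psi>) (r m a)) =
      (\<lambda>a\<in>carrier A. \<phi> (r m a)) \<oplus>\<^bsub>dual A\<^esub> (\<lambda>a\<in>carrier A. \<psi> (r m a))"
    "(\<lambda>a\<in>carrier A. (\<phi> \<oplus>\<^bsub>dual M\<^esub> \<psi>) (l a m)) =
      (\<lambda>a\<in>carrier A. \<phi> (l a m)) \<oplus>\<^bsub>dual A\<^esub> (\<lambda>a\<in>carrier A. \<psi> (l a m))"
    if "m \<in> carrier M" for m using that by (auto simp: dual_simps l_closed r_closed)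
  then show "bidual_l F (\<phi> \<oplus>\<^bsub>dual M\<^esub> \<psi>) = bidual_l F \<phi> \<oplus>\<^bsub>dual M\<^esub> bidual_l F \<psi>"
    "bidual_r (\<phi> \<oplus>\<^bsub>dual M\<^esub> \<psi>) F = bidual_r \<phi> F \<oplus>\<^bsub>dual M\<^esub> bidual_r \<psi> F"
    unfolding bidual_l_def bidual_r_def dual_simps(1)[where V = M and f = "restrict _ _"]
    using dualD(2)[OF F slice_right[OF \<phi>] slice_right[OF \<psi>]] dualD(2)[OF F slice_left[OF \<phi>] slice_left[OF \<psi>]]
    by (auto intro!: restrict_ext)
next
  fix F G \<phi>
  assume F: "F \<in> carrier (dual (dual A))" and G: "G \<in> carrier (dual (dual A))" and \<phi>: "\<phi> \<in> carrier (dual M)"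
  show "bidual_l (F \<oplus>\<^bsub>dual (dual A)\<^esub> G) \<phi> = bidual_l F \<phi> \<oplus>\<^bsub>dual M\<^esub> bidual_l G \<phi>"
    "bidual_r \<phi> (F \<oplus>\<^bsub>dual (dual A)\<^esub> G) = bidual_r \<phi> F \<oplus>\<^bsub>dual M\<^esub> bidual_r \<phi> G"
    using slice_right[OF \<phi>] slice_left[OF \<phi>] unfolding bidual_l_def bidual_r_def dual_simps
    by (auto intro!: restrict_ext)
  show "bidual_l (arens_first A F G) \<phi> = bidual_l F (bidual_l G \<phi>)"
    unfolding bidual_l_def[of "arens_first A F G"] bidual_l_def[of F]
  proof (intro restrict_ext)
    fix m assume m: "m \<in> carrier M"
    have "(\<lambda>b\<in>carrier A. (\<lambda>c\<in>carrier A. \<phi> (r m c)) (a \<otimes>\<^bsub>A\<^esub> b)) = (\<lambda>b\<in>carrier A. \<phi> (r (r m a) b))"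
      if "a \<in> carrier A" for a using that m by (auto simp: A.mult_closed r_mult)
    then have "(\<lambda>a\<in>carrier A. G (\<lambda>b\<in>carrier A. (\<lambda>c\<in>carrier A. \<phi> (r m c)) (a \<otimes>\<^bsub>A\<^esub> b))) =
        (\<lambda>a\<in>carrier A. bidual_l G \<phi> (r m a))"
      using m by (auto simp: bidual_l_def r_closed)
    then show "arens_first A F G (\<lambda>a\<in>carrier A. \<phi> (r m a)) = F (\<lambda>a\<in>carrier A. bidual_l G \<phi> (r m a))"
      using slice_right[OF \<phi> m] unfolding arens_first_def by simp
  qed
  show "bidual_r \<phi> (arens_first A F G) = bidual_r (bidual_r \<phi> F) G"
    unfolding bidual_r_def[of \<phi> "arens_first A F G"] bidual_r_def[of "bidual_r \<phi> F"]
  proof (intro restrict_ext)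
    fix m assume m: "m \<in> carrier M"
    obtain n where n: "n \<in> carrier M"
      "\<And>\<psi>. \<psi> \<in> carrier (dual M) \<Longrightarrow> G (\<lambda>b\<in>carrier A. \<psi> (l b m)) = \<psi> n"
      using left_action_representative[OF G m] by metis
    have "G (\<lambda>b\<in>carrier A. (\<lambda>c\<in>carrier A. \<phi> (l c m)) (a \<otimes>\<^bsub>A\<^esub> b)) = \<phi> (l a n)" if a: "a \<in> carrier A" for a
    proof -
      have "(\<lambda>b\<in>carrier A. (\<lambda>c\<in>carrier A. \<phi> (l c m)) (a \<otimes>\<^bsub>A\<^esub> b)) =
          (\<lambda>b\<in>carrier A. (\<lambda>y\<in>carrier M. \<phi> (l a y)) (l b m))"
        using a m by (auto simp: A.mult_closed l_mult l_closed)
      then show ?thesis using n(2)[OF slice_left'[OF \<phi> a]] n(1) by simp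
    qed
    then have "(\<lambda>a\<in>carrier A. G (\<lambda>b\<in>carrier A. (\<lambda>c\<in>carrier A. \<phi> (l c m)) (a \<otimes>\<^bsub>A\<^esub> b))) =
        (\<lambda>a\<in>carrier A. \<phi> (l a n))" by (intro restrict_ext)
    then have "arens_first A F G (\<lambda>a\<in>carrier A. \<phi> (l a m)) = F (\<lambda>a\<in>carrier A. \<phi> (l a n))"
      using slice_left[OF \<phi> m] unfolding arens_first_def by simp
    also have "\<dots> = bidual_r \<phi> F n" using n(1) by (simp add: bidual_r_def)
    also have "\<dots> = G (\<lambda>b\<in>carrier A. bidual_r \<phi> F (l b m))" using n(2)[OF bidual_r_closed[OF F \<phi>]] ..
    finally show "arens_first A F G (\<lambda>a\<in>carrier A. \<phi> (l a m)) = G (\<lambda>b\<in>carrier A. bidual_r \<phi> F (l b m))" .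
  qed
  show "bidual_l F (bidual_r \<phi> G) = bidual_r (bidual_l F \<phi>) G"
    unfolding bidual_r_def[of "bidual_l F \<phi>"] bidual_l_def[of F "bidual_r \<phi> G"]
  proof (intro restrict_ext)
    fix m assume m: "m \<in> carrier M"
    obtain n where n: "n \<in> carrier M"
      "\<And>\<psi>. \<psi> \<in> carrier (dual M) \<Longrightarrow> G (\<lambda>b\<in>carrier A. \<psi> (l b m)) = \<psi> n"
      using left_action_representative[OF G m] by metis
    have "bidual_r \<phi> G (r m a) = \<phi> (r n a)" if a: "a \<in> carrier A" for a
    proof -
      have "(\<lambda>b\<in>carrier A. \<phi> (l b (r m a))) = (\<lambda>b\<in>carrier A. (\<lambda>y\<in>carrier M. \<phi> (r y a)) (l b m))"
        using a m by (auto simp: l_r l_closed)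
      then show ?thesis using n(2)[OF slice_right'[OF \<phi> a]] n(1) a m by (simp add: bidual_r_def r_closed)
    qed
    then have "F (\<lambda>a\<in>carrier A. bidual_r \<phi> G (r m a)) = F (\<lambda>a\<in>carrier A. \<phi> (r n a))"
      by (intro arg_cong[where f = F] restrict_ext)
    also have "\<dots> = bidual_l F \<phi> n" using n(1) by (simp add: bidual_l_def)
    also have "\<dots> = G (\<lambda>b\<in>carrier A. bidual_l F \<phi> (l b m))" using n(2)[OF bidual_l_closed[OF F \<phi>]] ..
    finally show "F (\<lambda>a\<in>carrier A. bidual_r \<phi> G (r m a)) = G (\<lambda>b\<in>carrier A. bidual_l F \<phi> (l b m))" .
  qed
next
  obtain K where K: "K \<ge> 0"
    "\<And>\<phi> a m. \<phi> \<in> carrier (dual M) \<Longrightarrow> a \<in> carrier A \<Longrightarrow> m \<in> carrier M \<Longrightarrow>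
      cmod (\<phi> (l a m)) \<le> nrm (dual M) \<phi> * K * nrm A a * nrm M m"
    "\<And>\<phi> a m. \<phi> \<in> carrier (dual M) \<Longrightarrow> a \<in> carrier A \<Longrightarrow> m \<in> carrier M \<Longrightarrow>
      cmod (\<phi> (r m a)) \<le> nrm (dual M) \<phi> * K * nrm A a * nrm M m"
    using that by (rule functional_of_actions_bound)
  interpret dA: normed_space "dual A" by (rule A.normed_space_dual)
  have "nrm (dual M) (bidual_l F \<phi>) \<le> K * nrm (dual (dual A)) F * nrm (dual M) \<phi>"
    "nrm (dual M) (bidual_r \<phi> F) \<le> K * nrm (dual (dual A)) F * nrm (dual M) \<phi>"
    if F: "F \<in> carrier (dual (dual A))" and \<phi>: "\<phi> \<in> carrier (dual M)" for F \<phi>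
  proof -
    have nn: "0 \<le> nrm (dual M) \<phi> * K" "0 \<le> K * nrm (dual (dual A)) F * nrm (dual M) \<phi>"
      using K(1) dual_nrm_nonneg[OF \<phi>] dA.dual_nrm_nonneg[OF F] by auto
    show "nrm (dual M) (bidual_l F \<phi>) \<le> K * nrm (dual (dual A)) F * nrm (dual M) \<phi>"
    proof (rule dual_nrm_le[OF nn(2)])
      fix m assume m: "m \<in> carrier M"
      show "cmod (bidual_l F \<phi> m) \<le> K * nrm (dual (dual A)) F * nrm (dual M) \<phi> * nrm M m"
        using bounded_form.apply_bidual_bound[OF bounded_form_right[OF \<phi>] F nn(1) _ m] K(3)[OF \<phi>] m
        by (simp add: bidual_l_def ac_simps)
    qed
    show "nrm (dual M) (bidual_r \<phi> F) \<le> K * nrm (dual (dual A)) F * nrm (dual M) \<phi>"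
    proof (rule dual_nrm_le[OF nn(2)])
      fix m assume m: "m \<in> carrier M"
      show "cmod (bidual_r \<phi> F m) \<le> K * nrm (dual (dual A)) F * nrm (dual M) \<phi> * nrm M m"
        using bounded_form.apply_bidual_bound[OF bounded_form_left[OF \<phi>] F nn(1) _ m] K(2)[OF \<phi>] m
        by (simp add: bidual_r_def ac_simps)
    qed
  qed
  then show "\<exists>K. \<forall>F\<in>carrier (dual (dual A)). \<forall>\<phi>\<in>carrier (dual M).
      nrm (dual M) (bidual_l F \<phi>) \<le> K * nrm (dual (dual A)) F * nrm (dual M) \<phi> \<and>
      nrm (dual M) (bidual_r \<phi> F) \<le> K * nrm (dual (dual A)) F * nrm (dual M) \<phi>" by blast
qed

text \<open>
  A functional \<open>x\<close> on \<open>M\<^sup>*\<close> is evaluation at some \<open>m\<close>. Hence \<open>x (\<phi> \<cdot> F) = F (a \<mapsto> \<phi> (a \<cdot> m))\<close> is the value of \<open>F\<close> at a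
  functional on \<open>A\<close>, and such a value is weak*-continuous in \<open>F\<close>.
\<close>

lemma normal_dual_reflexive:
  "normal_dual (second_dual A) (second_dual_predual A) (dual M) bidual_l bidual_r"
  unfolding normal_dual_def
proof (intro ballI conjI)
  interpret Y: banach_bimodule "second_dual A" "dual M" bidual_l bidual_r by (rule banach_bimodule_dual)
  fix x assume x: "x \<in> carrier (dual (dual M))"
  obtain m where m: "m \<in> carrier M" "\<And>\<phi>. \<phi> \<in> carrier (dual M) \<Longrightarrow> x \<phi> = \<phi> m"
    using bidual_representative[OF x] by metis
  let ?W = "weak_star_alg (second_dual A) (second_dual_predual A)"
  have "continuous_map ?W euclidean (\<lambda>F. dual_l (dual M) bidual_r F x \<phi>)"
    "continuous_map ?W euclidean (\<lambda>F. dual_r (dual M) bidual_l x F \<phi>)" if \<phi>: "\<phi> \<in> carrier (dual M)" for \<phi>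
    using m \<phi> bidual_l_closed bidual_r_closed
    by (auto simp: dual_l_def dual_r_def bidual_l_def bidual_r_def
        intro: continuous_map_eq[OF continuous_map_apply_functional[OF slice_left[OF \<phi> m(1)]]]
          continuous_map_eq[OF continuous_map_apply_functional[OF slice_right[OF \<phi> m(1)]]])
  then show "continuous_map ?W (weak_star (dual M)) (\<lambda>F. dual_l (dual M) bidual_r F x)"
    "continuous_map ?W (weak_star (dual M)) (dual_r (dual M) bidual_l x)"
    using Y.dual_actions_closed[OF _ x] by (auto simp: continuous_map_weak_star)
qed

end

section \<open>Module extensions\<close>

context algebra_bimodule begin

abbreviation B :: "('m \<times> 'a) normed" where "B \<equiv> module_extension M A l r"

lemma extension_simps:
  "carrier B = carrier M \<times> carrier A"
  "\<zero>\<^bsub>B\<^esub> = (\<zero>\<^bsub>M\<^esub>, \<zero>\<^bsub>A\<^esub>)"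
  "x \<oplus>\<^bsub>B\<^esub> y = (fst x \<oplus>\<^bsub>M\<^esub> fst y, snd x \<oplus>\<^bsub>A\<^esub> snd y)"
  "k \<odot>\<^bsub>B\<^esub> x = (k \<odot>\<^bsub>M\<^esub> fst x, k \<odot>\<^bsub>A\<^esub> snd x)"
  "x \<otimes>\<^bsub>B\<^esub> y = (r (fst x) (snd y) \<oplus>\<^bsub>M\<^esub> l (snd x) (fst y), snd x \<otimes>\<^bsub>A\<^esub> snd y)"
  "nrm B x = nrm M (fst x) + nrm A (snd x)"
  by (simp_all add: module_extension_def split_beta)

lemma normed_space_extension: "normed_space B"
proof -
  have "abelian_group B"
  proof (rule abelian_groupI)
    fix x assume x: "x \<in> carrier B"
    then show "\<exists>y\<in>carrier B. y \<oplus>\<^bsub>B\<^esub> x = \<zero>\<^bsub>B\<^esub>"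
      by (intro bexI[of _ "(\<ominus>\<^bsub>M\<^esub> fst x, \<ominus>\<^bsub>A\<^esub> snd x)"])
        (auto simp: extension_simps l_neg A.l_neg)
  qed (auto simp: extension_simps a_ac A.a_ac)
  then have "module complex_ring B"
    by (intro moduleI cring_complex_ring)
      (auto simp: extension_simps smult_add A.smult_add smult_right_add A.smult_right_add
        smult_smult A.smult_smult)
  then show ?thesis
  proof (intro normed_space.intro normed_space_axioms.intro)
    fix x assume x: "x \<in> carrier B"
    then have nn: "0 \<le> nrm M (fst x)" "0 \<le> nrm A (snd x)"
      by (auto simp: extension_simps nrm_nonneg A.nrm_nonneg)
    then show "0 \<le> nrm B x" by (simp add: extension_simps)
    show "x = \<zero>\<^bsub>B\<^esub>" if "nrm B x = 0"
      using x nn that by (auto simp: extension_simps intro: nrm_eq_0 A.nrm_eq_0)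
    show "nrm B (c \<odot>\<^bsub>B\<^esub> x) = cmod c * nrm B x" for c
      using x by (auto simp: extension_simps nrm_smult A.nrm_smult distrib_left)
    fix y assume y: "y \<in> carrier B"
    show "nrm B (x \<oplus>\<^bsub>B\<^esub> y) \<le> nrm B x + nrm B y"
      using x y nrm_triangle[of "fst x" "fst y"] A.nrm_triangle[of "snd x" "snd y"]
      by (auto simp: extension_simps)
  qed
qed

lemma bounded_algebra_extension: "bounded_algebra B"
proof (intro bounded_algebra.intro bounded_algebra_axioms.intro normed_space_extension)
  obtain K where K: "\<And>a m. a \<in> carrier A \<Longrightarrow> m \<in> carrier M \<Longrightarrow>
      nrm M (l a m) \<le> K * nrm A a * nrm M m \<and> nrm M (r m a) \<le> K * nrm A a * nrm M m"
    using bounded_actions by blast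
  obtain L where L: "\<And>a b. a \<in> carrier A \<Longrightarrow> b \<in> carrier A \<Longrightarrow> nrm A (a \<otimes>\<^bsub>A\<^esub> b) \<le> L * nrm A a * nrm A b"
    using A.bounded_mult by blast
  have "nrm B (x \<otimes>\<^bsub>B\<^esub> y) \<le> (\<bar>K\<bar> + \<bar>L\<bar>) * nrm B x * nrm B y" if "x \<in> carrier B" "y \<in> carrier B" for x y
  proof -
    obtain m a n b where xy: "x = (m, a)" "y = (n, b)" by (cases x, cases y)
    have c: "m \<in> carrier M" "n \<in> carrier M" "a \<in> carrier A" "b \<in> carrier A"
      using that by (auto simp: extension_simps xy)
    note nn = nrm_nonneg[OF c(1)] nrm_nonneg[OF c(2)] A.nrm_nonneg[OF c(3)] A.nrm_nonneg[OF c(4)]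
    \<comment> \<open>each product of two norms that occurs below is one of the terms of \<open>nrm B x * nrm B y\<close>\<close>
    have abs: "k * s * t \<le> (\<bar>K\<bar> + \<bar>L\<bar>) * (s * t)" if "k \<le> \<bar>K\<bar> + \<bar>L\<bar>" "0 \<le> s" "0 \<le> t" for k s t :: real
      using mult_right_mono[OF that(1), of "s * t"] that by (simp add: mult.assoc)
    have "nrm B (x \<otimes>\<^bsub>B\<^esub> y) \<le> nrm M (r m b) + nrm M (l a n) + nrm A (a \<otimes>\<^bsub>A\<^esub> b)"
      using nrm_triangle[of "r m b" "l a n"] c by (simp add: extension_simps xy l_closed r_closed)
    also have "\<dots> \<le> K * nrm A b * nrm M m + K * nrm A a * nrm M n + L * nrm A a * nrm A b"
      using K c L by (intro add_mono) auto
    also have "\<dots> \<le> (\<bar>K\<bar> + \<bar>L\<bar>) * (nrm A b * nrm M m) + (\<bar>K\<bar> + \<bar>L\<bar>) * (nrm A a * nrm M n) +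
        (\<bar>K\<bar> + \<bar>L\<bar>) * (nrm A a * nrm A b)"
      using nn by (intro add_mono abs) auto
    also have "\<dots> = (\<bar>K\<bar> + \<bar>L\<bar>) * (nrm A b * nrm M m + nrm A a * nrm M n + nrm A a * nrm A b)"
      by (simp add: distrib_left)
    also have "\<dots> \<le> (\<bar>K\<bar> + \<bar>L\<bar>) * (nrm B x * nrm B y)"
      using nn by (intro mult_left_mono) (auto simp: extension_simps xy algebra_simps)
    finally show ?thesis by (simp add: mult.assoc)
  qed
  then show "\<exists>K. \<forall>x\<in>carrier B. \<forall>y\<in>carrier B. nrm B (x \<otimes>\<^bsub>B\<^esub> y) \<le> K * nrm B x * nrm B y" by blast
next
  fix x y k assume x: "x \<in> carrier B" and y: "y \<in> carrier B"
  note c = x[unfolded extension_simps mem_Times_iff] y[unfolded extension_simps mem_Times_iff]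
  show "x \<otimes>\<^bsub>B\<^esub> y \<in> carrier B"
    using c by (simp add: extension_simps l_closed r_closed A.mult_closed)
  show "(k \<odot>\<^bsub>B\<^esub> x) \<otimes>\<^bsub>B\<^esub> y = k \<odot>\<^bsub>B\<^esub> (x \<otimes>\<^bsub>B\<^esub> y)"
    "x \<otimes>\<^bsub>B\<^esub> (k \<odot>\<^bsub>B\<^esub> y) = k \<odot>\<^bsub>B\<^esub> (x \<otimes>\<^bsub>B\<^esub> y)"
    using c by (simp_all add: extension_simps l_closed r_closed r_smult l_smult r_smult_alg l_smult_alg
      smult_right_add A.mult_smult_left A.mult_smult_right)
  fix z assume z: "z \<in> carrier B"
  note z = z[unfolded extension_simps mem_Times_iff]
  show "(x \<oplus>\<^bsub>B\<^esub> y) \<otimes>\<^bsub>B\<^esub> z = (x \<otimes>\<^bsub>B\<^esub> z) \<oplus>\<^bsub>B\<^esub> (y \<otimes>\<^bsub>B\<^esub> z)"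
    "x \<otimes>\<^bsub>B\<^esub> (y \<oplus>\<^bsub>B\<^esub> z) = (x \<otimes>\<^bsub>B\<^esub> y) \<oplus>\<^bsub>B\<^esub> (x \<otimes>\<^bsub>B\<^esub> z)"
    using c z by (simp_all add: extension_simps l_closed r_closed l_add r_add l_add_alg r_add_alg
      A.mult_add_left A.mult_add_right a_ac)
qed

lemma bounded_map_fst: "bounded_map B M fst"
  by (intro bounded_map.intro bounded_map_axioms.intro normed_space_extension normed_space_axioms exI[of _ 1])
    (auto simp: extension_simps A.nrm_nonneg)

lemma bounded_map_snd: "bounded_map B A snd"
  by (intro bounded_map.intro bounded_map_axioms.intro normed_space_extension A.normed_space_axioms exI[of _ 1])
    (auto simp: extension_simps nrm_nonneg)

lemma bounded_map_Pair_zero: "bounded_map A B (\<lambda>a. (\<zero>\<^bsub>M\<^esub>, a))"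
  by (intro bounded_map.intro bounded_map_axioms.intro normed_space_extension A.normed_space_axioms exI[of _ 1])
    (auto simp: extension_simps)

lemma bounded_map_zero_Pair: "bounded_map M B (\<lambda>m. (m, \<zero>\<^bsub>A\<^esub>))"
  by (intro bounded_map.intro bounded_map_axioms.intro normed_space_extension normed_space_axioms exI[of _ 1])
    (auto simp: extension_simps)

abbreviation bidual_fst :: "(('m \<times> 'a \<Rightarrow> complex) \<Rightarrow> complex) \<Rightarrow> ('m \<Rightarrow> complex) \<Rightarrow> complex" where
  "bidual_fst \<equiv> second_adjoint B M fst"

abbreviation bidual_snd :: "(('m \<times> 'a \<Rightarrow> complex) \<Rightarrow> complex) \<Rightarrow> ('a \<Rightarrow> complex) \<Rightarrow> complex" where
  "bidual_snd \<equiv> second_adjoint B A snd"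

lemmas bidual_fst_closed = bounded_map.second_adjoint_closed[OF bounded_map_fst]
  and bidual_snd_closed = bounded_map.second_adjoint_closed[OF bounded_map_snd]
  and adjoint_fst_closed = bounded_map.adjoint_closed[OF bounded_map_fst]
  and adjoint_snd_closed = bounded_map.adjoint_closed[OF bounded_map_snd]

lemma functional_decomposition:
  assumes f: "f \<in> carrier (dual B)"
  obtains \<phi> g where "\<phi> \<in> carrier (dual M)" "g \<in> carrier (dual A)"
    "f = adjoint B fst \<phi> \<oplus>\<^bsub>dual B\<^esub> adjoint B snd g"
proof
  show "adjoint M (\<lambda>m. (m, \<zero>\<^bsub>A\<^esub>)) f \<in> carrier (dual M)"
    by (rule bounded_map.adjoint_closed[OF bounded_map_zero_Pair f])
  show "adjoint A (\<lambda>a. (\<zero>\<^bsub>M\<^esub>, a)) f \<in> carrier (dual A)"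
    by (rule bounded_map.adjoint_closed[OF bounded_map_Pair_zero f])
  show "f = adjoint B fst (adjoint M (\<lambda>m. (m, \<zero>\<^bsub>A\<^esub>)) f) \<oplus>\<^bsub>dual B\<^esub>
      adjoint B snd (adjoint A (\<lambda>a. (\<zero>\<^bsub>M\<^esub>, a)) f)"
    unfolding dual_simps(1)
  proof (rule extensionalityI[OF dualD(1)[OF f] restrict_extensional])
    fix x assume x: "x \<in> carrier B"
    then have "f x = f (fst x, \<zero>\<^bsub>A\<^esub>) + f (\<zero>\<^bsub>M\<^esub>, snd x)"
      using dualD(2)[OF f, of "(fst x, \<zero>\<^bsub>A\<^esub>)" "(\<zero>\<^bsub>M\<^esub>, snd x)"] by (auto simp: extension_simps)
    then show "f x = (\<lambda>x\<in>carrier B. adjoint B fst (adjoint M (\<lambda>m. (m, \<zero>\<^bsub>A\<^esub>)) f) x +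
        adjoint B snd (adjoint A (\<lambda>a. (\<zero>\<^bsub>M\<^esub>, a)) f) x) x"
      using x by (auto simp: adjoint_def extension_simps(1))
  qed
qed

end

context reflexive_bimodule begin

lemma functional_add:
  assumes "F \<in> carrier (dual (dual B))" "\<phi> \<in> carrier (dual M)" "g \<in> carrier (dual A)"
    "\<And>m a. m \<in> carrier M \<Longrightarrow> a \<in> carrier A \<Longrightarrow> h (m, a) = \<phi> m + g a"
  shows "F (\<lambda>x\<in>carrier B. h x) = bidual_fst F \<phi> + bidual_snd F g"
proof -
  have "(\<lambda>x\<in>carrier B. h x) = adjoint B fst \<phi> \<oplus>\<^bsub>dual B\<^esub> adjoint B snd g"
    unfolding dual_simps(1)
  proof (rule restrict_ext)
    show "h x = adjoint B fst \<phi> x + adjoint B snd g x" if "x \<in> carrier B" for x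
      using that assms(4)[of "fst x" "snd x"] by (auto simp: adjoint_def extension_simps(1))
  qed
  then show ?thesis
    unfolding second_adjoint_apply[OF assms(2)] second_adjoint_apply[OF assms(3)]
    by (simp only: dualD(2)[OF assms(1) adjoint_fst_closed[OF assms(2)] adjoint_snd_closed[OF assms(3)]])
qed

text \<open>
  At \<open>x = (m, a)\<close> and \<open>y = (n, b)\<close> the functional \<open>\<phi> \<circ> fst\<close> takes the value \<open>\<phi> (m \<cdot> b) + \<phi> (a \<cdot> n)\<close> on the product.
  In each summand one of the variables lies in \<open>M\<close>, and there \<open>F\<close> or \<open>G\<close> acts as evaluation at a point \<open>m\<^sub>0\<close> or
  \<open>n\<^sub>0\<close> of \<open>M\<close>. Therefore the order in which \<open>F\<close> and \<open>G\<close> are applied does not matter. The common value also says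
  that \<open>bidual_fst\<close> is a derivation.
\<close>

lemma arens_adjoint_fst:
  assumes F: "F \<in> carrier (dual (dual B))" and G: "G \<in> carrier (dual (dual B))"
    and \<phi>: "\<phi> \<in> carrier (dual M)"
  shows "arens_first B F G (adjoint B fst \<phi>) =
      bidual_fst F (bidual_l (bidual_snd G) \<phi>) + bidual_fst G (bidual_r \<phi> (bidual_snd F))"
    and "arens_second B F G (adjoint B fst \<phi>) =
      bidual_fst F (bidual_l (bidual_snd G) \<phi>) + bidual_fst G (bidual_r \<phi> (bidual_snd F))"
proof -
  obtain m\<^sub>0 where m\<^sub>0: "m\<^sub>0 \<in> carrier M" "\<And>\<psi>. \<psi> \<in> carrier (dual M) \<Longrightarrow> bidual_fst F \<psi> = \<psi> m\<^sub>0"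
    using bidual_representative[OF bidual_fst_closed[OF F]] by metis
  obtain n\<^sub>0 where n\<^sub>0: "n\<^sub>0 \<in> carrier M" "\<And>\<psi>. \<psi> \<in> carrier (dual M) \<Longrightarrow> bidual_fst G \<psi> = \<psi> n\<^sub>0"
    using bidual_representative[OF bidual_fst_closed[OF G]] by metis
  let ?f = "adjoint B fst \<phi>"
  note PF = bidual_snd_closed[OF F] and PG = bidual_snd_closed[OF G]
  note Lc = bidual_l_closed[OF PG \<phi>] and Rc = bidual_r_closed[OF PF \<phi>]
  have f: "?f (x \<otimes>\<^bsub>B\<^esub> y) = \<phi> (r (fst x) (snd y)) + \<phi> (l (snd x) (fst y))"
    if "x \<in> carrier B" "y \<in> carrier B" for x y
    using that by (auto simp: adjoint_def extension_simps A.mult_closed l_closed r_closed dualD(2)[OF \<phi>])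
  have slice: "G (\<lambda>y\<in>carrier B. ?f (x \<otimes>\<^bsub>B\<^esub> y)) =
      bidual_l (bidual_snd G) \<phi> (fst x) + \<phi> (l (snd x) n\<^sub>0)" if x: "x \<in> carrier B" for x
  proof -
    have c: "fst x \<in> carrier M" "snd x \<in> carrier A" using x by (auto simp: extension_simps)
    have "G (\<lambda>y\<in>carrier B. ?f (x \<otimes>\<^bsub>B\<^esub> y)) =
        bidual_fst G (\<lambda>n\<in>carrier M. \<phi> (l (snd x) n)) + bidual_snd G (\<lambda>b\<in>carrier A. \<phi> (r (fst x) b))"
    proof (rule functional_add[OF G slice_left'[OF \<phi> c(2)] slice_right[OF \<phi> c(1)]])
      fix n b assume "n \<in> carrier M" "b \<in> carrier A"
      then show "?f (x \<otimes>\<^bsub>B\<^esub> (n, b)) =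
          (\<lambda>n\<in>carrier M. \<phi> (l (snd x) n)) n + (\<lambda>b\<in>carrier A. \<phi> (r (fst x) b)) b"
        using f[OF x, of "(n, b)"] by (simp add: extension_simps)
    qed
    then show ?thesis
      using n\<^sub>0 slice_left'[OF \<phi> c(2)] c by (simp add: bidual_l_def)
  qed
  have "F (\<lambda>x\<in>carrier B. G (\<lambda>y\<in>carrier B. ?f (x \<otimes>\<^bsub>B\<^esub> y))) =
      bidual_fst F (bidual_l (bidual_snd G) \<phi>) + bidual_snd F (\<lambda>a\<in>carrier A. \<phi> (l a n\<^sub>0))"
    by (intro functional_add[OF F Lc slice_left[OF \<phi> n\<^sub>0(1)]]) (subst slice, simp_all add: extension_simps(1))
  moreover have "bidual_fst G (bidual_r \<phi> (bidual_snd F)) = bidual_snd F (\<lambda>a\<in>carrier A. \<phi> (l a n\<^sub>0))"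
    using n\<^sub>0 Rc by (simp add: bidual_r_def)
  ultimately show "arens_first B F G ?f =
      bidual_fst F (bidual_l (bidual_snd G) \<phi>) + bidual_fst G (bidual_r \<phi> (bidual_snd F))"
    using adjoint_fst_closed[OF \<phi>] by (simp add: arens_first_def)
  have slice: "F (\<lambda>x\<in>carrier B. ?f (x \<otimes>\<^bsub>B\<^esub> y)) =
      bidual_r \<phi> (bidual_snd F) (fst y) + \<phi> (r m\<^sub>0 (snd y))" if y: "y \<in> carrier B" for y
  proof -
    have c: "fst y \<in> carrier M" "snd y \<in> carrier A" using y by (auto simp: extension_simps)
    have "F (\<lambda>x\<in>carrier B. ?f (x \<otimes>\<^bsub>B\<^esub> y)) =
        bidual_fst F (\<lambda>m\<in>carrier M. \<phi> (r m (snd y))) + bidual_snd F (\<lambda>a\<in>carrier A. \<phi> (l a (fst y)))"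
    proof (rule functional_add[OF F slice_right'[OF \<phi> c(2)] slice_left[OF \<phi> c(1)]])
      fix m a assume "m \<in> carrier M" "a \<in> carrier A"
      then show "?f ((m, a) \<otimes>\<^bsub>B\<^esub> y) =
          (\<lambda>m\<in>carrier M. \<phi> (r m (snd y))) m + (\<lambda>a\<in>carrier A. \<phi> (l a (fst y))) a"
        using f[OF _ y, of "(m, a)"] by (simp add: extension_simps)
    qed
    then show ?thesis
      using m\<^sub>0 slice_right'[OF \<phi> c(2)] c by (simp add: bidual_r_def)
  qed
  have "G (\<lambda>y\<in>carrier B. F (\<lambda>x\<in>carrier B. ?f (x \<otimes>\<^bsub>B\<^esub> y))) =
      bidual_fst G (bidual_r \<phi> (bidual_snd F)) + bidual_snd G (\<lambda>a\<in>carrier A. \<phi> (r m\<^sub>0 a))"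
    by (intro functional_add[OF G Rc slice_right[OF \<phi> m\<^sub>0(1)]]) (subst slice, simp_all add: extension_simps(1))
  moreover have "bidual_fst F (bidual_l (bidual_snd G) \<phi>) = bidual_snd G (\<lambda>a\<in>carrier A. \<phi> (r m\<^sub>0 a))"
    using m\<^sub>0 Lc by (simp add: bidual_l_def)
  ultimately show "arens_second B F G ?f =
      bidual_fst F (bidual_l (bidual_snd G) \<phi>) + bidual_fst G (bidual_r \<phi> (bidual_snd F))"
    using adjoint_fst_closed[OF \<phi>] by (simp add: arens_second_def)
qed

text \<open>
  A functional on \<open>B\<close> is a sum \<open>\<phi> \<circ> fst + g \<circ> snd\<close>. On \<open>g \<circ> snd\<close> the Arens products of \<open>B\<close> are those of \<open>A\<close>, which
  agree by assumption; on \<open>\<phi> \<circ> fst\<close> they agree by the exchange of limits above.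
\<close>

theorem arens_regular_extension:
  assumes reg: "arens_regular A"
  shows "arens_regular B"
  unfolding arens_regular_def
proof (intro ballI)
  interpret B: bounded_algebra B by (rule bounded_algebra_extension)
  fix F G assume F: "F \<in> carrier (dual (dual B))" and G: "G \<in> carrier (dual (dual B))"
  have hom: "snd (x \<otimes>\<^bsub>B\<^esub> y) = snd x \<otimes>\<^bsub>A\<^esub> snd y" for x y by (simp add: extension_simps)
  have snd: "arens_first B F G (adjoint B snd g) = arens_second B F G (adjoint B snd g)"
    if g: "g \<in> carrier (dual A)" for g
  proof -
    note arens = second_adjoint_arens[OF bounded_map_snd bounded_algebra_extension A.bounded_algebra_axioms _ F G, OF hom]
    have "bidual_snd (arens_first B F G) g = bidual_snd (arens_second B F G) g"
      unfolding arens using reg bidual_snd_closed[OF F] bidual_snd_closed[OF G] by (simp add: arens_regular_def)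
    then show ?thesis using g by (simp add: second_adjoint_apply)
  qed
  have "arens_first B F G f = arens_second B F G f" if f: "f \<in> carrier (dual B)" for f
  proof -
    obtain \<phi> g where \<phi>: "\<phi> \<in> carrier (dual M)" and g: "g \<in> carrier (dual A)"
      and fe: "f = adjoint B fst \<phi> \<oplus>\<^bsub>dual B\<^esub> adjoint B snd g"
      by (rule functional_decomposition[OF f])
    show ?thesis
      using dualD(2)[OF B.arens_first_closed[OF F G] adjoint_fst_closed[OF \<phi>] adjoint_snd_closed[OF g]]
        B.arens_second_add[OF F G adjoint_fst_closed[OF \<phi>] adjoint_snd_closed[OF g]]
        snd[OF g] arens_adjoint_fst[OF F G \<phi>] by (simp add: fe)
  qed
  note eq = this
  have "arens_first B F G \<in> extensional (carrier (dual B))" "arens_second B F G \<in> extensional (carrier (dual B))"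
    unfolding arens_first_def arens_second_def by (rule restrict_extensional)+
  from extensionalityI[OF this eq] show "arens_first B F G = arens_second B F G" .
qed

lemma dual_homomorphism_snd:
  "dual_homomorphism (second_dual B) (second_dual_predual B) (second_dual A) (second_dual_predual A) bidual_snd"
proof (rule dual_homomorphism_second_adjoint[OF bounded_map_snd bounded_algebra_extension A.bounded_algebra_axioms])
  show "snd (x \<otimes>\<^bsub>B\<^esub> y) = snd x \<otimes>\<^bsub>A\<^esub> snd y" for x y by (simp add: extension_simps)
qed

text \<open>
  The derivation \<open>bidual_fst\<close> from \<open>B\<^sup>*\<^sup>*\<close> to \<open>M\<^sup>*\<^sup>* = (M\<^sup>*)\<^sup>*\<close> maps the image of \<open>(m, 0)\<close> to evaluation at \<open>m\<close>. But
  \<open>bidual_snd\<close> kills that image, so it acts as \<open>0\<close> on \<open>M\<^sup>*\<close> and every inner derivation vanishes there.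
\<close>

theorem connes_amenable_extension_imp_trivial:
  assumes ca: "connes_amenable (second_dual B) (second_dual_predual B)"
  shows "carrier M = {\<zero>\<^bsub>M\<^esub>}"
proof -
  interpret B: bounded_algebra B by (rule bounded_algebra_extension)
  interpret fst'': bounded_map "dual (dual B)" "dual (dual M)" bidual_fst
    by (rule bounded_map.bounded_map_second_adjoint[OF bounded_map_fst])
  interpret h: dual_homomorphism "second_dual B" "second_dual_predual B" "second_dual A"
    "second_dual_predual A" bidual_snd by (rule dual_homomorphism_snd)
  let ?l = "\<lambda>F. bidual_l (bidual_snd F)" and ?r = "\<lambda>\<phi> F. bidual_r \<phi> (bidual_snd F)"
  interpret Y: banach_bimodule "second_dual B" "dual M" ?l ?r
    by (rule h.pullback_bimodule[OF banach_bimodule_dual])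
  have "derivation (second_dual B) (dual M) ?l ?r bidual_fst"
    unfolding derivation_def second_dual_simps
  proof (intro conjI ballI allI)
    fix F G assume F: "F \<in> carrier (dual (dual B))" and G: "G \<in> carrier (dual (dual B))"
    show "bidual_fst (arens_first B F G) =
      dual_r (dual M) ?l (bidual_fst F) G \<oplus>\<^bsub>dual (dual M)\<^esub> dual_l (dual M) ?r F (bidual_fst G)"
    proof (rule dual_eqI[OF bidual_fst_closed[OF B.arens_first_closed[OF F G]]])
      show "dual_r (dual M) ?l (bidual_fst F) G \<oplus>\<^bsub>dual (dual M)\<^esub> dual_l (dual M) ?r F (bidual_fst G)
          \<in> carrier (dual (dual M))"
        by (rule fst''.W.a_closed[OF Y.dual_actions_closed(2) Y.dual_actions_closed(1)])
          (simp_all add: F G fst''.closed)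
      show "bidual_fst (arens_first B F G) \<phi> =
          (dual_r (dual M) ?l (bidual_fst F) G \<oplus>\<^bsub>dual (dual M)\<^esub> dual_l (dual M) ?r F (bidual_fst G)) \<phi>"
        if "\<phi> \<in> carrier (dual M)" for \<phi>
      proof -
        have "bidual_fst (arens_first B F G) \<phi> = bidual_fst F (?l G \<phi>) + bidual_fst G (?r \<phi> F)"
          unfolding second_adjoint_apply[OF that] by (rule arens_adjoint_fst(1)[OF F G that, unfolded second_adjoint_apply[OF that]])
        then show ?thesis using that by (simp add: dual_simps(1) dual_l_def dual_r_def)
      qed
    qed
  qed (fact fst''.closed fst''.add fst''.smult)+
  moreover have "continuous_map (weak_star_alg (second_dual B) (second_dual_predual B)) (weak_star (dual M)) bidual_fst"
    unfolding continuous_map_weak_star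
    by (simp add: fst''.closed second_adjoint_apply continuous_map_apply_functional adjoint_fst_closed)
  moreover have "connes_amenable_over TYPE('m \<Rightarrow> complex) (second_dual B) (second_dual_predual B)"
    by (rule B.connes_amenable_second_dual_over[OF ca])
  ultimately have "inner_derivation (second_dual B) (dual M) ?l ?r bidual_fst"
    using connes_amenable_overD[OF _ Y.banach_bimodule_axioms h.pullback_normal[OF normal_dual_reflexive]]
    by simp
  then obtain x where x: "x \<in> carrier (dual (dual M))"
    and inner: "\<And>F. F \<in> carrier (dual (dual B)) \<Longrightarrow>
      bidual_fst F = dual_l (dual M) ?r F x \<ominus>\<^bsub>dual (dual M)\<^esub> dual_r (dual M) ?l x F"
    unfolding inner_derivation_def second_dual_simps by blast
  have "m = \<zero>\<^bsub>M\<^esub>" if m: "m \<in> carrier M" for m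
  proof (rule functionals_separate[OF m])
    fix \<phi> assume \<phi>: "\<phi> \<in> carrier (dual M)"
    define F where "F = canonical B (m, \<zero>\<^bsub>A\<^esub>)"
    have mB: "(m, \<zero>\<^bsub>A\<^esub>) \<in> carrier B" using m by (simp add: extension_simps)
    have F: "F \<in> carrier (dual (dual B))" unfolding F_def by (rule B.canonical_closed[OF mB])
    have "g \<zero>\<^bsub>A\<^esub> = 0" if "g \<in> carrier (dual A)" for g
      using dualD(3)[OF that, of "\<zero>\<^bsub>A\<^esub>" 0] by simp
    then have zero: "bidual_snd F g = 0" if "g \<in> carrier (dual A)" for g
      using that mB adjoint_snd_closed[OF that] by (simp add: F_def second_adjoint_apply canonical_def) (simp add: adjoint_def)
    have "?r \<phi> F = \<zero>\<^bsub>dual M\<^esub>" "?l F \<phi> = \<zero>\<^bsub>dual M\<^esub>"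
      unfolding bidual_l_def bidual_r_def dual_simps
      by (rule restrict_ext, rule zero, erule slice_left[OF \<phi>] slice_right[OF \<phi>])+
    moreover have "x \<zero>\<^bsub>dual M\<^esub> = 0" using dualD(3)[OF x, of "\<zero>\<^bsub>dual M\<^esub>" 0] by simp
    moreover have "(dual_l (dual M) ?r F x \<ominus>\<^bsub>dual (dual M)\<^esub> dual_r (dual M) ?l x F) \<phi> = x (?r \<phi> F) - x (?l F \<phi>)"
      using Y.dual_actions_closed[of F x] F x \<phi> by (simp add: Y.dual_minus) (simp add: dual_l_def dual_r_def)
    ultimately have "bidual_fst F \<phi> = 0" using inner[OF F] by simp
    then show "\<phi> m = 0"
      using \<phi> mB adjoint_fst_closed[OF \<phi>] by (simp add: F_def second_adjoint_apply canonical_def) (simp add: adjoint_def)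
  qed
  then show ?thesis by auto
qed

end

theorem theorem2p1:
  fixes A :: "'a normed" and M :: "'m normed"
    and l :: "'a \<Rightarrow> 'm \<Rightarrow> 'm" and r :: "'m \<Rightarrow> 'a \<Rightarrow> 'm"
  assumes "banach_algebra A" and "arens_regular A"
    and "banach_bimodule A M l r" and "reflexive M"
  shows "arens_regular (module_extension M A l r) \<and>
    (connes_amenable (second_dual (module_extension M A l r))
        (second_dual_predual (module_extension M A l r))
      \<longleftrightarrow> carrier M = {\<zero>\<^bsub>M\<^esub>} \<and> connes_amenable (second_dual A) (second_dual_predual A))"
proof -
  interpret reflexive_bimodule A M l r
    using assms banach_algebra.bounded_algebra[OF assms(1)]
    by (intro reflexive_bimodule.intro algebra_bimodule.intro reflexive_bimodule_axioms.intro)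
  interpret B: bounded_algebra B by (rule bounded_algebra_extension)
  let ?A = "second_dual A" and ?B = "second_dual B"
  have reg: "arens_regular B" by (rule arens_regular_extension[OF assms(2)])
  have "connes_amenable ?A (second_dual_predual A)" if "connes_amenable ?B (second_dual_predual B)"
  proof -
    \<comment> \<open>the type of the modules by which \<open>A\<^sup>*\<^sup>*\<close> is tested; they are pulled back to \<open>B\<^sup>*\<^sup>*\<close>\<close>
    have "connes_amenable_over TYPE((('a \<Rightarrow> complex) \<Rightarrow> complex) sequence_code) ?B (second_dual_predual B)"
      by (rule B.connes_amenable_second_dual_over[OF that])
    moreover have "bidual_snd ` carrier ?B = carrier ?A"
    proof -
      have "bidual_snd (second_adjoint A B (\<lambda>a. (\<zero>\<^bsub>M\<^esub>, a)) G) = G" if "G \<in> carrier (dual (dual A))" for G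
        by (rule bounded_map.second_adjoint_right_inverse[OF bounded_map_snd bounded_map_Pair_zero _ that]) simp
      then show ?thesis
        using bidual_snd_closed bounded_map.second_adjoint_closed[OF bounded_map_Pair_zero]
        by (auto intro!: image_eqI[OF sym])
    qed
    ultimately have "connes_amenable_over TYPE((('a \<Rightarrow> complex) \<Rightarrow> complex) sequence_code) ?A (second_dual_predual A)"
      by (rule dual_homomorphism.connes_amenable_over_image[OF dual_homomorphism_snd])
    then show ?thesis using A.is_predual_second_dual[OF assms(2)] by (simp add: connes_amenable_def)
  qed
  moreover have "connes_amenable ?B (second_dual_predual B)"
    if zero: "carrier M = {\<zero>\<^bsub>M\<^esub>}" and ca: "connes_amenable ?A (second_dual_predual A)"
  proof -
    let ?i = "\<lambda>a. (\<zero>\<^bsub>M\<^esub>, a)" and ?U = "TYPE((('m \<times> 'a \<Rightarrow> complex) \<Rightarrow> complex) sequence_code)"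
    have "?i (a \<otimes>\<^bsub>A\<^esub> b) = ?i a \<otimes>\<^bsub>B\<^esub> ?i b" if "a \<in> carrier A" "b \<in> carrier A" for a b
      using that by (simp add: extension_simps l_zero r_zero')
    then have hom: "dual_homomorphism ?A (second_dual_predual A) ?B (second_dual_predual B) (second_adjoint A B ?i)"
      by (rule dual_homomorphism_second_adjoint[OF bounded_map_Pair_zero A.bounded_algebra_axioms bounded_algebra_extension])
    have "connes_amenable_over ?U ?A (second_dual_predual A)"
      by (rule A.connes_amenable_second_dual_over[OF ca])
    moreover have "second_adjoint A B ?i ` carrier ?A = carrier ?B"
    proof -
      have "second_adjoint A B ?i (bidual_snd G) = G" if "G \<in> carrier (dual (dual B))" for G
        by (rule bounded_map.second_adjoint_right_inverse[OF bounded_map_Pair_zero bounded_map_snd _ that])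
          (use zero in \<open>auto simp: extension_simps\<close>)
      then show ?thesis
        using bidual_snd_closed bounded_map.second_adjoint_closed[OF bounded_map_Pair_zero]
        by (auto intro!: image_eqI[OF sym])
    qed
    ultimately have "connes_amenable_over ?U ?B (second_dual_predual B)"
      by (rule dual_homomorphism.connes_amenable_over_image[OF hom])
    then show ?thesis using B.is_predual_second_dual[OF reg] by (simp add: connes_amenable_def)
  qed
  ultimately show ?thesis using reg connes_amenable_extension_imp_trivial by blast
qed

end
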